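(* For the channel with coefficients $\{\alpha_\ell\}$ described in the context: i) if $\displaystyle\liminf_{\ell\to\infty}\frac{\alpha_{\ell+1}}{\alpha_\ell}>0$, then $\displaystyle\sup_{\mathrm{SNR}>0}C_{\mathrm{FB}}(\mathrm{SNR})<\infty$; ii) if $\displaystyle\limsup_{\ell\to\infty}\frac{\alpha_{\ell+1}}{\alpha_\ell}=0$, then $\displaystyle\sup_{\mathrm{SNR}>0}C(\mathrm{SNR})=\infty$; where, for any $a>0$, $a/0$ is defined to be $\infty$, and $0/0$ is defined to be $0$.
   Context: Notation: $A_m^n$ stands for $A_m,\dots,A_n$; $\log$ is the natural logarithm; $h$ is differential entropy. Channel model. Fix $\sigma^2>0$ and real coefficients $\alpha_\ell$, $\ell\in\{1,2,\dots\}$, with $\alpha_\ell\ge 0$ and $\sup_{\ell\ge1}\alpha_\ell<\infty$ (the $\alpha_\ell$ need not be summable). Let $\{U_k\}_{k\in\mathbb{Z}}$ be a real-valued, zero-mean, unit-variance, stationary, weakly-mixing random process, drawn independently of the message $M$, with $\mathsf{E}[U_k^4]<\infty$ and finite differential entropy rate, $h(U_k\mid U_{-\infty}^{k-1})>-\infty$ (the process need not be IID). Conditional on inputs $X_1=x_1,\dots,X_k=x_k\in\mathbb{R}$, the time-$k$ channel output is $$Y_k=x_k+\sqrt{\sigma^2+\sum_{\ell=1}^{k-1}\alpha_{k-\ell}x_\ell^2}\;\cdot U_k,\qquad k=1,2,\dots$$ Codes. A code of block-length $n$ has a finite message set $\mathcal{M}_n$, with the message $M$ uniform on $\mathcal{M}_n$.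 Without feedback the encoder is a map $\phi_n:\mathcal{M}_n\to\mathbb{R}^n$ with $X_1^n=\phi_n(M)$. With feedback the encoder consists of maps $\varphi_n^{(k)}:\mathcal{M}_n\times\mathbb{R}^{k-1}\to\mathbb{R}$ with $X_k=\varphi_n^{(k)}(M,Y_1^{k-1})$, $k=1,\dots,n$. In both cases the decoder is a map $\psi_n:\mathbb{R}^n\to\mathcal{M}_n$ with $\hat M=\psi_n(Y_1^n)$. The encoder must satisfy the average-power constraint $\frac1n\sum_{k=1}^n\mathsf{E}[X_k^2]\le\mathsf{P}$ (expectation over the message and the channel outputs). With $\sigma^2$ fixed, $\mathrm{SNR}=\mathsf{P}/\sigma^2$. Capacity. The rate of a code is $\frac1n\log|\mathcal{M}_n|$ (nats per channel use). A rate $R$ is achievable if there is a sequence of codes satisfying the power constraint with rates at least $R$ asymptotically (i.e. $\liminf_n\frac1n\log|\mathcal{M}_n|\ge R$) and $\Pr(\hat M\ne M)\to0$ as $n\to\infty$. $C(\mathrm{SNR})$ is the supremum of achievable rates without feedback, and $C_{\mathrm{FB}}(\mathrm{SNR})$ is the supremum of achievable rates with feedback. *)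

theory Defs
  imports "HOL-Probability.Probability"
begin

text \<open>
  Conditional differential entropy \<open>h(X | Y)\<close> in nats, extended-real valued: minus the expected
  logarithm of the conditional density of \<open>X\<close> given \<open>Y\<close>, i.e. of the density of the joint law with
  respect to (Lebesgue measure) x (law of \<open>Y\<close>); it is \<open>-\<infinity>\<close> if there is no such density. The random
  element \<open>Y\<close> may take values in any measurable space \<open>N\<close>, in particular it may be an infinite past.
  The expectation is split into its positive and negative parts; the positive part is finite
  whenever \<open>X\<close> has a finite second moment, so the case \<open>\<infinity> - \<infinity>\<close> does not arise below.
\<close>
definition cond_diff_entropy ::
  "'a measure \<Rightarrow> 'b measure \<Rightarrow> ('a \<Rightarrow> real) \<Rightarrow> ('a \<Rightarrow> 'b) \<Rightarrow> ereal" where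
  "cond_diff_entropy \<Omega> N X Y =
    (let J = distr \<Omega> (lborel \<Otimes>\<^sub>M N) (\<lambda>\<omega>. (X \<omega>, Y \<omega>));
         Q = lborel \<Otimes>\<^sub>M distr \<Omega> N Y;
         f = (\<lambda>z. enn2real (RN_deriv Q J z))
     in if absolutely_continuous Q J
        then enn2ereal (\<integral>\<^sup>+ z. ennreal (- ln (f z)) \<partial>J) - enn2ereal (\<integral>\<^sup>+ z. ennreal (ln (f z)) \<partial>J)
        else - \<infinity>)"

abbreviation path_space :: "(int \<Rightarrow> real) measure" where
  "path_space \<equiv> Pi\<^sub>M UNIV (\<lambda>_. borel)"

definition stationary_process :: "'a measure \<Rightarrow> (int \<Rightarrow> 'a \<Rightarrow> real) \<Rightarrow> bool" where
  "stationary_process \<Omega> U \<longleftrightarrow>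
    (\<forall>k::int. distr \<Omega> path_space (\<lambda>\<omega> i. U (i + k) \<omega>) = distr \<Omega> path_space (\<lambda>\<omega> i. U i \<omega>))"

text \<open>Weak mixing of the shift on path space under the law of the process.\<close>
definition weakly_mixing_process :: "'a measure \<Rightarrow> (int \<Rightarrow> 'a \<Rightarrow> real) \<Rightarrow> bool" where
  "weakly_mixing_process \<Omega> U \<longleftrightarrow>
    (\<forall>A \<in> sets path_space. \<forall>B \<in> sets path_space.
      (\<lambda>n. (\<Sum>k<n.
          \<bar>measure \<Omega> {\<omega> \<in> space \<Omega>. (\<lambda>i. U i \<omega>) \<in> A \<and> (\<lambda>i. U (i + int k) \<omega>) \<in> B}
            - measure \<Omega> {\<omega> \<in> space \<Omega>. (\<lambda>i. U i \<omega>) \<in> A}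
              * measure \<Omega> {\<omega> \<in> space \<Omega>. (\<lambda>i. U i \<omega>) \<in> B}\<bar>) / real n)
        \<longlonglongrightarrow> 0)"

locale noise_process = prob_space \<Omega> for \<Omega> :: "'a measure" +
  fixes U :: "int \<Rightarrow> 'a \<Rightarrow> real"
  assumes random_variable_U: "\<And>k. random_variable borel (U k)"
    and fourth_moment: "\<And>k. integrable \<Omega> (\<lambda>\<omega>. U k \<omega> ^ 4)"
    and zero_mean: "\<And>k. expectation (U k) = 0"
    and unit_variance: "\<And>k. variance (U k) = 1"
    and stationary: "stationary_process \<Omega> U"
    and weakly_mixing: "weakly_mixing_process \<Omega> U"
    and entropy_rate: "\<And>k. cond_diff_entropy \<Omega> (Pi\<^sub>M {..<k} (\<lambda>_. borel))
                              (U k) (\<lambda>\<omega>. \<lambda>i\<in>{..<k}. U i \<omega>) > - \<infinity>"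

text \<open>Times run over \<open>1, 2, \<dots>\<close>; the values \<open>x 0\<close>, \<open>u 0\<close> and \<open>\<alpha> 0\<close> are never used.\<close>
definition channel_output ::
  "real \<Rightarrow> (nat \<Rightarrow> real) \<Rightarrow> (nat \<Rightarrow> real) \<Rightarrow> (nat \<Rightarrow> real) \<Rightarrow> nat \<Rightarrow> real" where
  "channel_output \<sigma> \<alpha> u x k =
    x k + sqrt (\<sigma>\<^sup>2 + (\<Sum>l=1..<k. \<alpha> (k - l) * (x l)\<^sup>2)) * u k"

lemma channel_output_cong [fundef_cong]:
  assumes "\<sigma> = \<sigma>'" "\<alpha> = \<alpha>'" "u = u'" "k = k'" "\<And>l. l \<le> k' \<Longrightarrow> x l = x' l"
  shows "channel_output \<sigma> \<alpha> u x k = channel_output \<sigma>' \<alpha>' u' x' k'"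
  using assms by (auto simp: channel_output_def intro!: sum.cong)

lemma restrict_fundef_cong [fundef_cong]:
  assumes "I = J" "\<And>i. i \<in> J \<Longrightarrow> f i = g i"
  shows "restrict f I = restrict g J"
  using assms by auto

text \<open>
  Channel inputs produced by the feedback encoder of one fixed message: \<open>\<phi> k\<close> is applied to the
  past outputs \<open>(y\<^sub>1, \<dots>, y\<^sub>k\<^sub>-\<^sub>1)\<close>, a function on \<open>{1..<k}\<close>.
\<close>
function fb_input ::
  "real \<Rightarrow> (nat \<Rightarrow> real) \<Rightarrow> (nat \<Rightarrow> (nat \<Rightarrow> real) \<Rightarrow> real) \<Rightarrow> (nat \<Rightarrow> real) \<Rightarrow> nat \<Rightarrow> real" where
  "fb_input \<sigma> \<alpha> \<phi> u k =
    \<phi> k (\<lambda>i\<in>{1..<k}. channel_output \<sigma> \<alpha> u (\<lambda>l. fb_input \<sigma> \<alpha> \<phi> u l) i)"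
  by pat_completeness auto
termination
  by (relation "Wellfounded.measure (\<lambda>(_, _, _, _, k). k)") auto

declare fb_input.simps [simp del]

text \<open>
  Joint space of a message uniform on \<open>W\<close> and the noise, independent of each other. Below, the
  channel inputs of a code are random variables \<open>X k\<close> on this space.
\<close>
abbreviation msg_noise :: "nat set \<Rightarrow> 'a measure \<Rightarrow> (nat \<times> 'a) measure" where
  "msg_noise W \<Omega> \<equiv> uniform_count_measure W \<Otimes>\<^sub>M \<Omega>"

text \<open>
  The second moments are Lebesgue integrals of nonnegative functions, so inputs with infinite
  second moment violate the constraint.
\<close>
definition power_constraint ::
  "'a measure \<Rightarrow> real \<Rightarrow> nat \<Rightarrow> nat set \<Rightarrow> (nat \<Rightarrow> nat \<times> 'a \<Rightarrow> real) \<Rightarrow> bool" where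
  "power_constraint \<Omega> P n W X \<longleftrightarrow>
    (\<Sum>k=1..n. \<integral>\<^sup>+ p. ennreal ((X k p)\<^sup>2) \<partial>msg_noise W \<Omega>) / of_nat n \<le> ennreal P"

definition error_prob ::
  "'a measure \<Rightarrow> (int \<Rightarrow> 'a \<Rightarrow> real) \<Rightarrow> real \<Rightarrow> (nat \<Rightarrow> real) \<Rightarrow> nat \<Rightarrow> nat set
    \<Rightarrow> (nat \<Rightarrow> nat \<times> 'a \<Rightarrow> real) \<Rightarrow> ((nat \<Rightarrow> real) \<Rightarrow> nat) \<Rightarrow> real" where
  "error_prob \<Omega> U \<sigma> \<alpha> n W X \<psi> =
    measure (msg_noise W \<Omega>)
      {p \<in> space (msg_noise W \<Omega>).
        \<psi> (\<lambda>k\<in>{1..n}. channel_output \<sigma> \<alpha> (\<lambda>i. U (int i) (snd p)) (\<lambda>i. X i p) k) \<noteq> fst p}"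

definition achieves_rate ::
  "'a measure \<Rightarrow> (int \<Rightarrow> 'a \<Rightarrow> real) \<Rightarrow> real \<Rightarrow> (nat \<Rightarrow> real) \<Rightarrow> real
    \<Rightarrow> (nat \<Rightarrow> nat set) \<Rightarrow> (nat \<Rightarrow> nat \<Rightarrow> nat \<times> 'a \<Rightarrow> real) \<Rightarrow> (nat \<Rightarrow> (nat \<Rightarrow> real) \<Rightarrow> nat)
    \<Rightarrow> real \<Rightarrow> bool" where
  "achieves_rate \<Omega> U \<sigma> \<alpha> P W X \<psi> R \<longleftrightarrow>
    (\<forall>n\<ge>1. finite (W n) \<and> W n \<noteq> {}
         \<and> \<psi> n \<in> Pi\<^sub>M {1..n} (\<lambda>_. borel) \<rightarrow>\<^sub>M count_space (W n)
         \<and> power_constraint \<Omega> P n (W n) (X n))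
    \<and> ereal R \<le> liminf (\<lambda>n. ereal (ln (real (card (W n))) / real n))
    \<and> (\<lambda>n. error_prob \<Omega> U \<sigma> \<alpha> n (W n) (X n) (\<psi> n)) \<longlonglongrightarrow> 0"

definition achievable ::
  "'a measure \<Rightarrow> (int \<Rightarrow> 'a \<Rightarrow> real) \<Rightarrow> real \<Rightarrow> (nat \<Rightarrow> real) \<Rightarrow> real \<Rightarrow> real \<Rightarrow> bool" where
  "achievable \<Omega> U \<sigma> \<alpha> P R \<longleftrightarrow>
    (\<exists>(W :: nat \<Rightarrow> nat set) (\<phi> :: nat \<Rightarrow> nat \<Rightarrow> nat \<Rightarrow> real) \<psi>.
      achieves_rate \<Omega> U \<sigma> \<alpha> P W (\<lambda>n k p. \<phi> n (fst p) k) \<psi> R)"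

definition achievable_fb ::
  "'a measure \<Rightarrow> (int \<Rightarrow> 'a \<Rightarrow> real) \<Rightarrow> real \<Rightarrow> (nat \<Rightarrow> real) \<Rightarrow> real \<Rightarrow> real \<Rightarrow> bool" where
  "achievable_fb \<Omega> U \<sigma> \<alpha> P R \<longleftrightarrow>
    (\<exists>(W :: nat \<Rightarrow> nat set) (\<phi> :: nat \<Rightarrow> nat \<Rightarrow> nat \<Rightarrow> (nat \<Rightarrow> real) \<Rightarrow> real) \<psi>.
      (\<forall>n\<ge>1. \<forall>m\<in>W n. \<forall>k\<in>{1..n}. \<phi> n m k \<in> borel_measurable (Pi\<^sub>M {1..<k} (\<lambda>_. borel)))
      \<and> achieves_rate \<Omega> U \<sigma> \<alpha> P W
          (\<lambda>n k p. fb_input \<sigma> \<alpha> (\<phi> n (fst p)) (\<lambda>i. U (int i) (snd p)) k) \<psi> R)"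

text \<open>Capacities as functions of \<open>SNR = P / \<sigma>\<^sup>2\<close>.\<close>
definition capacity ::
  "'a measure \<Rightarrow> (int \<Rightarrow> 'a \<Rightarrow> real) \<Rightarrow> real \<Rightarrow> (nat \<Rightarrow> real) \<Rightarrow> real \<Rightarrow> ereal" where
  "capacity \<Omega> U \<sigma> \<alpha> SNR = Sup (ereal ` {R. achievable \<Omega> U \<sigma> \<alpha> (SNR * \<sigma>\<^sup>2) R})"

definition capacity_fb ::
  "'a measure \<Rightarrow> (int \<Rightarrow> 'a \<Rightarrow> real) \<Rightarrow> real \<Rightarrow> (nat \<Rightarrow> real) \<Rightarrow> real \<Rightarrow> ereal" where
  "capacity_fb \<Omega> U \<sigma> \<alpha> SNR = Sup (ereal ` {R. achievable_fb \<Omega> U \<sigma> \<alpha> (SNR * \<sigma>\<^sup>2) R})"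

text \<open>
  Division on \<^typ>\<open>ereal\<close> already satisfies the intended conventions \<open>a / 0 = \<infinity>\<close> for \<open>a > 0\<close>
  and \<open>0 / 0 = 0\<close>.
\<close>
definition coeff_ratio :: "(nat \<Rightarrow> real) \<Rightarrow> nat \<Rightarrow> ereal" where
  "coeff_ratio \<alpha> l = ereal (\<alpha> (l + 1)) / ereal (\<alpha> l)"

lemma coeff_ratio_conventions:
  "\<alpha> l = 0 \<Longrightarrow> \<alpha> (l + 1) > 0 \<Longrightarrow> coeff_ratio \<alpha> l = \<infinity>"
  "\<alpha> l = 0 \<Longrightarrow> \<alpha> (l + 1) = 0 \<Longrightarrow> coeff_ratio \<alpha> l = 0"
  "\<alpha> l \<noteq> 0 \<Longrightarrow> coeff_ratio \<alpha> l = ereal (\<alpha> (l + 1) / \<alpha> l)"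
  by (auto simp: coeff_ratio_def)

end

theory Submission imports Defs "HOL-Real_Asymp.Real_Asymp" begin

text \<open>
  Part i. If \<open>\<alpha>\<close> decays at most geometrically, then the noise variance \<open>L\<close> steps after time
  \<open>k\<close> is at least a fixed fraction of the variance plus the input power at time \<open>k\<close>, so that past
  outputs reveal the scale of the current noise. A Cauchy density with this revealed scale serves as
  reference law of the outputs. Against it, the information density of a code of length \<open>n\<close>
  telescopes to \<open>O(n)\<close>, uniformly in the power, up to a boundary term \<open>O(log n)\<close>. The
  probability of correct decoding is at most the probability that the information density
  exceeds \<open>n T\<close>, plus \<open>exp (n T) / |W|\<close>; this replaces Fano's inequality. The likelihood uses
  the conditional density of the noise given its infinite past, which makes the entropy rate
  appear without a chain rule.

  Part ii. If \<open>\<alpha>\<close> decays superexponentially, transmit only at the times \<open>\<nu> L + 1\<close>, with \<open>b^L\<close>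
  amplitude levels: since \<open>\<alpha> l \<le> b^(-4l)\<close>, the self-generated noise stays bounded and a symbol is
  received correctly unless the noise is large. By weak mixing the fraction of large noise samples
  along multiples of \<open>L\<close> concentrates, so a Gilbert-Varshamov outer code corrects the errors, at a
  rate of order \<open>ln b\<close>.
\<close>

section \<open>The conditional density of the noise given its past\<close>

text \<open>In part i no bound on the output power may enter, since it would grow with the input
  power. A Gaussian reference of variance v would charge y^2 / v for an output y; the Cauchy density
  charges only ln (v + y^2). This charge is repaid: the same y raises the reference variance one lag
  later, so charges and gains cancel in a telescoping sum. Conditioning on the whole noise past,
  also before time 1, makes the conditional densities at all times shifts of a single function. Only
  first moments of the terms of the information density are controlled, so Markov's inequality
  bounds its tail. Above the claimed rate this keeps the error probability away from 0, which is all
  that boundedness requires. In part ii, inputs closer together than \<open>L\<close> would meet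
  coefficients that are not yet small. With spacing \<open>L\<close>, the energy b^(4L) of a pulse
  is cancelled by the coefficient bound b^(-4L) at the next used time, for every \<open>b\<close>.
  Subsampling the noise is possible because weak mixing averages absolute values of covariances:
  such averages pass to multiples of \<open>L\<close>, whereas averages of signed covariances need
  not.\<close>

lemma nn_integral_cauchy_le:
  fixes v :: real
  assumes v: "0 < v"
  shows "(\<integral>\<^sup>+ y. ennreal (sqrt v / (pi * (v + y\<^sup>2))) \<partial>lborel) \<le> 1"
proof -
  let ?g = "\<lambda>y::real. ennreal (1 / (1 + y\<^sup>2))"
  have pos: "1 + y\<^sup>2 > 0" for y :: real by (simp add: add_pos_nonneg)
  have half: "(\<integral>\<^sup>+ y. ?g y * indicator {0..} y \<partial>lborel) = ennreal (pi / 2)"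
  proof -
    have "(\<integral>\<^sup>+ y. ?g y * indicator {0..} y \<partial>lborel) = ennreal (pi / 2 - arctan 0)"
    proof (rule nn_integral_FTC_atLeast)
      show "(\<lambda>y::real. 1 / (1 + y\<^sup>2)) \<in> borel_measurable borel" by measurable
      show "DERIV arctan y :> 1 / (1 + y\<^sup>2)" for y :: real
        using DERIV_arctan[of y] by (simp add: inverse_eq_divide)
      show "(arctan \<longlongrightarrow> pi / 2) at_top" by (rule tendsto_arctan_at_top)
    qed (use pos in \<open>auto intro: less_imp_le\<close>)
    then show ?thesis by simp
  qed
  have half': "(\<integral>\<^sup>+ y. ?g y * indicator {..0} y \<partial>lborel) = ennreal (pi / 2)"
    by (subst nn_integral_real_affine[where c = "-1" and t = 0])
       (auto simp: half[symmetric] indicator_def intro!: nn_integral_cong)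
  have "(\<integral>\<^sup>+ y. ?g y \<partial>lborel)
      \<le> (\<integral>\<^sup>+ y. ?g y * indicator {0..} y + ?g y * indicator {..0} y \<partial>lborel)"
    by (intro nn_integral_mono) (auto simp: indicator_def)
  also have "\<dots> = ennreal pi"
    by (subst nn_integral_add) (auto simp: half half' simp flip: ennreal_plus)
  finally have g: "(\<integral>\<^sup>+ y. ?g y \<partial>lborel) \<le> ennreal pi" .
  have sc: "sqrt v * (sqrt v / (pi * (v + (0 + sqrt v * y)\<^sup>2))) = 1 / pi * (1 / (1 + y\<^sup>2))" for y :: real
  proof -
    have "v + (0 + sqrt v * y)\<^sup>2 = v * (1 + y\<^sup>2)"
      using v by (simp add: power_mult_distrib algebra_simps)
    then show ?thesis
      using v by (simp add: real_sqrt_mult_self)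
  qed
  have "(\<integral>\<^sup>+ y. ennreal (sqrt v / (pi * (v + y\<^sup>2))) \<partial>lborel)
      = ennreal (sqrt v) * (\<integral>\<^sup>+ y. ennreal (sqrt v / (pi * (v + (0 + sqrt v * y)\<^sup>2))) \<partial>lborel)"
    using v by (subst nn_integral_real_affine[where c = "sqrt v" and t = 0]) auto
  also have "\<dots> = (\<integral>\<^sup>+ y. ennreal (sqrt v * (sqrt v / (pi * (v + (0 + sqrt v * y)\<^sup>2)))) \<partial>lborel)"
    using v by (subst nn_integral_cmult[symmetric]) (auto simp flip: ennreal_mult')
  also have "\<dots> = (\<integral>\<^sup>+ y. ennreal (1 / pi) * ?g y \<partial>lborel)"
    unfolding sc by (intro nn_integral_cong) (simp flip: ennreal_mult')
  also have "\<dots> = ennreal (1 / pi) * (\<integral>\<^sup>+ y. ?g y \<partial>lborel)"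
    by (rule nn_integral_cmult) measurable
  also have "\<dots> \<le> ennreal (1 / pi) * ennreal pi"
    by (intro mult_left_mono g) simp
  also have "\<dots> = 1"
    by (simp flip: ennreal_mult')
  finally show ?thesis .
qed

context noise_process
begin

definition past :: "int \<Rightarrow> 'a \<Rightarrow> int \<Rightarrow> real" where
  "past k \<omega> = (\<lambda>i\<in>{..<k}. U i \<omega>)"

lemma measurable_U [measurable]: "U k \<in> borel_measurable \<Omega>"
  by (rule random_variable_U)

lemma measurable_past [measurable]: "past k \<in> \<Omega> \<rightarrow>\<^sub>M Pi\<^sub>M {..<k} (\<lambda>_. borel)"
  unfolding past_def by measurable

lemma measurable_path [measurable]: "(\<lambda>\<omega> i. U (i + k) \<omega>) \<in> \<Omega> \<rightarrow>\<^sub>M path_space"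
  by (rule measurable_PiM_single') auto

lemma measurable_path0 [measurable]: "(\<lambda>\<omega> i. U i \<omega>) \<in> \<Omega> \<rightarrow>\<^sub>M path_space"
  using measurable_path[of 0] by simp

text \<open>Stationarity enters only through this identity, which is why probabilities and
  almost-everywhere statements are later phrased as such integrals.\<close>

lemma nn_integral_shift:
  assumes [measurable]: "F \<in> borel_measurable path_space"
  shows "(\<integral>\<^sup>+ \<omega>. F (\<lambda>i. U (i + k) \<omega>) \<partial>\<Omega>) = (\<integral>\<^sup>+ \<omega>. F (\<lambda>i. U i \<omega>) \<partial>\<Omega>)"
proof -
  have "(\<integral>\<^sup>+ \<omega>. F (\<lambda>i. U (i + k) \<omega>) \<partial>\<Omega>) = (\<integral>\<^sup>+ w. F w \<partial>distr \<Omega> path_space (\<lambda>\<omega> i. U (i + k) \<omega>))"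
    by (subst nn_integral_distr) auto
  also have "\<dots> = (\<integral>\<^sup>+ w. F w \<partial>distr \<Omega> path_space (\<lambda>\<omega> i. U i \<omega>))"
    using stationary unfolding stationary_process_def by metis
  also have "\<dots> = (\<integral>\<^sup>+ \<omega>. F (\<lambda>i. U i \<omega>) \<partial>\<Omega>)"
    by (subst nn_integral_distr) auto
  finally show ?thesis .
qed

text \<open>The Bochner integral of a non-integrable function is 0 by convention, so the value 1 of
  the second moment by itself forces integrability.\<close>

lemma integrable_U_sq: "integrable \<Omega> (\<lambda>\<omega>. (U k \<omega>)\<^sup>2)"
  and expectation_U_sq: "expectation (\<lambda>\<omega>. (U k \<omega>)\<^sup>2) = 1"
proof -
  show 1: "expectation (\<lambda>\<omega>. (U k \<omega>)\<^sup>2) = 1"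
    using unit_variance[of k] zero_mean[of k] by simp
  show "integrable \<Omega> (\<lambda>\<omega>. (U k \<omega>)\<^sup>2)"
    using 1 not_integrable_integral_eq by fastforce
qed

lemma nn_integral_U_sq: "(\<integral>\<^sup>+ \<omega>. ennreal ((U k \<omega>)\<^sup>2) \<partial>\<Omega>) = 1"
  using nn_integral_eq_integral[OF integrable_U_sq[of k]] by (simp add: expectation_U_sq)

text \<open>\<open>f\<close> is a Radon-Nikodym derivative of the joint law of noise and past with
  respect to Lebesgue measure times the law of the past; the entropy hypothesis makes the mean
  \<open>H\<close> of the positive part of its logarithm finite. The last property uses
  \<open>f\<close> as a conditional density without disintegration: dividing by it replaces the
  current noise by Lebesgue measure. It is an inequality because 1 / 0 = 0 discards the set where
  the derivative vanishes.\<close>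

lemma conditional_density_0:
  obtains f :: "real \<times> (int \<Rightarrow> real) \<Rightarrow> real" and H :: real where
    "f \<in> borel_measurable (borel \<Otimes>\<^sub>M Pi\<^sub>M {..<0} (\<lambda>_. borel))" "\<And>z. 0 \<le> f z" "0 \<le> H"
    "AE \<omega> in \<Omega>. 0 < f (U 0 \<omega>, past 0 \<omega>)"
    "(\<integral>\<^sup>+ \<omega>. ennreal (ln (f (U 0 \<omega>, past 0 \<omega>))) \<partial>\<Omega>) = ennreal H"
    "\<And>F. F \<in> borel_measurable (borel \<Otimes>\<^sub>M Pi\<^sub>M {..<0} (\<lambda>_. borel)) \<Longrightarrow>
      (\<integral>\<^sup>+ \<omega>. F (U 0 \<omega>, past 0 \<omega>) * ennreal (1 / f (U 0 \<omega>, past 0 \<omega>)) \<partial>\<Omega>)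
      \<le> (\<integral>\<^sup>+ \<omega>. (\<integral>\<^sup>+ u. F (u, past 0 \<omega>) \<partial>lborel) \<partial>\<Omega>)"
proof -
  let ?N = "Pi\<^sub>M {..<0::int} (\<lambda>_. borel :: real measure)"
  define Z where "Z = (\<lambda>\<omega>. (U 0 \<omega>, past 0 \<omega>))"
  define J where "J = distr \<Omega> (lborel \<Otimes>\<^sub>M ?N) Z"
  define Q where "Q = (lborel :: real measure) \<Otimes>\<^sub>M distr \<Omega> ?N (past 0)"
  define R where "R = RN_deriv Q J"
  define f where "f = (\<lambda>z. enn2real (R z))"
  have Zm [measurable]: "Z \<in> \<Omega> \<rightarrow>\<^sub>M lborel \<Otimes>\<^sub>M ?N" unfolding Z_def by measurable
  interpret D: prob_space "distr \<Omega> ?N (past 0)" by (rule prob_space_distr) measurable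
  interpret Q: pair_sigma_finite "lborel :: real measure" "distr \<Omega> ?N (past 0)" ..
  have sQ: "sigma_finite_measure Q" unfolding Q_def by (rule Q.sigma_finite_measure_axioms)
  interpret J: prob_space J unfolding J_def by (rule prob_space_distr) measurable
  have sets_Q [measurable_cong]: "sets Q = sets (borel \<Otimes>\<^sub>M ?N)"
    unfolding Q_def by (intro sets_pair_measure_cong) auto
  have sets_J' [measurable_cong]: "sets J = sets (borel \<Otimes>\<^sub>M ?N)"
    unfolding J_def by (simp cong: sets_pair_measure_cong)
  then have sets_J: "sets J = sets Q"
    by (simp add: sets_Q)
  have ent: "cond_diff_entropy \<Omega> ?N (U 0) (past 0) > - \<infinity>"
    using entropy_rate[of 0] by (simp add: past_def[abs_def])
  have ac: "absolutely_continuous Q J"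
    using ent by (auto simp: cond_diff_entropy_def Let_def Q_def J_def Z_def split: if_splits)
  have gt: "enn2ereal (\<integral>\<^sup>+ z. ennreal (- ln (f z)) \<partial>J) - enn2ereal (\<integral>\<^sup>+ z. ennreal (ln (f z)) \<partial>J) > - \<infinity>"
    using ent ac by (simp add: cond_diff_entropy_def Let_def Q_def J_def Z_def f_def R_def)
  have JR: "density Q R = J"
    unfolding R_def by (rule sigma_finite_measure.density_RN_deriv[OF sQ ac sets_J])
  have Rm [measurable]: "R \<in> borel_measurable Q" unfolding R_def by simp
  then have Rm' [measurable]: "R \<in> borel_measurable (borel \<Otimes>\<^sub>M ?N)"
    using sets_Q measurable_cong_sets by blast
  have fm [measurable]: "f \<in> borel_measurable (borel \<Otimes>\<^sub>M ?N)" unfolding f_def by measurable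
  have Rfin: "AE z in Q. R z \<noteq> \<infinity>"
    unfolding R_def by (rule sigma_finite_measure.RN_deriv_finite[OF sQ J.sigma_finite_measure_axioms ac sets_J])
  have fJ: "AE z in J. 0 < f z"
    unfolding JR[symmetric]
  proof (subst AE_density)
    show "AE z in Q. 0 < R z \<longrightarrow> 0 < f z"
      using Rfin by eventually_elim (auto simp: f_def enn2real_positive_iff less_top)
  qed simp
  have J_int: "(\<integral>\<^sup>+ z. F z \<partial>J) = (\<integral>\<^sup>+ \<omega>. F (Z \<omega>) \<partial>\<Omega>)"
    if [measurable]: "F \<in> borel_measurable (borel \<Otimes>\<^sub>M ?N)" for F
    unfolding J_def by (rule nn_integral_distr) measurable
  have fpos: "AE \<omega> in \<Omega>. 0 < f (Z \<omega>)"
    using fJ unfolding J_def by (rule AE_distrD[OF Zm])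
  have [measurable]: "(\<lambda>\<omega>. fst (Z \<omega>)) \<in> borel_measurable \<Omega>"
    by (simp add: Z_def)
  have [measurable]: "Z \<in> \<Omega> \<rightarrow>\<^sub>M borel \<Otimes>\<^sub>M ?N"
    unfolding Z_def by measurable
  have [measurable]: "(\<lambda>\<omega>. f (Z \<omega>)) \<in> borel_measurable \<Omega>"
    by (rule measurable_compose[OF _ fm]) measurable
  have key: "(\<integral>\<^sup>+ \<omega>. F (Z \<omega>) * ennreal (1 / f (Z \<omega>)) \<partial>\<Omega>)
      \<le> (\<integral>\<^sup>+ \<omega>. (\<integral>\<^sup>+ u. F (u, past 0 \<omega>) \<partial>lborel) \<partial>\<Omega>)"
    if [measurable]: "F \<in> borel_measurable (borel \<Otimes>\<^sub>M ?N)" for F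
  proof -
    have FQ [measurable]: "F \<in> borel_measurable Q"
      using that sets_Q measurable_cong_sets by blast
    have "(\<integral>\<^sup>+ \<omega>. F (Z \<omega>) * ennreal (1 / f (Z \<omega>)) \<partial>\<Omega>) = (\<integral>\<^sup>+ z. F z * ennreal (1 / f z) \<partial>J)"
      by (subst J_int) auto
    also have "\<dots> = (\<integral>\<^sup>+ z. R z * (F z * ennreal (1 / f z)) \<partial>Q)"
      unfolding JR[symmetric] by (subst nn_integral_density) auto
    also have "\<dots> \<le> (\<integral>\<^sup>+ z. F z \<partial>Q)"
    proof (rule nn_integral_mono_AE)
      show "AE z in Q. R z * (F z * ennreal (1 / f z)) \<le> F z"
        using Rfin
      proof eventually_elim
        case (elim z)
        then have "R z = ennreal (f z)" by (simp add: f_def less_top)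
        then have "R z * (F z * ennreal (1 / f z)) = ennreal (f z * (1 / f z)) * F z"
          by (subst ennreal_mult) (auto simp: f_def mult_ac)
        also have "\<dots> \<le> 1 * F z" by (intro mult_right_mono) auto
        finally show ?case by simp
      qed
    qed
    also have "\<dots> = (\<integral>\<^sup>+ w. (\<integral>\<^sup>+ u. F (u, w) \<partial>lborel) \<partial>distr \<Omega> ?N (past 0))"
      unfolding Q_def
      by (subst Q.nn_integral_snd[symmetric]) (auto simp: Q_def[symmetric])
    also have "\<dots> = (\<integral>\<^sup>+ \<omega>. (\<integral>\<^sup>+ u. F (u, past 0 \<omega>) \<partial>lborel) \<partial>\<Omega>)"
      by (subst nn_integral_distr) auto
    finally show ?thesis .
  qed
  \<comment> \<open>Comparison with a Cauchy density bounds \<open>\<integral> max 0 (- ln f)\<close>; without it the entropy hypothesis would be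
    void, since \<open>\<infinity> - \<infinity> = \<infinity>\<close> on \<^typ>\<open>ereal\<close>.\<close>
  let ?\<kappa> = "\<lambda>u::real. 1 / (pi * (1 + u\<^sup>2))"
  have \<kappa>pos: "0 < pi * (1 + u\<^sup>2)" for u :: real
    by (intro mult_pos_pos add_pos_nonneg) auto
  have "(\<integral>\<^sup>+ z. ennreal (- ln (f z)) \<partial>J) = (\<integral>\<^sup>+ \<omega>. ennreal (- ln (f (Z \<omega>))) \<partial>\<Omega>)"
    by (rule J_int) measurable
  also have "\<dots> \<le> (\<integral>\<^sup>+ \<omega>. ennreal (?\<kappa> (fst (Z \<omega>))) * ennreal (1 / f (Z \<omega>)) + ennreal (pi * (1 + (U 0 \<omega>)\<^sup>2)) \<partial>\<Omega>)"
  proof (rule nn_integral_mono_AE)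
    show "AE \<omega> in \<Omega>. ennreal (- ln (f (Z \<omega>)))
      \<le> ennreal (?\<kappa> (fst (Z \<omega>))) * ennreal (1 / f (Z \<omega>)) + ennreal (pi * (1 + (U 0 \<omega>)\<^sup>2))"
      using fpos
    proof eventually_elim
      case (elim \<omega>)
      let ?u = "U 0 \<omega>"
      have "ln (?\<kappa> ?u / f (Z \<omega>)) \<le> ?\<kappa> ?u / f (Z \<omega>)"
        using elim \<kappa>pos[of ?u] by (intro ln_bound) (auto simp: zero_less_divide_iff)
      moreover have "ln (?\<kappa> ?u / f (Z \<omega>)) = - ln (pi * (1 + ?u\<^sup>2)) - ln (f (Z \<omega>))"
        using elim \<kappa>pos[of ?u] by (subst ln_div) (auto simp del: ln_mult simp: ln_div)
      moreover have "ln (pi * (1 + ?u\<^sup>2)) \<le> pi * (1 + ?u\<^sup>2)"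
        by (rule ln_bound[OF \<kappa>pos])
      ultimately have "- ln (f (Z \<omega>)) \<le> ?\<kappa> ?u * (1 / f (Z \<omega>)) + pi * (1 + ?u\<^sup>2)"
        by simp
      then have "ennreal (- ln (f (Z \<omega>))) \<le> ennreal (?\<kappa> ?u * (1 / f (Z \<omega>)) + pi * (1 + ?u\<^sup>2))"
        by (rule ennreal_leI)
      also have "\<dots> = ennreal (?\<kappa> ?u) * ennreal (1 / f (Z \<omega>)) + ennreal (pi * (1 + ?u\<^sup>2))"
      proof (subst ennreal_plus)
        show "0 \<le> ?\<kappa> ?u * (1 / f (Z \<omega>))" "0 \<le> pi * (1 + ?u\<^sup>2)"
          using elim \<kappa>pos[of ?u] by (auto intro: less_imp_le)
        show "ennreal (?\<kappa> ?u * (1 / f (Z \<omega>))) + ennreal (pi * (1 + ?u\<^sup>2))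
          = ennreal (?\<kappa> ?u) * ennreal (1 / f (Z \<omega>)) + ennreal (pi * (1 + ?u\<^sup>2))"
          using elim \<kappa>pos[of ?u] by (subst ennreal_mult) (auto intro: less_imp_le)
      qed
      finally show ?case by (simp add: Z_def)
    qed
  qed
  also have "\<dots> = (\<integral>\<^sup>+ \<omega>. ennreal (?\<kappa> (fst (Z \<omega>))) * ennreal (1 / f (Z \<omega>)) \<partial>\<Omega>)
      + (\<integral>\<^sup>+ \<omega>. ennreal (pi * (1 + (U 0 \<omega>)\<^sup>2)) \<partial>\<Omega>)"
    by (rule nn_integral_add) auto
  also have "\<dots> < \<infinity>"
  proof -
    have "(\<integral>\<^sup>+ \<omega>. ennreal (?\<kappa> (fst (Z \<omega>))) * ennreal (1 / f (Z \<omega>)) \<partial>\<Omega>)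
      \<le> (\<integral>\<^sup>+ \<omega>. (\<integral>\<^sup>+ u. ennreal (?\<kappa> (fst (u, past 0 \<omega>))) \<partial>lborel) \<partial>\<Omega>)"
      by (rule key) measurable
    also have "\<dots> \<le> (\<integral>\<^sup>+ \<omega>. 1 \<partial>\<Omega>)"
      using nn_integral_cauchy_le[of 1] by (intro nn_integral_mono) simp
    also have "\<dots> < \<infinity>" by (simp add: emeasure_space_1)
    finally have 1: "(\<integral>\<^sup>+ \<omega>. ennreal (?\<kappa> (fst (Z \<omega>))) * ennreal (1 / f (Z \<omega>)) \<partial>\<Omega>) < \<infinity>" .
    have "(\<integral>\<^sup>+ \<omega>. ennreal (pi * (1 + (U 0 \<omega>)\<^sup>2)) \<partial>\<Omega>) = ennreal (expectation (\<lambda>\<omega>. pi * (1 + (U 0 \<omega>)\<^sup>2)))"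
      by (intro nn_integral_eq_integral integrable_mult_right Bochner_Integration.integrable_add integrable_U_sq) auto
    then show ?thesis using 1 by (simp add: less_top)
  qed
  finally have "(\<integral>\<^sup>+ z. ennreal (ln (f z)) \<partial>J) < \<infinity>"
    using gt by (cases "\<integral>\<^sup>+ z. ennreal (ln (f z)) \<partial>J"; cases "\<integral>\<^sup>+ z. ennreal (- ln (f z)) \<partial>J") auto
  then have "(\<integral>\<^sup>+ \<omega>. ennreal (ln (f (Z \<omega>))) \<partial>\<Omega>) < \<infinity>"
    by (subst (asm) J_int) auto
  then obtain H where H: "0 \<le> H" "(\<integral>\<^sup>+ \<omega>. ennreal (ln (f (Z \<omega>))) \<partial>\<Omega>) = ennreal H"
    by (cases "\<integral>\<^sup>+ \<omega>. ennreal (ln (f (Z \<omega>))) \<partial>\<Omega>") auto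
  show thesis
    using that[OF fm _ H(1) fpos[unfolded Z_def] H(2)[unfolded Z_def] key[unfolded Z_def]]
    by (simp add: f_def)
qed

text \<open>Transporting the one density at time 0 along the shift, instead of taking a new
  derivative at each time, makes \<open>H\<close> common to all times.\<close>

lemma conditional_density:
  obtains d :: "int \<Rightarrow> real \<times> (int \<Rightarrow> real) \<Rightarrow> real" and H :: real where
    "\<And>k. d k \<in> borel_measurable (borel \<Otimes>\<^sub>M Pi\<^sub>M {..<k} (\<lambda>_. borel))" "0 \<le> H"
    "\<And>k. AE \<omega> in \<Omega>. 0 < d k (U k \<omega>, past k \<omega>)"
    "\<And>k. (\<integral>\<^sup>+ \<omega>. ennreal (ln (d k (U k \<omega>, past k \<omega>))) \<partial>\<Omega>) = ennreal H"
    "\<And>k F. F \<in> borel_measurable (borel \<Otimes>\<^sub>M Pi\<^sub>M {..<k} (\<lambda>_. borel)) \<Longrightarrow>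
      (\<integral>\<^sup>+ \<omega>. F (U k \<omega>, past k \<omega>) * ennreal (1 / d k (U k \<omega>, past k \<omega>)) \<partial>\<Omega>)
      \<le> (\<integral>\<^sup>+ \<omega>. (\<integral>\<^sup>+ u. F (u, past k \<omega>) \<partial>lborel) \<partial>\<Omega>)"
proof -
  obtain f :: "real \<times> (int \<Rightarrow> real) \<Rightarrow> real" and H where
    fm [measurable]: "f \<in> borel_measurable (borel \<Otimes>\<^sub>M Pi\<^sub>M {..<0} (\<lambda>_. borel))"
    and f0: "\<And>z. 0 \<le> f z" and H: "0 \<le> H"
    and fpos: "AE \<omega> in \<Omega>. 0 < f (U 0 \<omega>, past 0 \<omega>)"
    and fH: "(\<integral>\<^sup>+ \<omega>. ennreal (ln (f (U 0 \<omega>, past 0 \<omega>))) \<partial>\<Omega>) = ennreal H"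
    and key: "\<And>F. F \<in> borel_measurable (borel \<Otimes>\<^sub>M Pi\<^sub>M {..<0} (\<lambda>_. borel)) \<Longrightarrow>
      (\<integral>\<^sup>+ \<omega>. F (U 0 \<omega>, past 0 \<omega>) * ennreal (1 / f (U 0 \<omega>, past 0 \<omega>)) \<partial>\<Omega>)
      \<le> (\<integral>\<^sup>+ \<omega>. (\<integral>\<^sup>+ u. F (u, past 0 \<omega>) \<partial>lborel) \<partial>\<Omega>)"
  proof (rule conditional_density_0, goal_cases)
    case (1 f H)
    show ?case by (rule 1(1)[OF 1(2-7)])
  qed
  define d :: "int \<Rightarrow> real \<times> (int \<Rightarrow> real) \<Rightarrow> real"
    where "d k = (\<lambda>(u, w). f (u, \<lambda>i\<in>{..<0}. w (i + k)))" for k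
  have [measurable]: "(\<lambda>w. \<lambda>i\<in>{..<0}. w (i + k)) \<in> Pi\<^sub>M {..<k} (\<lambda>_. borel) \<rightarrow>\<^sub>M Pi\<^sub>M {..<0} (\<lambda>_. borel :: real measure)" for k :: int
    by (intro measurable_restrict measurable_component_singleton) auto
  have [measurable]: "(\<lambda>w. \<lambda>i\<in>{..<k}. w (i - k)) \<in> Pi\<^sub>M {..<0} (\<lambda>_. borel) \<rightarrow>\<^sub>M Pi\<^sub>M {..<k} (\<lambda>_. borel :: real measure)" for k :: int
    by (intro measurable_restrict measurable_component_singleton) auto
  have [measurable]: "(\<lambda>w. restrict w {..<0}) \<in> path_space \<rightarrow>\<^sub>M Pi\<^sub>M {..<0} (\<lambda>_. borel)"
    by (intro measurable_restrict_subset) auto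
  have dm: "d k \<in> borel_measurable (borel \<Otimes>\<^sub>M Pi\<^sub>M {..<k} (\<lambda>_. borel))" for k
    unfolding d_def by measurable
  let ?W = "\<lambda>w::int \<Rightarrow> real. (w 0, restrict w {..<0})"
  have d_eq: "d k (U k \<omega>, past k \<omega>) = f (?W (\<lambda>i. U (i + k) \<omega>))" for k \<omega>
    by (auto simp: d_def past_def restrict_def intro!: arg_cong[where f = f] ext)
  have f_eq: "f (U 0 \<omega>, past 0 \<omega>) = f (?W (\<lambda>i. U i \<omega>))" for \<omega>
    by (simp add: past_def)
  have 4: "(\<integral>\<^sup>+ \<omega>. ennreal (ln (d k (U k \<omega>, past k \<omega>))) \<partial>\<Omega>) = ennreal H" for k
    using nn_integral_shift[of "\<lambda>w. ennreal (ln (f (?W w)))" k] fH by (simp add: d_eq f_eq)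
  have 3: "AE \<omega> in \<Omega>. 0 < d k (U k \<omega>, past k \<omega>)" for k
  proof -
    \<comment> \<open>A 0-1 integrand turns the almost-everywhere statement into an integral, to
      which \<open>nn_integral_shift\<close> applies.\<close>
    let ?I = "\<lambda>w. if 0 < f (?W w) then 0 else 1 :: ennreal"
    have "(\<integral>\<^sup>+ \<omega>. ?I (\<lambda>i. U (i + k) \<omega>) \<partial>\<Omega>) = (\<integral>\<^sup>+ \<omega>. ?I (\<lambda>i. U i \<omega>) \<partial>\<Omega>)"
      by (rule nn_integral_shift) measurable
    also have "\<dots> = (\<integral>\<^sup>+ \<omega>. 0 \<partial>\<Omega>)"
      using fpos by (intro nn_integral_cong_AE) (auto simp: f_eq)
    finally have "AE \<omega> in \<Omega>. ?I (\<lambda>i. U (i + k) \<omega>) = 0"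
      by (subst (asm) nn_integral_const, subst (asm) mult_zero_left, subst (asm) nn_integral_0_iff_AE) auto
    then show ?thesis by eventually_elim (auto simp: d_eq split: if_splits)
  qed
  have 5: "(\<integral>\<^sup>+ \<omega>. F (U k \<omega>, past k \<omega>) * ennreal (1 / d k (U k \<omega>, past k \<omega>)) \<partial>\<Omega>)
      \<le> (\<integral>\<^sup>+ \<omega>. (\<integral>\<^sup>+ u. F (u, past k \<omega>) \<partial>lborel) \<partial>\<Omega>)"
    if [measurable]: "F \<in> borel_measurable (borel \<Otimes>\<^sub>M Pi\<^sub>M {..<k} (\<lambda>_. borel))" for k F
  proof -
    define G where "G = (\<lambda>(u, w). F (u, \<lambda>i\<in>{..<k}. w (i - k)))"
    have Gm [measurable]: "G \<in> borel_measurable (borel \<Otimes>\<^sub>M Pi\<^sub>M {..<0} (\<lambda>_. borel))"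
      unfolding G_def by measurable
    have G_eq: "F (u, past k \<omega>) = G (u, snd (?W (\<lambda>i. U (i + k) \<omega>)))" for u \<omega>
      by (auto simp: G_def past_def restrict_def intro!: arg_cong[where f = F] ext)
    have "(\<integral>\<^sup>+ \<omega>. F (U k \<omega>, past k \<omega>) * ennreal (1 / d k (U k \<omega>, past k \<omega>)) \<partial>\<Omega>)
        = (\<integral>\<^sup>+ \<omega>. (\<lambda>w. G (?W w) * ennreal (1 / f (?W w))) (\<lambda>i. U (i + k) \<omega>) \<partial>\<Omega>)"
      by (simp add: G_eq d_eq)
    also have "\<dots> = (\<integral>\<^sup>+ \<omega>. (\<lambda>w. G (?W w) * ennreal (1 / f (?W w))) (\<lambda>i. U i \<omega>) \<partial>\<Omega>)"
      by (rule nn_integral_shift) measurable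
    also have "\<dots> = (\<integral>\<^sup>+ \<omega>. G (U 0 \<omega>, past 0 \<omega>) * ennreal (1 / f (U 0 \<omega>, past 0 \<omega>)) \<partial>\<Omega>)"
      by (simp add: past_def)
    also have "\<dots> \<le> (\<integral>\<^sup>+ \<omega>. (\<integral>\<^sup>+ u. G (u, past 0 \<omega>) \<partial>lborel) \<partial>\<Omega>)"
      by (rule key) measurable
    also have "\<dots> = (\<integral>\<^sup>+ \<omega>. (\<lambda>w. \<integral>\<^sup>+ u. G (u, restrict w {..<0}) \<partial>lborel) (\<lambda>i. U i \<omega>) \<partial>\<Omega>)"
      by (simp add: past_def)
    also have "\<dots> = (\<integral>\<^sup>+ \<omega>. (\<lambda>w. \<integral>\<^sup>+ u. G (u, restrict w {..<0}) \<partial>lborel) (\<lambda>i. U (i + k) \<omega>) \<partial>\<Omega>)"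
      by (rule nn_integral_shift[symmetric]) measurable
    also have "\<dots> = (\<integral>\<^sup>+ \<omega>. (\<integral>\<^sup>+ u. F (u, past k \<omega>) \<partial>lborel) \<partial>\<Omega>)"
      by (simp add: G_eq)
    finally show ?thesis .
  qed
  show thesis
    by (rule that[OF dm H 3 4 5])
qed

end

section \<open>Persistent heating: reference variances and the information density\<close>

text \<open>The noise variance at time \<open>k\<close>. The name pictures past inputs as dissipated
  power that warms the device.\<close>

definition heat :: "real \<Rightarrow> (nat \<Rightarrow> real) \<Rightarrow> (nat \<Rightarrow> real) \<Rightarrow> nat \<Rightarrow> real" where
  "heat \<sigma> \<alpha> x k = \<sigma>\<^sup>2 + (\<Sum>l=1..<k. \<alpha> (k - l) * (x l)\<^sup>2)"

lemma channel_output_heat: "channel_output \<sigma> \<alpha> u x k = x k + sqrt (heat \<sigma> \<alpha> x k) * u k"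
  by (simp add: channel_output_def heat_def)

text \<open>Telescoping with lag \<open>L\<close>: the interior terms cancel, and the number of
  boundary differences that remain does not grow with \<open>n\<close>.\<close>

lemma sum_shift_diff:
  fixes a :: "nat \<Rightarrow> real"
  shows "(\<Sum>k=1..n. a (k + L) - a k) = (\<Sum>j=1..L. a (n + j) - a j)"
proof (induction n)
  case (Suc n)
  have "(\<Sum>j=1..L. a (Suc n + j) - a (n + j)) = a (Suc n + L) - a (Suc n)"
    by (induction L) auto
  moreover have "(\<Sum>j=1..L. a (Suc n + j) - a j)
      = (\<Sum>j=1..L. a (Suc n + j) - a (n + j)) + (\<Sum>j=1..L. a (n + j) - a j)"
    by (simp flip: sum.distrib)
  ultimately show ?case using Suc by simp
qed simp

text \<open>The lag \<open>L\<close> lets the early coefficients be irregular, even zero, since only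
  comparisons across a whole lag count. \<open>persistent\<close> says that heat already present
  survives a lag up to the factor \<open>c\<close>, and \<open>persistent_0\<close> that a fresh
  input is felt one lag later; \<open>heat_add\<close> combines the two.\<close>

locale persistent_heat =
  fixes \<sigma> :: real and \<alpha> :: "nat \<Rightarrow> real" and c A :: real and L :: nat
  assumes \<sigma>: "0 < \<sigma>" and c: "0 < c" "c \<le> 1" and L: "1 \<le> L" and A: "1 \<le> A"
    and nonneg: "\<And>l. 1 \<le> l \<Longrightarrow> 0 \<le> \<alpha> l" and bounded: "\<And>l. 1 \<le> l \<Longrightarrow> \<alpha> l \<le> A"
    and persistent: "\<And>l. 1 \<le> l \<Longrightarrow> c * \<alpha> l \<le> \<alpha> (l + L)" and persistent_0: "c \<le> \<alpha> L"
begin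

text \<open>
  \<open>ref_var y k\<close> estimates the noise variance \<open>heat \<sigma> \<alpha> x k\<close> from the past outputs, never
  overshooting it by more than the factor \<open>noise_factor u k\<close>.
\<close>
function ref_var :: "(nat \<Rightarrow> real) \<Rightarrow> nat \<Rightarrow> real" where
  "ref_var y k = (if k \<le> L then \<sigma>\<^sup>2 else c / 2 * (ref_var y (k - L) + (y (k - L))\<^sup>2))"
  by pat_completeness auto
termination
  using L by (relation "Wellfounded.measure snd") auto

text \<open>The halving stems from the factor \<open>c / 2\<close> in \<open>ref_var\<close>.
  \<open>heat_add\<close> would allow \<open>c\<close> there; the smaller factor is chosen so that
  this recursion contracts and its mean stays bounded instead of growing with the number of
  periods.\<close>

function noise_factor :: "(nat \<Rightarrow> real) \<Rightarrow> nat \<Rightarrow> real" where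
  "noise_factor u k = (if k \<le> L then 1 else noise_factor u (k - L) / 2 + 1 + (u (k - L))\<^sup>2)"
  by pat_completeness auto
termination
  using L by (relation "Wellfounded.measure snd") auto

definition ref_density :: "(nat \<Rightarrow> real) \<Rightarrow> nat \<Rightarrow> real" where
  "ref_density y k = sqrt (ref_var y k) / (pi * (ref_var y k + (y k)\<^sup>2))"

declare ref_var.simps [simp del] noise_factor.simps [simp del]

lemma ref_var_init: "k \<le> L \<Longrightarrow> ref_var y k = \<sigma>\<^sup>2"
  by (simp add: ref_var.simps)

lemma ref_var_add: "1 \<le> k \<Longrightarrow> ref_var y (k + L) = c / 2 * (ref_var y k + (y k)\<^sup>2)"
  by (subst ref_var.simps) auto

lemma noise_factor_init: "k \<le> L \<Longrightarrow> noise_factor u k = 1"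
  by (simp add: noise_factor.simps)

lemma noise_factor_add: "1 \<le> k \<Longrightarrow> noise_factor u (k + L) = noise_factor u k / 2 + 1 + (u k)\<^sup>2"
  by (subst noise_factor.simps) auto

lemma period_induct [consumes 1, case_names init add]:
  assumes "1 \<le> k" "\<And>k. \<lbrakk>1 \<le> k; k \<le> L\<rbrakk> \<Longrightarrow> P k" "\<And>k. \<lbrakk>1 \<le> k; P k\<rbrakk> \<Longrightarrow> P (k + L)"
  shows "P k"
  using assms(1)
proof (induction k rule: less_induct)
  case (less k)
  show ?case
  proof (cases "k \<le> L")
    case False
    then have "P (k - L)" using less L by auto
    then show ?thesis using False assms(3)[of "k - L"] by simp
  qed (use less assms(2) in auto)
qed

lemma ref_var_pos: "1 \<le> k \<Longrightarrow> 0 < ref_var y k"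
  by (induction k rule: period_induct) (use \<sigma> c in \<open>auto simp: ref_var_init ref_var_add add_pos_nonneg\<close>)

lemma noise_factor_ge_1: "1 \<le> k \<Longrightarrow> 1 \<le> noise_factor u k"
proof (induction k rule: period_induct)
  case (add k)
  have "0 \<le> (u k)\<^sup>2" by simp
  then show ?case using add by (simp add: noise_factor_add)
qed (simp add: noise_factor_init)

lemma ref_density_pos: "1 \<le> k \<Longrightarrow> 0 < ref_density y k"
  using ref_var_pos[of k y] by (auto simp: ref_density_def intro!: divide_pos_pos mult_pos_pos add_pos_nonneg)

lemma ref_var_cong: "1 \<le> k \<Longrightarrow> (\<And>i. 1 \<le> i \<Longrightarrow> i < k \<Longrightarrow> y i = y' i) \<Longrightarrow> ref_var y k = ref_var y' k"
  by (induction k rule: period_induct) (use L in \<open>auto simp: ref_var_init ref_var_add\<close>)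

lemma ref_density_cong:
  "1 \<le> k \<Longrightarrow> (\<And>i. 1 \<le> i \<Longrightarrow> i \<le> k \<Longrightarrow> y i = y' i) \<Longrightarrow> ref_density y k = ref_density y' k"
  using ref_var_cong[of k y y'] by (simp add: ref_density_def)

lemma measurable_ref_var:
  "1 \<le> k \<Longrightarrow> (\<And>i. 1 \<le> i \<Longrightarrow> i < k \<Longrightarrow> (\<lambda>w. y w i) \<in> borel_measurable M)
    \<Longrightarrow> (\<lambda>w. ref_var (y w) k) \<in> borel_measurable M"
  by (induction k rule: period_induct) (use L in \<open>auto simp: ref_var_init ref_var_add\<close>)

lemma measurable_ref_density:
  assumes "1 \<le> k" "\<And>i. 1 \<le> i \<Longrightarrow> i \<le> k \<Longrightarrow> (\<lambda>w. y w i) \<in> borel_measurable M"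
  shows "(\<lambda>w. ref_density (y w) k) \<in> borel_measurable M"
proof -
  have [measurable]: "(\<lambda>w. ref_var (y w) k) \<in> borel_measurable M" "(\<lambda>w. y w k) \<in> borel_measurable M"
    using assms by (auto intro!: measurable_ref_var)
  show ?thesis unfolding ref_density_def by measurable
qed

lemma measurable_noise_factor:
  "1 \<le> k \<Longrightarrow> (\<And>i. 1 \<le> i \<Longrightarrow> (\<lambda>w. u w i) \<in> borel_measurable M)
    \<Longrightarrow> (\<lambda>w. noise_factor (u w) k) \<in> borel_measurable M"
  by (induction k rule: period_induct) (use L in \<open>auto simp: noise_factor_init noise_factor_add\<close>)

text \<open>The scale \<open>ref_var y k\<close> involves only outputs before \<open>k\<close>, so
  the integrand is a Cauchy density of fixed scale.\<close>

lemma nn_integral_ref_density: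
  assumes "1 \<le> k"
  shows "(\<integral>\<^sup>+ t. ennreal (ref_density (y(k := t)) k) \<partial>lborel) \<le> 1"
proof -
  have "ref_var (y(k := t)) k = ref_var y k" for t
    using assms by (intro ref_var_cong) auto
  then show ?thesis
    using nn_integral_cauchy_le[OF ref_var_pos[OF assms, of y]] by (simp add: ref_density_def)
qed

lemma heat_ge: "\<sigma>\<^sup>2 \<le> heat \<sigma> \<alpha> x k"
  by (auto simp: heat_def intro!: sum_nonneg mult_nonneg_nonneg nonneg)

lemma heat_pos: "0 < heat \<sigma> \<alpha> x k"
  by (rule less_le_trans[OF _ heat_ge]) (use \<sigma> in simp)

text \<open>Each summand of the heat at \<open>k\<close> survives the lag up to the factor
  \<open>c\<close>, and the square of \<open>x k\<close> enters with the coefficient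
  \<open>\<alpha> L\<close>. The contributions of inputs strictly between \<open>k\<close> and
  \<open>k + L\<close> are nonnegative and are discarded.\<close>

lemma heat_add:
  assumes "1 \<le> k"
  shows "c * (heat \<sigma> \<alpha> x k + (x k)\<^sup>2) \<le> heat \<sigma> \<alpha> x (k + L)"
proof -
  have "c * (heat \<sigma> \<alpha> x k + (x k)\<^sup>2)
      = c * \<sigma>\<^sup>2 + (\<Sum>l=1..<k. c * \<alpha> (k - l) * (x l)\<^sup>2) + c * (x k)\<^sup>2"
    by (simp add: heat_def distrib_left sum_distrib_left mult.assoc)
  also have "\<dots> \<le> \<sigma>\<^sup>2 + (\<Sum>l=1..<k. \<alpha> (k + L - l) * (x l)\<^sup>2) + \<alpha> (k + L - k) * (x k)\<^sup>2"
  proof (intro add_mono sum_mono mult_right_mono)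
    show "c * \<sigma>\<^sup>2 \<le> \<sigma>\<^sup>2" using c by (simp add: mult_left_le_one_le)
    show "c * \<alpha> (k - l) \<le> \<alpha> (k + L - l)" if "l \<in> {1..<k}" for l
    proof -
      have "k - l + L = k + L - l" "1 \<le> k - l" using that by auto
      then show ?thesis using persistent[of "k - l"] by simp
    qed
    show "c \<le> \<alpha> (k + L - k)" using persistent_0 by simp
  qed auto
  also have "\<dots> = \<sigma>\<^sup>2 + (\<Sum>l=1..<Suc k. \<alpha> (k + L - l) * (x l)\<^sup>2)"
    using assms by simp
  also have "\<dots> \<le> heat \<sigma> \<alpha> x (k + L)"
    unfolding heat_def
    by (intro add_left_mono sum_mono2) (use L in \<open>auto intro!: mult_nonneg_nonneg nonneg\<close>)
  finally show ?thesis .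
qed

text \<open>A crude bound by the total energy is enough, because it is applied only to the
  \<open>L\<close> boundary terms and only under a logarithm.\<close>

lemma heat_le:
  assumes "1 \<le> k" "k \<le> n"
  shows "heat \<sigma> \<alpha> x k + (x k)\<^sup>2 \<le> \<sigma>\<^sup>2 + A * (\<Sum>l=1..n. (x l)\<^sup>2)"
proof -
  have "heat \<sigma> \<alpha> x k + (x k)\<^sup>2 \<le> \<sigma>\<^sup>2 + (\<Sum>l=1..<k. A * (x l)\<^sup>2) + A * (x k)\<^sup>2"
    unfolding heat_def
  proof (intro add_mono sum_mono mult_right_mono order.refl)
    show "(x k)\<^sup>2 \<le> A * (x k)\<^sup>2" using mult_right_mono[OF A, of "(x k)\<^sup>2"] by simp
  qed (auto intro!: bounded)
  also have "\<dots> = \<sigma>\<^sup>2 + (\<Sum>l=1..<Suc k. A * (x l)\<^sup>2)"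
    using assms by simp
  also have "\<dots> \<le> \<sigma>\<^sup>2 + (\<Sum>l=1..n. A * (x l)\<^sup>2)"
    by (intro add_left_mono sum_mono2) (use assms A in auto)
  finally show ?thesis by (simp add: sum_distrib_left)
qed

text \<open>One step of the recursion gives both parts: a squared output is at most twice the
  squared input plus twice the squared scaled noise, and for the first part \<open>heat_add\<close>
  then passes to the next lag. The second part stops before \<open>heat_add\<close>, so that for k
  <= n < k + L it refers to no input after time \<open>n\<close>, about which a code of length
  \<open>n\<close> says nothing.\<close>

lemma ref_var_le:
  assumes "1 \<le> k" "\<And>i. 1 \<le> i \<Longrightarrow> i < k \<Longrightarrow> y i = channel_output \<sigma> \<alpha> u x i"
  shows "ref_var y k \<le> heat \<sigma> \<alpha> x k * noise_factor u k"
    and "y k = channel_output \<sigma> \<alpha> u x k \<Longrightarrow>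
      ref_var y (k + L) \<le> c * (heat \<sigma> \<alpha> x k + (x k)\<^sup>2) * noise_factor u (k + L)"
proof -
  have step: "ref_var y (k + L) \<le> c * (heat \<sigma> \<alpha> x k + (x k)\<^sup>2) * noise_factor u (k + L)"
    if "1 \<le> k" "ref_var y k \<le> heat \<sigma> \<alpha> x k * noise_factor u k"
      "y k = channel_output \<sigma> \<alpha> u x k" for k
  proof -
    let ?S = "heat \<sigma> \<alpha> x k" and ?N = "noise_factor u k" and ?u = "(u k)\<^sup>2" and ?x = "(x k)\<^sup>2"
    have S: "0 < ?S" by (rule heat_pos)
    have N: "1 \<le> ?N" using that by (simp add: noise_factor_ge_1)
    have "0 \<le> (x k - sqrt ?S * u k)\<^sup>2" by simp
    then have "(y k)\<^sup>2 \<le> 2 * ?x + 2 * (?S * ?u)"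
      using S by (simp add: that channel_output_heat power2_sum power2_diff power_mult_distrib)
    then have "ref_var y k + (y k)\<^sup>2 \<le> ?S * ?N + (2 * ?x + 2 * (?S * ?u))"
      using that by simp
    also have "\<dots> \<le> (?S + ?x) * (?N + 2 + 2 * ?u)"
    proof -
      have "0 \<le> ?x * ?N" "0 \<le> ?x * ?u" using N by auto
      then show ?thesis using S by (simp add: algebra_simps)
    qed
    finally have "c / 2 * (ref_var y k + (y k)\<^sup>2) \<le> c / 2 * ((?S + ?x) * (?N + 2 + 2 * ?u))"
      using c by (intro mult_left_mono) auto
    also have "\<dots> = c * (?S + ?x) * (?N / 2 + 1 + ?u)" by (simp add: field_simps)
    finally show ?thesis
      using that by (simp add: ref_var_add noise_factor_add)
  qed
  show 1: "ref_var y k \<le> heat \<sigma> \<alpha> x k * noise_factor u k"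
    using assms
  proof (induction k rule: period_induct)
    case (init k)
    then show ?case using heat_ge by (simp add: ref_var_init noise_factor_init)
  next
    case (add k)
    have "ref_var y (k + L) \<le> c * (heat \<sigma> \<alpha> x k + (x k)\<^sup>2) * noise_factor u (k + L)"
      using add L by (intro step) auto
    also have "\<dots> \<le> heat \<sigma> \<alpha> x (k + L) * noise_factor u (k + L)"
      using heat_add[OF add(1)] noise_factor_ge_1[of "k + L" u] add(1) by (intro mult_right_mono) auto
    finally show ?case .
  qed
  show "ref_var y (k + L) \<le> c * (heat \<sigma> \<alpha> x k + (x k)\<^sup>2) * noise_factor u (k + L)"
    if "y k = channel_output \<sigma> \<alpha> u x k"
    by (rule step[OF assms(1) 1 that])
qed

text \<open>
  Since \<open>ref_var y k + (y k)\<^sup>2 = 2 / c * ref_var y (k + L)\<close>, the logarithms of the reference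
  variances telescope.
\<close>
lemma information_density_le:
  assumes n: "1 \<le> n" and D: "\<And>k. k \<in> {1..n} \<Longrightarrow> 0 < D k"
    and y: "\<And>i. i \<in> {1..n} \<Longrightarrow> y i = channel_output \<sigma> \<alpha> u x i"
  shows "- ln (\<Prod>k=1..n. ref_density y k * sqrt (heat \<sigma> \<alpha> x k) / D k)
    \<le> (\<Sum>k=1..n. ln (D k)) + real n * ln (2 * pi / c) + (\<Sum>k=1..n. noise_factor u k)
      + (\<Sum>j=1..L. noise_factor u (n + j) + ln (real n) + (1 + A / \<sigma>\<^sup>2 * (\<Sum>l=1..n. (x l)\<^sup>2)) / real n)"
proof -
  let ?V = "ref_var y" and ?S = "heat \<sigma> \<alpha> x" and ?N = "noise_factor u"
  let ?z = "1 + A / \<sigma>\<^sup>2 * (\<Sum>l=1..n. (x l)\<^sup>2)"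
  have z1: "1 \<le> ?z" using A by (auto intro!: mult_nonneg_nonneg divide_nonneg_nonneg sum_nonneg)
  have S: "0 < ?S k" for k by (rule heat_pos)
  have V: "0 < ?V k" if "1 \<le> k" for k using that by (rule ref_var_pos)
  have VN: "ln (?V k) - ln (?S k) \<le> ?N k" if k: "k \<in> {1..n}" for k
  proof -
    have N: "1 \<le> ?N k" using k by (simp add: noise_factor_ge_1)
    have "?V k \<le> ?S k * ?N k" using k y by (intro ref_var_le) auto
    then have "ln (?V k) \<le> ln (?S k * ?N k)" using V[of k] k by simp
    also have "\<dots> = ln (?S k) + ln (?N k)" using S[of k] N by (simp add: ln_mult)
    also have "ln (?N k) \<le> ?N k" using N by (intro ln_bound) auto
    finally show ?thesis by simp
  qed
  have N0: "1 \<le> ?N k" if "k \<in> {1..n}" for k using that by (simp add: noise_factor_ge_1)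
  have Vend: "ln (?V (n + j)) - ln (?V j) \<le> ?N (n + j) + ln (real n) + ?z / real n"
    if j: "j \<in> {1..L}" for j
  proof -
    have N: "1 \<le> ?N (n + j)" using j by (simp add: noise_factor_ge_1)
    have "?V (n + j) \<le> \<sigma>\<^sup>2 * ?z * ?N (n + j)"
    proof (cases "n + j \<le> L")
      case True
      then show ?thesis
        using z1 \<sigma> by (simp add: ref_var_init noise_factor_init)
    next
      case False
      define k where "k = n + j - L"
      have k: "k \<in> {1..n}" "n + j = k + L" using False j by (auto simp: k_def)
      have "?V (k + L) \<le> c * (?S k + (x k)\<^sup>2) * ?N (k + L)"
        using k y by (intro ref_var_le(2)) auto
      also have "\<dots> \<le> (\<sigma>\<^sup>2 * ?z) * ?N (k + L)"
      proof (intro mult_right_mono)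
        have "c * (?S k + (x k)\<^sup>2) \<le> 1 * (?S k + (x k)\<^sup>2)"
          using c S[of k] by (intro mult_right_mono) (auto intro: add_nonneg_nonneg less_imp_le)
        also have "\<dots> \<le> \<sigma>\<^sup>2 * ?z"
          using heat_le[of k n x] k \<sigma> by (simp add: distrib_left)
        finally show "c * (?S k + (x k)\<^sup>2) \<le> \<sigma>\<^sup>2 * ?z" .
      qed (use N k in auto)
      finally show ?thesis using k by simp
    qed
    then have "ln (?V (n + j)) \<le> ln (\<sigma>\<^sup>2 * ?z * ?N (n + j))"
      using V[of "n + j"] j by simp
    also have "\<dots> = ln (\<sigma>\<^sup>2) + ln ?z + ln (?N (n + j))"
      using N z1 \<sigma> by (simp add: ln_mult)
    also have "ln (\<sigma>\<^sup>2) = ln (?V j)" using j by (simp add: ref_var_init)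
    also have "ln (?N (n + j)) \<le> ?N (n + j)" using N by (intro ln_bound) auto
    \<comment> \<open>Splitting off ln n before using ln s <= s leaves the energy divided by
      \<open>n\<close>. Its mean is then bounded by the average power, and the boundary contributes
      only O(ln n).\<close>
    also have "ln ?z = ln (real n) + ln (?z / real n)"
      using z1 n by (subst ln_div) auto
    also have "ln (?z / real n) \<le> ?z / real n" using z1 n by (intro ln_bound) auto
    finally show ?thesis by simp
  qed
  \<comment> \<open>The Cauchy density contributes ln V / 2 - ln pi - ln (V + y^2), and ln (V + y^2)
    is the logarithm of the next reference variance plus ln (2 / c). Completing ln V / 2 to a full
    ln V for the telescoping leaves half the difference of ln V and ln S, which \<open>VN\<close>
    controls.\<close>
  have summand: "- ln (ref_density y k * sqrt (?S k) / D k)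
    = ln (D k) + ln (2 * pi / c) + (ln (?V k) - ln (?S k)) / 2 + (ln (?V (k + L)) - ln (?V k))"
    if k: "k \<in> {1..n}" for k
  proof -
    have Vk: "0 < ?V k" using k by (simp add: V)
    have W: "0 < ?V k + (y k)\<^sup>2" using Vk by (simp add: add_pos_nonneg)
    have "ln (?V (k + L)) = ln c - ln 2 + ln (?V k + (y k)\<^sup>2)"
      using W c k by (simp add: ref_var_add ln_mult ln_div)
    moreover have "ln (ref_density y k * sqrt (?S k) / D k)
        = ln (?V k) / 2 - (ln pi + ln (?V k + (y k)\<^sup>2)) + ln (?S k) / 2 - ln (D k)"
      using D[OF k] W Vk S[of k] by (simp add: ref_density_def ln_div ln_mult ln_sqrt)
    ultimately show ?thesis using c by (simp add: ln_div ln_mult field_simps)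
  qed
  have "- ln (\<Prod>k=1..n. ref_density y k * sqrt (?S k) / D k)
      = (\<Sum>k=1..n. - ln (ref_density y k * sqrt (?S k) / D k))"
  proof -
    have "ref_density y k * sqrt (?S k) / D k \<noteq> 0" if "k \<in> {1..n}" for k
      using that S[of k] D[OF that] ref_density_pos[of k y] by auto
    then have "ln (\<Prod>k=1..n. ref_density y k * sqrt (?S k) / D k)
        = (\<Sum>k=1..n. ln (ref_density y k * sqrt (?S k) / D k))"
      by (intro ln_prod) blast+
    then show ?thesis by (simp add: sum_negf)
  qed
  also have "\<dots> = (\<Sum>k=1..n. ln (D k)) + real n * ln (2 * pi / c)
      + (\<Sum>k=1..n. (ln (?V k) - ln (?S k)) / 2) + (\<Sum>k=1..n. ln (?V (k + L)) - ln (?V k))"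
    by (simp only: summand cong: sum.cong) (simp add: sum.distrib)
  also have "(\<Sum>k=1..n. ln (?V (k + L)) - ln (?V k)) = (\<Sum>j=1..L. ln (?V (n + j)) - ln (?V j))"
    by (rule sum_shift_diff)
  also have "\<dots> \<le> (\<Sum>j=1..L. ?N (n + j) + ln (real n) + ?z / real n)"
    by (intro sum_mono Vend)
  also have "(\<Sum>k=1..n. (ln (?V k) - ln (?S k)) / 2) \<le> (\<Sum>k=1..n. ?N k)"
  proof (intro sum_mono)
    show "(ln (?V k) - ln (?S k)) / 2 \<le> ?N k" if "k \<in> {1..n}" for k
      using VN[OF that] N0[OF that] by simp
  qed
  finally show ?thesis by simp
qed

end

text \<open>From some \<open>K\<close> on, one step costs at most the factor \<open>\<rho>\<close>,
  so a lag costs at most \<open>\<rho> ^ L\<close>. The finitely many earlier indices are handled by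
  a minimum of positive coefficients, once the lag carries them into the positive range.\<close>

lemma persistent_heat_exists:
  assumes \<sigma>: "0 < \<sigma>" and nonneg: "\<And>l. 1 \<le> l \<Longrightarrow> 0 \<le> \<alpha> l" and bdd: "bdd_above (\<alpha> ` {1..})"
    and lim: "0 < liminf (coeff_ratio \<alpha>)"
  obtains c A L where "persistent_heat \<sigma> \<alpha> c A L"
proof -
  obtain r0 where r0: "0 < r0" "r0 < liminf (coeff_ratio \<alpha>)"
    using lim dense by blast
  \<comment> \<open>\<open>r0\<close> is extended real and may be infinite, in which case any
    positive real serves.\<close>
  obtain r :: real where r: "0 < r" "ereal r \<le> r0"
    using r0(1) by (cases r0) (auto intro: that[of 1])
  define \<rho> where "\<rho> = min r 1"
  have \<rho>: "0 < \<rho>" "\<rho> \<le> 1" using r by (auto simp: \<rho>_def)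
  have "\<forall>\<^sub>F l in sequentially. r0 < coeff_ratio \<alpha> l"
    using r0(2) by (simp add: less_LiminfD)
  then obtain K where K: "\<And>l. K \<le> l \<Longrightarrow> r0 < coeff_ratio \<alpha> l"
    by (auto simp: eventually_sequentially)
  \<comment> \<open>Every index l + L - 1 is then at least \<open>K\<close> and at least 1, as
    \<open>pos\<close> requires; the 2 instead of 1 covers l = 0 with K = 0.\<close>
  define L where "L = K + 2"
  have pos: "0 < \<alpha> (l + 1)" and ratio: "\<rho> * \<alpha> l \<le> \<alpha> (l + 1)" if l: "K \<le> l" "1 \<le> l" for l
  proof -
    have "0 < coeff_ratio \<alpha> l" using K[OF l(1)] r0(1) by auto
    \<comment> \<open>A zero numerator gives the ratio 0 even over a zero denominator, by the
      convention 0 / 0 = 0, so a positive ratio excludes it.\<close>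
    then have "\<alpha> (l + 1) \<noteq> 0" by (auto simp: coeff_ratio_def split: if_splits)
    then show p: "0 < \<alpha> (l + 1)" using nonneg[of "l + 1"] by auto
    show "\<rho> * \<alpha> l \<le> \<alpha> (l + 1)"
    proof (cases "\<alpha> l = 0")
      case False
      then have "0 < \<alpha> l" using nonneg[of l] l by auto
      moreover have "ereal r < coeff_ratio \<alpha> l" using K[OF l(1)] r(2) by auto
      ultimately have "r * \<alpha> l < \<alpha> (l + 1)" by (simp add: coeff_ratio_def field_simps)
      moreover have "\<rho> * \<alpha> l \<le> r * \<alpha> l" using \<open>0 < \<alpha> l\<close> by (intro mult_right_mono) (auto simp: \<rho>_def)
      ultimately show ?thesis by simp
    qed (use p in simp)
  qed
  have iter: "\<rho> ^ m * \<alpha> l \<le> \<alpha> (l + m)" if "K \<le> l" "1 \<le> l" for l m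
  proof (induction m)
    case (Suc m)
    have "\<rho> ^ Suc m * \<alpha> l \<le> \<rho> * \<alpha> (l + m)" using Suc \<rho> by (simp add: mult.assoc)
    also have "\<dots> \<le> \<alpha> (l + Suc m)" using ratio[of "l + m"] that by simp
    finally show ?case .
  qed simp
  obtain B where B: "\<And>l. 1 \<le> l \<Longrightarrow> \<alpha> l \<le> B" using bdd by (auto simp: bdd_above_def)
  define A where "A = max B 1"
  have A: "1 \<le> A" "\<And>l. 1 \<le> l \<Longrightarrow> \<alpha> l \<le> A" using B by (auto simp: A_def le_max_iff_disj)
  define e where "e = Min ((\<lambda>l. \<alpha> (l + L)) ` {0..K})"
  have posL: "0 < \<alpha> (l + L)" for l using pos[of "l + L - 1"] by (simp add: L_def)
  have e: "0 < e" "\<And>l. l \<le> K \<Longrightarrow> e \<le> \<alpha> (l + L)"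
    by (auto simp: e_def posL)
  \<comment> \<open>\<open>e / A\<close> serves the indices up to \<open>K\<close>,
    \<open>\<rho> ^ L\<close> the later ones, and \<open>e\<close> serves
    \<open>persistent_0\<close>.\<close>
  define c where "c = Min {1, e / A, e, \<rho> ^ L}"
  have c: "0 < c" "c \<le> 1" "c \<le> e / A" "c \<le> e" "c \<le> \<rho> ^ L"
    using e A \<rho> by (auto simp: c_def)
  have "c * \<alpha> l \<le> \<alpha> (l + L)" if "1 \<le> l" for l
  proof (cases "l \<le> K")
    case True
    have "c * \<alpha> l \<le> e / A * A" using that c A nonneg[of l] by (intro mult_mono) auto
    also have "\<dots> = e" using A by simp
    also have "\<dots> \<le> \<alpha> (l + L)" using e True by simp
    finally show ?thesis .
  next
    case False
    have "c * \<alpha> l \<le> \<rho> ^ L * \<alpha> l" using c nonneg that by (intro mult_right_mono) auto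
    also have "\<dots> \<le> \<alpha> (l + L)" using iter[of l L] False that by simp
    finally show ?thesis .
  qed
  moreover have "c \<le> \<alpha> L" using e(2)[of 0] c by simp
  ultimately have "persistent_heat \<sigma> \<alpha> c A L"
    using \<sigma> c A nonneg by unfold_locales (auto simp: L_def)
  then show thesis by (rule that)
qed

section \<open>Change of measure\<close>

lemma sets_PiM_lborel [measurable_cong]:
  "sets (Pi\<^sub>M I (\<lambda>_. lborel :: real measure)) = sets (Pi\<^sub>M I (\<lambda>_. borel))"
  by (rule sets_PiM_cong) auto

section \<open>Causality and measurability of the feedback loop\<close>

abbreviation fb_output ::
  "real \<Rightarrow> (nat \<Rightarrow> real) \<Rightarrow> (nat \<Rightarrow> (nat \<Rightarrow> real) \<Rightarrow> real) \<Rightarrow> (nat \<Rightarrow> real) \<Rightarrow> nat \<Rightarrow> real" where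
  "fb_output \<sigma> \<alpha> \<phi> u \<equiv> channel_output \<sigma> \<alpha> u (fb_input \<sigma> \<alpha> \<phi> u)"

lemma heat_cong:
  "(\<And>i. 1 \<le> i \<Longrightarrow> i < k \<Longrightarrow> x i = x' i) \<Longrightarrow> heat \<sigma> \<alpha> x k = heat \<sigma> \<alpha> x' k"
  by (simp add: heat_def)

text \<open>Causality is what permits replacing the noise by its past before time \<open>k\<close>
  when the \<open>k\<close>-th noise sample is integrated out in
  \<open>change_of_measure\<close>.\<close>

lemma fb_input_cong:
  "(\<And>i. 1 \<le> i \<Longrightarrow> i < k \<Longrightarrow> u i = u' i) \<Longrightarrow> fb_input \<sigma> \<alpha> \<phi> u k = fb_input \<sigma> \<alpha> \<phi> u' k"
proof (induction k rule: less_induct)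
  case (less k)
  have x: "fb_input \<sigma> \<alpha> \<phi> u i = fb_input \<sigma> \<alpha> \<phi> u' i" if "i < k" for i
    using less that by auto
  have "fb_output \<sigma> \<alpha> \<phi> u i = fb_output \<sigma> \<alpha> \<phi> u' i" if "i \<in> {1..<k}" for i
    using x that less.prems heat_cong[of i "fb_input \<sigma> \<alpha> \<phi> u" "fb_input \<sigma> \<alpha> \<phi> u'"]
    by (auto simp: channel_output_heat)
  then show ?case
    by (subst (1 2) fb_input.simps) (auto intro!: arg_cong[where f = "\<phi> k"])
qed

lemma fb_output_cong:
  assumes "1 \<le> k" "\<And>i. 1 \<le> i \<Longrightarrow> i \<le> k \<Longrightarrow> u i = u' i"
  shows "fb_output \<sigma> \<alpha> \<phi> u k = fb_output \<sigma> \<alpha> \<phi> u' k"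
proof -
  have "fb_input \<sigma> \<alpha> \<phi> u i = fb_input \<sigma> \<alpha> \<phi> u' i" if "i \<le> k" for i
    using assms that by (intro fb_input_cong) auto
  then show ?thesis
    using heat_cong[of k "fb_input \<sigma> \<alpha> \<phi> u" "fb_input \<sigma> \<alpha> \<phi> u'" \<sigma> \<alpha>] assms
    by (simp add: channel_output_heat)
qed

lemma measurable_heat:
  "(\<And>i. 1 \<le> i \<Longrightarrow> i < k \<Longrightarrow> (\<lambda>w. x w i) \<in> borel_measurable M)
    \<Longrightarrow> (\<lambda>w. heat \<sigma> \<alpha> (x w) k) \<in> borel_measurable M"
  unfolding heat_def
  by (intro borel_measurable_add borel_measurable_sum borel_measurable_times borel_measurable_power
      borel_measurable_const) auto

lemma measurable_fb_input:
  assumes \<phi>: "\<And>k. k \<in> {1..n} \<Longrightarrow> \<phi> k \<in> borel_measurable (Pi\<^sub>M {1..<k} (\<lambda>_. borel))"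
  shows "k \<in> {1..n} \<Longrightarrow> (\<And>i. 1 \<le> i \<Longrightarrow> i < k \<Longrightarrow> (\<lambda>w. u w i) \<in> borel_measurable M)
    \<Longrightarrow> (\<lambda>w. fb_input \<sigma> \<alpha> \<phi> (u w) k) \<in> borel_measurable M"
proof (induction k rule: less_induct)
  case (less k)
  have x: "(\<lambda>w. fb_input \<sigma> \<alpha> \<phi> (u w) i) \<in> borel_measurable M" if "1 \<le> i" "i < k" for i
    using less that by auto
  have "(\<lambda>w. fb_output \<sigma> \<alpha> \<phi> (u w) i) \<in> borel_measurable M" if "i \<in> {1..<k}" for i
  proof -
    have [measurable]: "(\<lambda>w. heat \<sigma> \<alpha> (fb_input \<sigma> \<alpha> \<phi> (u w)) i) \<in> borel_measurable M"
      using that x by (intro measurable_heat) auto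
    have [measurable]: "(\<lambda>w. u w i) \<in> borel_measurable M" "(\<lambda>w. fb_input \<sigma> \<alpha> \<phi> (u w) i) \<in> borel_measurable M"
      using that x less by auto
    show ?thesis unfolding channel_output_heat by measurable
  qed
  then have "(\<lambda>w. \<lambda>i\<in>{1..<k}. fb_output \<sigma> \<alpha> \<phi> (u w) i) \<in> M \<rightarrow>\<^sub>M Pi\<^sub>M {1..<k} (\<lambda>_. borel)"
    by (intro measurable_restrict) auto
  from measurable_compose[OF this \<phi>] less.prems show ?case
    by (subst fb_input.simps) auto
qed

lemma measurable_fb_heat:
  assumes \<phi>: "\<And>k. k \<in> {1..n} \<Longrightarrow> \<phi> k \<in> borel_measurable (Pi\<^sub>M {1..<k} (\<lambda>_. borel))"
    and "k \<in> {1..n}" "\<And>i. 1 \<le> i \<Longrightarrow> i < k \<Longrightarrow> (\<lambda>w. u w i) \<in> borel_measurable M"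
  shows "(\<lambda>w. heat \<sigma> \<alpha> (fb_input \<sigma> \<alpha> \<phi> (u w)) k) \<in> borel_measurable M"
  using assms(2-) by (intro measurable_heat measurable_fb_input[OF \<phi>]) auto

lemma measurable_fb_output:
  assumes \<phi>: "\<And>k. k \<in> {1..n} \<Longrightarrow> \<phi> k \<in> borel_measurable (Pi\<^sub>M {1..<k} (\<lambda>_. borel))"
    and k: "k \<in> {1..n}" "\<And>i. 1 \<le> i \<Longrightarrow> i \<le> k \<Longrightarrow> (\<lambda>w. u w i) \<in> borel_measurable M"
  shows "(\<lambda>w. fb_output \<sigma> \<alpha> \<phi> (u w) k) \<in> borel_measurable M"
proof -
  have [measurable]: "(\<lambda>w. heat \<sigma> \<alpha> (fb_input \<sigma> \<alpha> \<phi> (u w)) k) \<in> borel_measurable M"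
    using k by (intro measurable_fb_heat[OF \<phi>]) auto
  have [measurable]: "(\<lambda>w. fb_input \<sigma> \<alpha> \<phi> (u w) k) \<in> borel_measurable M" "(\<lambda>w. u w k) \<in> borel_measurable M"
    using k by (auto intro!: measurable_fb_input[OF \<phi>])
  show ?thesis unfolding channel_output_heat by measurable
qed

text \<open>\<open>conditional_density\<close> yields \<open>d\<close> and \<open>H\<close> only
  existentially. Fixing them here allows definitions that depend on them; the assumptions are
  discharged in \<open>capacity_fb_bounded\<close>.\<close>

locale persistent_channel = noise_process \<Omega> U + persistent_heat \<sigma> \<alpha> c A L
  for \<Omega> :: "'a measure" and U \<sigma> \<alpha> c A L +
  fixes d :: "int \<Rightarrow> real \<times> (int \<Rightarrow> real) \<Rightarrow> real" and H :: real
  assumes d_measurable [measurable]: "\<And>k. d k \<in> borel_measurable (borel \<Otimes>\<^sub>M Pi\<^sub>M {..<k} (\<lambda>_. borel))"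
    and H_nonneg: "0 \<le> H"
    and d_pos: "\<And>k. AE \<omega> in \<Omega>. 0 < d k (U k \<omega>, past k \<omega>)"
    and d_ln: "\<And>k. (\<integral>\<^sup>+ \<omega>. ennreal (ln (d k (U k \<omega>, past k \<omega>))) \<partial>\<Omega>) = ennreal H"
    and d_density: "\<And>k F. F \<in> borel_measurable (borel \<Otimes>\<^sub>M Pi\<^sub>M {..<k} (\<lambda>_. borel)) \<Longrightarrow>
      (\<integral>\<^sup>+ \<omega>. F (U k \<omega>, past k \<omega>) * ennreal (1 / d k (U k \<omega>, past k \<omega>)) \<partial>\<Omega>)
      \<le> (\<integral>\<^sup>+ \<omega>. (\<integral>\<^sup>+ u. F (u, past k \<omega>) \<partial>lborel) \<partial>\<Omega>)"
begin

definition noise :: "'a \<Rightarrow> nat \<Rightarrow> real" where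
  "noise \<omega> i = U (int i) \<omega>"

definition D :: "nat \<Rightarrow> 'a \<Rightarrow> real" where
  "D k \<omega> = d (int k) (U (int k) \<omega>, past (int k) \<omega>)"

text \<open>Given the message and the infinite noise past, output \<open>k\<close> is affine in the
  noise with slope the square root of the heat, so its density is \<open>D k\<close> divided by that
  slope. This is thus the reference density over the true conditional density, and minus the
  logarithm of the product over \<open>k\<close> is the information density.\<close>

definition ratio :: "(nat \<Rightarrow> (nat \<Rightarrow> real) \<Rightarrow> real) \<Rightarrow> nat \<Rightarrow> 'a \<Rightarrow> real" where
  "ratio \<phi> k \<omega> = ref_density (fb_output \<sigma> \<alpha> \<phi> (noise \<omega>)) k
    * sqrt (heat \<sigma> \<alpha> (fb_input \<sigma> \<alpha> \<phi> (noise \<omega>)) k) / D k \<omega>"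

lemma measurable_noise [measurable]: "(\<lambda>\<omega>. noise \<omega> i) \<in> borel_measurable \<Omega>"
  unfolding noise_def by measurable

lemma measurable_D [measurable]: "D k \<in> borel_measurable \<Omega>"
  unfolding D_def by measurable

text \<open>
  The last factor of the product is integrated out first: given the past, \<open>U n\<close> has density \<open>d n\<close>, which cancels
  against \<open>1 / D n\<close>, and the affine substitution \<open>u \<mapsto> x + s u\<close> absorbs the factor \<open>s\<close> of \<open>ratio\<close>.
\<close>
lemma change_of_measure:
  assumes "\<And>k. k \<in> {1..n} \<Longrightarrow> \<phi> k \<in> borel_measurable (Pi\<^sub>M {1..<k} (\<lambda>_. borel))"
    and "g \<in> borel_measurable (Pi\<^sub>M {1..n} (\<lambda>_. borel))"
  shows "(\<integral>\<^sup>+ \<omega>. g (\<lambda>i\<in>{1..n}. fb_output \<sigma> \<alpha> \<phi> (noise \<omega>) i) * (\<Prod>k=1..n. ennreal (ratio \<phi> k \<omega>)) \<partial>\<Omega>)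
    \<le> (\<integral>\<^sup>+ y. g y * (\<Prod>k=1..n. ennreal (ref_density y k)) \<partial>Pi\<^sub>M {1..n} (\<lambda>_. lborel))"
  using assms
proof (induction n arbitrary: g)
  case 0
  interpret product_sigma_finite "\<lambda>_::nat. lborel :: real measure" ..
  show ?case
    by (simp add: nn_integral_empty emeasure_space_1 restrict_def)
next
  case (Suc n)
  interpret P: product_sigma_finite "\<lambda>_::nat. lborel :: real measure" ..
  let ?k = "Suc n"
  have \<phi>: "k \<in> {1..Suc n} \<Longrightarrow> \<phi> k \<in> borel_measurable (Pi\<^sub>M {1..<k} (\<lambda>_. borel))" for k
    using Suc.prems by auto
  have gm [measurable]: "g \<in> borel_measurable (Pi\<^sub>M {1..?k} (\<lambda>_. borel))" by fact
  have ins: "{1..?k} = insert ?k {1..n}" by auto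
  have upd [measurable]: "(\<lambda>p. (fst p)(?k := snd p)) \<in> Pi\<^sub>M {1..n} (\<lambda>_. borel) \<Otimes>\<^sub>M borel \<rightarrow>\<^sub>M Pi\<^sub>M {1..?k} (\<lambda>_. borel :: real measure)"
    unfolding ins using measurable_add_dim[of ?k "{1..n}" "\<lambda>_. borel :: real measure"]
    by (simp add: case_prod_beta')
  have rd [measurable]: "(\<lambda>y. ref_density y k) \<in> borel_measurable (Pi\<^sub>M {1..?k} (\<lambda>_. borel))"
    if "k \<in> {1..?k}" for k
    using that by (intro measurable_ref_density measurable_component_singleton) auto
  \<comment> \<open>\<open>q\<close> absorbs the last reference factor and \<open>g'\<close>
    integrates out the last output. Since this changes the test function, the induction runs over
    arbitrary \<open>g\<close>.\<close>
  define q where "q y = g y * ennreal (ref_density y ?k)" for y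
  have qm [measurable]: "q \<in> borel_measurable (Pi\<^sub>M {1..?k} (\<lambda>_. borel))"
    unfolding q_def by measurable
  define g' where "g' y = (\<integral>\<^sup>+ t. q (y(?k := t)) \<partial>lborel)" for y
  have "(\<lambda>p. q ((fst p)(?k := snd p))) \<in> borel_measurable (Pi\<^sub>M {1..n} (\<lambda>_. borel) \<Otimes>\<^sub>M lborel)"
    by measurable
  then have g'm: "g' \<in> borel_measurable (Pi\<^sub>M {1..n} (\<lambda>_. borel))"
    unfolding g'_def by (intro lborel.borel_measurable_nn_integral) (simp add: case_prod_beta')
  let ?nz = "\<lambda>(w::int \<Rightarrow> real) (i::nat). w (int i)"
  let ?x = "\<lambda>u. fb_input \<sigma> \<alpha> \<phi> u ?k" and ?s = "\<lambda>u. sqrt (heat \<sigma> \<alpha> (fb_input \<sigma> \<alpha> \<phi> u) ?k)"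
  let ?Y = "\<lambda>u. \<lambda>i\<in>{1..n}. fb_output \<sigma> \<alpha> \<phi> u i"
  \<comment> \<open>\<open>d_density\<close> accepts only functions of the current noise and its
    past. Hence \<open>Pr\<close> and \<open>F\<close> recompute the earlier factors and the last
    output from an arbitrary path \<open>w\<close> before time n + 1, and the equations below
    identify them with the original quantities.\<close>
  define Pr where "Pr w = (\<Prod>k=1..n. ennreal (ref_density (fb_output \<sigma> \<alpha> \<phi> (?nz w)) k
    * sqrt (heat \<sigma> \<alpha> (fb_input \<sigma> \<alpha> \<phi> (?nz w)) k) / d (int k) (w (int k), restrict w {..<int k})))" for w
  define F where "F p = Pr (snd p) * (q ((?Y (?nz (snd p)))(?k := ?x (?nz (snd p)) + ?s (?nz (snd p)) * fst p))
    * ennreal (?s (?nz (snd p))))" for p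
  let ?M = "Pi\<^sub>M {..<int ?k} (\<lambda>_. borel :: real measure)"
  have nz: "(\<lambda>w. w (int i)) \<in> borel_measurable ?M" if "i \<le> n" for i :: nat
    using that by (intro measurable_component_singleton) auto
  have xm [measurable]: "(\<lambda>w. ?x (?nz w)) \<in> borel_measurable ?M"
    using nz by (intro measurable_fb_input[OF \<phi>]) auto
  have sm [measurable]: "(\<lambda>w. heat \<sigma> \<alpha> (fb_input \<sigma> \<alpha> \<phi> (?nz w)) k) \<in> borel_measurable ?M" if "k \<in> {1..?k}" for k
    using that nz by (intro measurable_fb_heat[OF \<phi>]) auto
  have ym: "(\<lambda>w. fb_output \<sigma> \<alpha> \<phi> (?nz w) k) \<in> borel_measurable ?M" if "k \<in> {1..n}" for k
    using that nz by (intro measurable_fb_output[OF \<phi>]) auto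
  have Ym [measurable]: "(\<lambda>w. ?Y (?nz w)) \<in> ?M \<rightarrow>\<^sub>M Pi\<^sub>M {1..n} (\<lambda>_. borel)"
    using ym by (intro measurable_restrict) auto
  have Prm [measurable]: "Pr \<in> borel_measurable ?M"
    unfolding Pr_def
  proof (intro borel_measurable_prod_ennreal)
    fix k assume k: "k \<in> {1..n}"
    have [measurable]: "(\<lambda>w. ref_density (fb_output \<sigma> \<alpha> \<phi> (?nz w)) k) \<in> borel_measurable ?M"
      using k ym by (intro measurable_ref_density) auto
    have [measurable]: "(\<lambda>w. restrict w {..<int k}) \<in> ?M \<rightarrow>\<^sub>M Pi\<^sub>M {..<int k} (\<lambda>_. borel)"
      using k by (intro measurable_restrict_subset) auto
    have [measurable]: "(\<lambda>w. w (int k)) \<in> borel_measurable ?M"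
      using k by (intro nz) auto
    have [measurable]: "(\<lambda>w. heat \<sigma> \<alpha> (fb_input \<sigma> \<alpha> \<phi> (?nz w)) k) \<in> borel_measurable ?M"
      using k by (intro sm) auto
    show "(\<lambda>w. ennreal (ref_density (fb_output \<sigma> \<alpha> \<phi> (?nz w)) k
    * sqrt (heat \<sigma> \<alpha> (fb_input \<sigma> \<alpha> \<phi> (?nz w)) k) / d (int k) (w (int k), restrict w {..<int k}))) \<in> borel_measurable ?M"
      by measurable
  qed
  have Fm: "F \<in> borel_measurable (borel \<Otimes>\<^sub>M ?M)"
  proof -
    have [measurable]: "(\<lambda>w. heat \<sigma> \<alpha> (fb_input \<sigma> \<alpha> \<phi> (?nz w)) ?k) \<in> borel_measurable ?M"
      by (rule sm) simp
    have 1: "(\<lambda>p. (?Y (?nz (snd p)), ?x (?nz (snd p)) + ?s (?nz (snd p)) * fst p))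
        \<in> borel \<Otimes>\<^sub>M ?M \<rightarrow>\<^sub>M Pi\<^sub>M {1..n} (\<lambda>_. borel) \<Otimes>\<^sub>M borel"
      by measurable
    have "(\<lambda>p. (?Y (?nz (snd p)))(?k := ?x (?nz (snd p)) + ?s (?nz (snd p)) * fst p))
        \<in> borel \<Otimes>\<^sub>M ?M \<rightarrow>\<^sub>M Pi\<^sub>M {1..?k} (\<lambda>_. borel)"
      using measurable_compose[OF 1 upd] by simp
    from measurable_compose[OF this qm]
    have [measurable]: "(\<lambda>p. q ((?Y (?nz (snd p)))(?k := ?x (?nz (snd p)) + ?s (?nz (snd p)) * fst p)))
        \<in> borel_measurable (borel \<Otimes>\<^sub>M ?M)" .
    show ?thesis unfolding F_def by measurable
  qed
  have past_nz: "?nz (past (int ?k) \<omega>) i = noise \<omega> i" if "i \<le> n" for i \<omega>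
    using that by (simp add: past_def noise_def)
  have in_eq: "fb_input \<sigma> \<alpha> \<phi> (?nz (past (int ?k) \<omega>)) k = fb_input \<sigma> \<alpha> \<phi> (noise \<omega>) k" if "k \<le> ?k" for k \<omega>
    using that past_nz by (intro fb_input_cong) auto
  have heat_eq: "heat \<sigma> \<alpha> (fb_input \<sigma> \<alpha> \<phi> (?nz (past (int ?k) \<omega>))) k = heat \<sigma> \<alpha> (fb_input \<sigma> \<alpha> \<phi> (noise \<omega>)) k"
    if "k \<le> ?k" for k \<omega>
    using that in_eq by (intro heat_cong) auto
  have out_eq: "fb_output \<sigma> \<alpha> \<phi> (?nz (past (int ?k) \<omega>)) k = fb_output \<sigma> \<alpha> \<phi> (noise \<omega>) k"
    if "1 \<le> k" "k \<le> n" for k \<omega>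
    using that past_nz by (intro fb_output_cong) auto
  have Y_eq: "?Y (?nz (past (int ?k) \<omega>)) = ?Y (noise \<omega>)" for \<omega>
    using out_eq by auto
  have Pr_eq: "Pr (past (int ?k) \<omega>) = (\<Prod>k=1..n. ennreal (ratio \<phi> k \<omega>))" for \<omega>
    unfolding Pr_def
  proof (intro prod.cong refl)
    fix k assume k: "k \<in> {1..n}"
    have "ref_density (fb_output \<sigma> \<alpha> \<phi> (?nz (past (int ?k) \<omega>))) k = ref_density (fb_output \<sigma> \<alpha> \<phi> (noise \<omega>)) k"
      using k out_eq by (intro ref_density_cong) auto
    moreover have "restrict (past (int ?k) \<omega>) {..<int k} = past (int k) \<omega>" "past (int ?k) \<omega> (int k) = U (int k) \<omega>"
      using k by (auto simp: past_def restrict_def)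
    ultimately show "ennreal (ref_density (fb_output \<sigma> \<alpha> \<phi> (?nz (past (int ?k) \<omega>))) k
        * sqrt (heat \<sigma> \<alpha> (fb_input \<sigma> \<alpha> \<phi> (?nz (past (int ?k) \<omega>))) k)
        / d (int k) (past (int ?k) \<omega> (int k), restrict (past (int ?k) \<omega>) {..<int k})) = ennreal (ratio \<phi> k \<omega>)"
      using k heat_eq[of k \<omega>] by (simp add: ratio_def D_def)
  qed
  have F_eq: "F (u, past (int ?k) \<omega>) = (\<Prod>k=1..n. ennreal (ratio \<phi> k \<omega>))
      * (q ((?Y (noise \<omega>))(?k := ?x (noise \<omega>) + ?s (noise \<omega>) * u)) * ennreal (?s (noise \<omega>)))" for u \<omega>
    unfolding F_def fst_conv snd_conv Pr_eq Y_eq in_eq[OF order.refl] heat_eq[OF order.refl] ..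
  have Y_Suc: "(?Y (noise \<omega>))(?k := ?x (noise \<omega>) + ?s (noise \<omega>) * U (int ?k) \<omega>)
      = (\<lambda>i\<in>{1..?k}. fb_output \<sigma> \<alpha> \<phi> (noise \<omega>) i)" for \<omega>
    by (auto simp: fun_eq_iff restrict_def channel_output_heat noise_def)
  have "(\<integral>\<^sup>+ \<omega>. g (\<lambda>i\<in>{1..?k}. fb_output \<sigma> \<alpha> \<phi> (noise \<omega>) i) * (\<Prod>k=1..?k. ennreal (ratio \<phi> k \<omega>)) \<partial>\<Omega>)
      = (\<integral>\<^sup>+ \<omega>. F (U (int ?k) \<omega>, past (int ?k) \<omega>) * ennreal (1 / D ?k \<omega>) \<partial>\<Omega>)"
  proof (intro nn_integral_cong)
    fix \<omega>
    have rc: "ref_density (\<lambda>i\<in>{1..?k}. fb_output \<sigma> \<alpha> \<phi> (noise \<omega>) i) ?k = ref_density (fb_output \<sigma> \<alpha> \<phi> (noise \<omega>)) ?k"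
      by (intro ref_density_cong) auto
    have "ennreal (ratio \<phi> ?k \<omega>) = ennreal (ref_density (fb_output \<sigma> \<alpha> \<phi> (noise \<omega>)) ?k)
        * ennreal (?s (noise \<omega>)) * ennreal (1 / D ?k \<omega>)"
    proof -
      have "0 \<le> ref_density (fb_output \<sigma> \<alpha> \<phi> (noise \<omega>)) ?k" "0 \<le> ?s (noise \<omega>)"
        using ref_density_pos[of ?k "fb_output \<sigma> \<alpha> \<phi> (noise \<omega>)"] heat_pos[of "fb_input \<sigma> \<alpha> \<phi> (noise \<omega>)" ?k]
        by (auto intro: less_imp_le)
      then show ?thesis
        unfolding ratio_def divide_inverse[of _ "D ?k \<omega>"] divide_inverse[of 1] mult_1
        by (subst ennreal_mult', simp, subst ennreal_mult', auto)
    qed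
    then show "g (\<lambda>i\<in>{1..?k}. fb_output \<sigma> \<alpha> \<phi> (noise \<omega>) i) * (\<Prod>k=1..?k. ennreal (ratio \<phi> k \<omega>))
        = F (U (int ?k) \<omega>, past (int ?k) \<omega>) * ennreal (1 / D ?k \<omega>)"
      unfolding F_eq Y_Suc q_def rc by (simp add: mult_ac)
  qed
  also have "\<dots> \<le> (\<integral>\<^sup>+ \<omega>. (\<integral>\<^sup>+ u. F (u, past (int ?k) \<omega>) \<partial>lborel) \<partial>\<Omega>)"
    unfolding D_def by (rule d_density[OF Fm])
  also have "\<dots> = (\<integral>\<^sup>+ \<omega>. g' (?Y (noise \<omega>)) * (\<Prod>k=1..n. ennreal (ratio \<phi> k \<omega>)) \<partial>\<Omega>)"
  proof (intro nn_integral_cong)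
    fix \<omega>
    let ?y = "?Y (noise \<omega>)" and ?a = "?x (noise \<omega>)" and ?b = "?s (noise \<omega>)"
    have b: "0 < ?b" by (simp add: heat_pos)
    have "?y \<in> space (Pi\<^sub>M {1..n} (\<lambda>_. borel))" by (auto simp: space_PiM)
    then have "(\<lambda>t. (?y, t)) \<in> borel \<rightarrow>\<^sub>M Pi\<^sub>M {1..n} (\<lambda>_. borel) \<Otimes>\<^sub>M (borel :: real measure)"
      by (rule measurable_Pair1')
    from measurable_compose[OF measurable_compose[OF this upd] qm]
    have qy [measurable]: "(\<lambda>t. q (?y(?k := t))) \<in> borel_measurable borel" by simp
    have "(\<integral>\<^sup>+ u. F (u, past (int ?k) \<omega>) \<partial>lborel)
        = (\<Prod>k=1..n. ennreal (ratio \<phi> k \<omega>)) * ((\<integral>\<^sup>+ u. q (?y(?k := ?a + ?b * u)) \<partial>lborel) * ennreal ?b)"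
      unfolding F_eq by (subst nn_integral_cmult, measurable, subst nn_integral_multc, measurable)
    also have "(\<integral>\<^sup>+ u. q (?y(?k := ?a + ?b * u)) \<partial>lborel) * ennreal ?b = g' ?y"
      unfolding g'_def using b nn_integral_real_affine[OF qy, of ?b ?a] by (simp add: mult.commute)
    finally show "(\<integral>\<^sup>+ u. F (u, past (int ?k) \<omega>) \<partial>lborel) = g' ?y * (\<Prod>k=1..n. ennreal (ratio \<phi> k \<omega>))"
      by (simp add: mult.commute)
  qed
  also have "\<dots> \<le> (\<integral>\<^sup>+ y. g' y * (\<Prod>k=1..n. ennreal (ref_density y k)) \<partial>Pi\<^sub>M {1..n} (\<lambda>_. lborel))"
    using Suc.prems g'm by (intro Suc.IH) auto
  also have "\<dots> = (\<integral>\<^sup>+ y. (\<integral>\<^sup>+ t. g (y(?k := t)) * (\<Prod>k=1..?k. ennreal (ref_density (y(?k := t)) k)) \<partial>lborel)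
      \<partial>Pi\<^sub>M {1..n} (\<lambda>_. lborel))"
  proof (intro nn_integral_cong)
    fix y :: "nat \<Rightarrow> real" assume "y \<in> space (Pi\<^sub>M {1..n} (\<lambda>_. lborel))"
    then have "y \<in> space (Pi\<^sub>M {1..n} (\<lambda>_. borel))" by (simp add: space_PiM)
    then have "(\<lambda>t. (y, t)) \<in> borel \<rightarrow>\<^sub>M Pi\<^sub>M {1..n} (\<lambda>_. borel) \<Otimes>\<^sub>M (borel :: real measure)"
      by (rule measurable_Pair1')
    from measurable_compose[OF measurable_compose[OF this upd] qm]
    have qy [measurable]: "(\<lambda>t. q (y(?k := t))) \<in> borel_measurable borel" by simp
    have "ref_density (y(?k := t)) k = ref_density y k" if "k \<in> {1..n}" for k t
      using that by (intro ref_density_cong) auto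
    then have "(\<Prod>k=1..n. ennreal (ref_density (y(?k := t)) k)) = (\<Prod>k=1..n. ennreal (ref_density y k))" for t
      by (intro prod.cong) auto
    then have "g (y(?k := t)) * (\<Prod>k=1..?k. ennreal (ref_density (y(?k := t)) k))
        = q (y(?k := t)) * (\<Prod>k=1..n. ennreal (ref_density y k))" for t
      by (simp add: q_def mult_ac)
    then show "g' y * (\<Prod>k=1..n. ennreal (ref_density y k))
        = (\<integral>\<^sup>+ t. g (y(?k := t)) * (\<Prod>k=1..?k. ennreal (ref_density (y(?k := t)) k)) \<partial>lborel)"
      unfolding g'_def by (simp only:) (rule nn_integral_multc[symmetric], measurable)
  qed
  also have "\<dots> = (\<integral>\<^sup>+ y. g y * (\<Prod>k=1..?k. ennreal (ref_density y k)) \<partial>Pi\<^sub>M {1..?k} (\<lambda>_. lborel))"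
  proof -
    have "(\<lambda>y. g y * (\<Prod>k=1..?k. ennreal (ref_density y k))) \<in> borel_measurable (Pi\<^sub>M {1..?k} (\<lambda>_. borel))"
      by (intro borel_measurable_times_ennreal gm borel_measurable_prod_ennreal measurable_compose[OF rd measurable_ennreal]) auto
    then have "(\<lambda>y. g y * (\<Prod>k=1..?k. ennreal (ref_density y k))) \<in> borel_measurable (Pi\<^sub>M (insert ?k {1..n}) (\<lambda>_. lborel))"
      unfolding ins[symmetric] by (simp cong: measurable_cong_sets add: sets_PiM_lborel)
    from P.product_nn_integral_insert[OF _ _ this] show ?thesis
      unfolding ins[symmetric] by simp
  qed
  finally show ?case .
qed

text \<open>The factor with index \<open>k\<close> depends on no later coordinate, so the last
  coordinate can be integrated out first: the reference law is built from causal conditional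
  densities.\<close>

lemma nn_integral_ref_density_prod:
  "(\<integral>\<^sup>+ y. (\<Prod>k=1..n. ennreal (ref_density y k)) \<partial>Pi\<^sub>M {1..n} (\<lambda>_. lborel)) \<le> 1"
proof (induction n)
  case 0
  interpret product_sigma_finite "\<lambda>_::nat. lborel :: real measure" ..
  show ?case by (simp add: PiM_empty)
next
  case (Suc n)
  interpret P: product_sigma_finite "\<lambda>_::nat. lborel :: real measure" ..
  let ?k = "Suc n"
  have ins: "{1..?k} = insert ?k {1..n}" by auto
  have rd: "(\<lambda>y. ref_density y k) \<in> borel_measurable (Pi\<^sub>M {1..m} (\<lambda>_. borel))"
    if "k \<in> {1..m}" for k m
    using that by (intro measurable_ref_density measurable_component_singleton) auto
  have pm: "(\<lambda>y. \<Prod>k=1..m. ennreal (ref_density y k)) \<in> borel_measurable (Pi\<^sub>M {1..m} (\<lambda>_. lborel))" for m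
    using rd by (simp cong: measurable_cong_sets add: sets_PiM_lborel)
  have "(\<integral>\<^sup>+ y. (\<Prod>k=1..?k. ennreal (ref_density y k)) \<partial>Pi\<^sub>M {1..?k} (\<lambda>_. lborel))
      = (\<integral>\<^sup>+ y. (\<integral>\<^sup>+ t. (\<Prod>k=1..?k. ennreal (ref_density (y(?k := t)) k)) \<partial>lborel) \<partial>Pi\<^sub>M {1..n} (\<lambda>_. lborel))"
    using P.product_nn_integral_insert[OF _ _ pm[of ?k, unfolded ins]] unfolding ins[symmetric] by simp
  also have "\<dots> \<le> (\<integral>\<^sup>+ y. (\<Prod>k=1..n. ennreal (ref_density y k)) \<partial>Pi\<^sub>M {1..n} (\<lambda>_. lborel))"
  proof (intro nn_integral_mono)
    fix y :: "nat \<Rightarrow> real"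
    have "ref_density (y(?k := t)) k = ref_density y k" if "k \<in> {1..n}" for k t
      using that by (intro ref_density_cong) auto
    then have eq: "(\<Prod>k=1..n. ennreal (ref_density (y(?k := t)) k)) = (\<Prod>k=1..n. ennreal (ref_density y k))" for t
      by (intro prod.cong) auto
    have m: "(\<lambda>t. ref_density (y(?k := t)) ?k) \<in> borel_measurable borel"
      by (intro measurable_ref_density) auto
    have "(\<integral>\<^sup>+ t. (\<Prod>k=1..?k. ennreal (ref_density (y(?k := t)) k)) \<partial>lborel)
        = (\<integral>\<^sup>+ t. (\<Prod>k=1..n. ennreal (ref_density y k)) * ennreal (ref_density (y(?k := t)) ?k) \<partial>lborel)"
      using eq by simp
    also have "\<dots> = (\<Prod>k=1..n. ennreal (ref_density y k)) * (\<integral>\<^sup>+ t. ennreal (ref_density (y(?k := t)) ?k) \<partial>lborel)"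
      using m by (intro nn_integral_cmult) simp
    also have "\<dots> \<le> (\<Prod>k=1..n. ennreal (ref_density y k)) * 1"
      by (intro mult_left_mono nn_integral_ref_density) auto
    finally show "(\<integral>\<^sup>+ t. (\<Prod>k=1..?k. ennreal (ref_density (y(?k := t)) k)) \<partial>lborel)
        \<le> (\<Prod>k=1..n. ennreal (ref_density y k))" by simp
  qed
  also have "\<dots> \<le> 1" by (rule Suc.IH)
  finally show ?case .
qed

text \<open>4 is the fixed point of m = m / 2 + 1 + 1, where the second 1 is the noise
  variance.\<close>

lemma nn_integral_noise_factor:
  "1 \<le> k \<Longrightarrow> (\<integral>\<^sup>+ \<omega>. ennreal (noise_factor (noise \<omega>) k) \<partial>\<Omega>) \<le> 4"
proof (induction k rule: period_induct)
  case (init k)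
  then show ?case by (simp add: noise_factor_init emeasure_space_1)
next
  case (add k)
  have [measurable]: "(\<lambda>\<omega>. noise_factor (noise \<omega>) k) \<in> borel_measurable \<Omega>"
    using add by (intro measurable_noise_factor) auto
  have "(\<integral>\<^sup>+ \<omega>. ennreal (noise_factor (noise \<omega>) (k + L)) \<partial>\<Omega>)
      = (\<integral>\<^sup>+ \<omega>. ennreal (1 / 2) * ennreal (noise_factor (noise \<omega>) k) + (1 + ennreal ((U (int k) \<omega>)\<^sup>2)) \<partial>\<Omega>)"
  proof (intro nn_integral_cong)
    fix \<omega>
    have "0 \<le> noise_factor (noise \<omega>) k" using noise_factor_ge_1[OF add(1), of "noise \<omega>"] by simp
    then show "ennreal (noise_factor (noise \<omega>) (k + L))
        = ennreal (1 / 2) * ennreal (noise_factor (noise \<omega>) k) + (1 + ennreal ((U (int k) \<omega>)\<^sup>2))"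
      unfolding noise_factor_add[OF add(1)] noise_def[of \<omega> k]
      by (subst ennreal_mult[symmetric], simp, simp, subst ennreal_1[symmetric],
          subst ennreal_plus[symmetric], simp, simp, subst ennreal_plus[symmetric]) (auto simp: add_ac)
  qed
  also have "\<dots> = ennreal (1 / 2) * (\<integral>\<^sup>+ \<omega>. ennreal (noise_factor (noise \<omega>) k) \<partial>\<Omega>) + (1 + 1)"
    by (simp add: nn_integral_add nn_integral_cmult nn_integral_U_sq emeasure_space_1)
  also have "\<dots> \<le> ennreal (1 / 2) * ennreal 4 + (1 + 1)"
    using add by (intro add_mono mult_left_mono) auto
  also have "\<dots> = 4"
    by (subst ennreal_mult[symmetric]) auto
  finally show ?case .
qed

end

section \<open>The converse\<close>

context noise_process
begin

lemma prob_space_msg_noise: "finite W \<Longrightarrow> W \<noteq> {} \<Longrightarrow> prob_space (msg_noise W \<Omega>)"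
  by (intro prob_space_pair prob_space_uniform_count_measure) (auto intro: prob_space_axioms)

lemma space_msg_noise: "space (msg_noise W \<Omega>) = W \<times> space \<Omega>"
  by (simp add: space_pair_measure space_uniform_count_measure)

text \<open>Since \<open>W\<close> is finite, joint measurability can be checked message by message,
  whatever the dependence on the message.\<close>

lemma measurable_msg_noise:
  assumes "finite W" "\<And>m. m \<in> W \<Longrightarrow> (\<lambda>\<omega>. f (m, \<omega>)) \<in> \<Omega> \<rightarrow>\<^sub>M K"
  shows "f \<in> msg_noise W \<Omega> \<rightarrow>\<^sub>M K"
proof -
  have "f \<in> count_space W \<Otimes>\<^sub>M \<Omega> \<rightarrow>\<^sub>M K"
    using assms by (intro measurable_pair_measure_countable1) (auto intro: countable_finite)
  moreover have "sets (count_space W \<Otimes>\<^sub>M \<Omega>) = sets (msg_noise W \<Omega>)"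
    by (intro sets_pair_measure_cong) (auto simp: sets_uniform_count_measure)
  ultimately show ?thesis using measurable_cong_sets by blast
qed

lemma nn_integral_msg_noise:
  assumes "finite W" "W \<noteq> {}" and [measurable]: "F \<in> borel_measurable (msg_noise W \<Omega>)"
  shows "(\<integral>\<^sup>+ p. F p \<partial>msg_noise W \<Omega>) = (\<Sum>m\<in>W. \<integral>\<^sup>+ \<omega>. F (m, \<omega>) \<partial>\<Omega>) * ennreal (1 / card W)"
proof -
  have "(\<integral>\<^sup>+ p. F p \<partial>msg_noise W \<Omega>) = (\<integral>\<^sup>+ m. (\<integral>\<^sup>+ \<omega>. F (m, \<omega>) \<partial>\<Omega>) \<partial>uniform_count_measure W)"
    by (rule nn_integral_fst[symmetric]) measurable
  also have "\<dots> = (\<Sum>m\<in>W. (\<integral>\<^sup>+ \<omega>. F (m, \<omega>) \<partial>\<Omega>) * ennreal (1 / card W))"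
    unfolding uniform_count_measure_def using assms
    by (subst nn_integral_point_measure_finite) (auto simp: mult.commute)
  finally show ?thesis by (simp add: sum_distrib_right)
qed

end

context persistent_channel
begin

text \<open>A bound on the mean information density, apart from the power term: each 4 is the bound
  on the mean of \<open>noise_factor\<close>, and the summand with \<open>real L\<close> collects
  the \<open>L\<close> boundary terms of the telescoping.\<close>

definition excess :: "nat \<Rightarrow> real" where
  "excess n = real n * H + real n * ln (2 * pi / c) + 4 * real n + real L * (4 + ln (real n) + 1 / real n)"

lemma ln_const_nonneg: "0 \<le> ln (2 * pi / c)"
proof -
  have "2 * 2 / 1 \<le> 2 * pi / c" using c pi_ge_two by (intro frac_le mult_left_mono) auto
  then show ?thesis by simp
qed

lemma excess_nonneg: "1 \<le> n \<Longrightarrow> 0 \<le> excess n"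
  using ln_const_nonneg H_nonneg by (auto simp: excess_def)

text \<open>The converse for a single message with decoding region \<open>B\<close>. Either the
  information density exceeds n T, which Markov's inequality makes improbable, or the true law is at
  most exp (n T) times the reference law, which bounds the probability of \<open>B\<close> through
  \<open>change_of_measure\<close>.\<close>

lemma prob_in_region_le:
  assumes n: "1 \<le> n" and T: "0 < T"
    and \<phi>: "\<And>k. k \<in> {1..n} \<Longrightarrow> \<phi> k \<in> borel_measurable (Pi\<^sub>M {1..<k} (\<lambda>_. borel))"
    and B [measurable]: "B \<in> sets (Pi\<^sub>M {1..n} (\<lambda>_. borel))"
  shows "(\<integral>\<^sup>+ \<omega>. indicator B (\<lambda>i\<in>{1..n}. fb_output \<sigma> \<alpha> \<phi> (noise \<omega>) i) \<partial>\<Omega>)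
    \<le> ennreal (1 / (real n * T)) * (ennreal (excess n) + ennreal (real L * A / (\<sigma>\<^sup>2 * real n))
        * (\<Sum>k=1..n. \<integral>\<^sup>+ \<omega>. ennreal ((fb_input \<sigma> \<alpha> \<phi> (noise \<omega>) k)\<^sup>2) \<partial>\<Omega>))
      + ennreal (exp (real n * T)) * (\<integral>\<^sup>+ y. indicator B y * (\<Prod>k=1..n. ennreal (ref_density y k)) \<partial>Pi\<^sub>M {1..n} (\<lambda>_. lborel))"
proof -
  let ?x = "\<lambda>\<omega>. fb_input \<sigma> \<alpha> \<phi> (noise \<omega>)" and ?y = "\<lambda>\<omega>. fb_output \<sigma> \<alpha> \<phi> (noise \<omega>)"
  let ?Y = "\<lambda>\<omega>. \<lambda>i\<in>{1..n}. ?y \<omega> i"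
  let ?N = "\<lambda>\<omega>. noise_factor (noise \<omega>)"
  have xm [measurable]: "(\<lambda>\<omega>. ?x \<omega> k) \<in> borel_measurable \<Omega>" if "k \<in> {1..n}" for k
    using that by (intro measurable_fb_input[OF \<phi>]) auto
  have Nm [measurable]: "(\<lambda>\<omega>. ?N \<omega> k) \<in> borel_measurable \<Omega>" if "1 \<le> k" for k
    using that by (intro measurable_noise_factor) auto
  have ym: "(\<lambda>\<omega>. ?y \<omega> k) \<in> borel_measurable \<Omega>" if "k \<in> {1..n}" for k
    using that by (intro measurable_fb_output[OF \<phi>]) auto
  have Ym [measurable]: "?Y \<in> \<Omega> \<rightarrow>\<^sub>M Pi\<^sub>M {1..n} (\<lambda>_. borel)"
    using ym by (intro measurable_restrict) auto
  have rm [measurable]: "ratio \<phi> k \<in> borel_measurable \<Omega>" if "k \<in> {1..n}" for k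
  proof -
    have [measurable]: "(\<lambda>\<omega>. ref_density (?y \<omega>) k) \<in> borel_measurable \<Omega>"
      using that ym by (intro measurable_ref_density) auto
    have [measurable]: "(\<lambda>\<omega>. heat \<sigma> \<alpha> (?x \<omega>) k) \<in> borel_measurable \<Omega>"
      using that by (intro measurable_fb_heat[OF \<phi>]) auto
    show ?thesis unfolding ratio_def by measurable
  qed
  define b where "b = real L * A / (\<sigma>\<^sup>2 * real n)"
  have b0: "0 \<le> b" using A by (auto simp: b_def)
  define r1 where "r1 = real n * ln (2 * pi / c)"
  define r2 where "r2 = real L * (ln (real n) + 1 / real n)"
  have r12: "0 \<le> r1" "0 \<le> r2" using ln_const_nonneg n by (auto simp: r1_def r2_def)
  \<comment> \<open>On \<open>ennreal\<close> each ln (D k) is replaced by its positive part, the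
    part that \<open>d_ln\<close> controls; inputs of infinite energy are covered as well.\<close>
  define Bd where "Bd \<omega> = (\<Sum>k=1..n. ennreal (ln (D k \<omega>))) + ennreal r1 + (\<Sum>k=1..n. ennreal (?N \<omega> k))
    + (\<Sum>j=1..L. ennreal (?N \<omega> (n + j))) + ennreal r2 + ennreal b * (\<Sum>k=1..n. ennreal ((?x \<omega> k)\<^sup>2))" for \<omega>
  have [measurable]: "Bd \<in> borel_measurable \<Omega>"
    unfolding Bd_def using xm Nm by measurable
  have "AE \<omega> in \<Omega>. \<forall>k\<in>{1..n}. 0 < D k \<omega>"
    using d_pos by (subst AE_ball_countable) (auto simp: D_def)
  then have "AE \<omega> in \<Omega>. indicator B (?Y \<omega>) \<le> ennreal (1 / (real n * T)) * Bd \<omega>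
      + ennreal (exp (real n * T)) * (indicator B (?Y \<omega>) * (\<Prod>k=1..n. ennreal (ratio \<phi> k \<omega>)))"
  proof eventually_elim
    case (elim \<omega>)
    have r: "0 < ratio \<phi> k \<omega>" if "k \<in> {1..n}" for k
      using that elim ref_density_pos[of k "?y \<omega>"] heat_pos[of "?x \<omega>" k] by (auto simp: ratio_def)
    have pr: "(\<Prod>k=1..n. ennreal (ratio \<phi> k \<omega>)) = ennreal (\<Prod>k=1..n. ratio \<phi> k \<omega>)"
      using r by (intro prod_ennreal) (auto intro: less_imp_le)
    have pos: "0 < (\<Prod>k=1..n. ratio \<phi> k \<omega>)" using r by (intro prod_pos) auto
    show ?case
      \<comment> \<open>If the likelihood ratio is large, the second summand is at least 1; otherwise Markov applies to \<open>Bd\<close>.\<close>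
    proof (cases "exp (- (real n * T)) \<le> (\<Prod>k=1..n. ratio \<phi> k \<omega>)")
      case True
      have "1 = exp (real n * T) * exp (- (real n * T))" by (simp add: exp_minus)
      also have "\<dots> \<le> exp (real n * T) * (\<Prod>k=1..n. ratio \<phi> k \<omega>)" using True by simp
      finally have "1 \<le> ennreal (exp (real n * T) * (\<Prod>k=1..n. ratio \<phi> k \<omega>))" by simp
      then have "1 \<le> ennreal (exp (real n * T)) * (\<Prod>k=1..n. ennreal (ratio \<phi> k \<omega>))"
        unfolding pr by (simp add: ennreal_mult')
      then show ?thesis by (auto simp: indicator_def intro: add_increasing)
    next
      case False
      let ?z = "1 + A / \<sigma>\<^sup>2 * (\<Sum>l=1..n. (?x \<omega> l)\<^sup>2)"
      have N0: "0 \<le> ?N \<omega> k" if "1 \<le> k" for k using noise_factor_ge_1[OF that, of "noise \<omega>"] by simp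
      have "ln (\<Prod>k=1..n. ratio \<phi> k \<omega>) < - (real n * T)"
        using False pos ln_less_cancel_iff[of "\<Prod>k=1..n. ratio \<phi> k \<omega>" "exp (- (real n * T))"] by simp
      then have "real n * T < - ln (\<Prod>k=1..n. ratio \<phi> k \<omega>)" by simp
      also have "\<dots> \<le> (\<Sum>k=1..n. ln (D k \<omega>)) + real n * ln (2 * pi / c) + (\<Sum>k=1..n. ?N \<omega> k)
          + (\<Sum>j=1..L. ?N \<omega> (n + j) + ln (real n) + ?z / real n)"
        unfolding ratio_def using elim n by (intro information_density_le) auto
      also have "(\<Sum>j=1..L. ?N \<omega> (n + j) + ln (real n) + ?z / real n)
          = (\<Sum>j=1..L. ?N \<omega> (n + j)) + r2 + b * (\<Sum>k=1..n. (?x \<omega> k)\<^sup>2)"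
        by (simp add: sum.distrib r2_def b_def add_divide_distrib distrib_left mult.assoc)
      also have "(\<Sum>k=1..n. ln (D k \<omega>)) \<le> (\<Sum>k=1..n. max 0 (ln (D k \<omega>)))"
        by (intro sum_mono) auto
      finally have "real n * T \<le> (\<Sum>k=1..n. max 0 (ln (D k \<omega>))) + r1 + (\<Sum>k=1..n. ?N \<omega> k)
          + (\<Sum>j=1..L. ?N \<omega> (n + j)) + r2 + b * (\<Sum>k=1..n. (?x \<omega> k)\<^sup>2)"
        by (simp add: r1_def)
      then have "ennreal (real n * T) \<le> ennreal ((\<Sum>k=1..n. max 0 (ln (D k \<omega>))) + r1 + (\<Sum>k=1..n. ?N \<omega> k)
          + (\<Sum>j=1..L. ?N \<omega> (n + j)) + r2 + b * (\<Sum>k=1..n. (?x \<omega> k)\<^sup>2))"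
        by (rule ennreal_leI)
      also have "\<dots> = Bd \<omega>"
      proof -
        have [simp]: "ennreal (max 0 t) = ennreal t" for t by (simp add: max_def ennreal_neg)
        have 1: "0 \<le> (\<Sum>k=1..n. max 0 (ln (D k \<omega>)))" by (intro sum_nonneg) auto
        have 2: "0 \<le> (\<Sum>k=1..n. ?N \<omega> k)" using N0 by (intro sum_nonneg) auto
        have 3: "0 \<le> (\<Sum>j=1..L. ?N \<omega> (n + j))" using N0 by (intro sum_nonneg) auto
        have 4: "0 \<le> b * (\<Sum>k=1..n. (?x \<omega> k)\<^sup>2)" using b0 by (intro mult_nonneg_nonneg sum_nonneg) auto
        have "ennreal (\<Sum>k=1..n. max 0 (ln (D k \<omega>))) = (\<Sum>k=1..n. ennreal (ln (D k \<omega>)))"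
          by (subst sum_ennreal[symmetric]) auto
        moreover have "ennreal (\<Sum>k=1..n. ?N \<omega> k) = (\<Sum>k=1..n. ennreal (?N \<omega> k))"
          using N0 by (subst sum_ennreal[symmetric]) auto
        moreover have "ennreal (\<Sum>j=1..L. ?N \<omega> (n + j)) = (\<Sum>j=1..L. ennreal (?N \<omega> (n + j)))"
          using N0 by (subst sum_ennreal[symmetric]) auto
        moreover have "ennreal (b * (\<Sum>k=1..n. (?x \<omega> k)\<^sup>2)) = ennreal b * (\<Sum>k=1..n. ennreal ((?x \<omega> k)\<^sup>2))"
          using b0 by (subst ennreal_mult') (auto simp: sum_ennreal)
        ultimately show ?thesis
          unfolding Bd_def using 1 2 3 4 r12 by (simp add: ennreal_plus)
      qed
      finally have "ennreal (1 / (real n * T)) * ennreal (real n * T) \<le> ennreal (1 / (real n * T)) * Bd \<omega>"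
        by (rule mult_left_mono) simp
      moreover have "ennreal (1 / (real n * T)) * ennreal (real n * T) = 1"
        using n T by (subst ennreal_mult'[symmetric]) auto
      ultimately have "1 \<le> ennreal (1 / (real n * T)) * Bd \<omega>" by simp
      then show ?thesis by (auto simp: indicator_def intro: add_increasing2)
    qed
  qed
  then have "(\<integral>\<^sup>+ \<omega>. indicator B (?Y \<omega>) \<partial>\<Omega>) \<le> (\<integral>\<^sup>+ \<omega>. ennreal (1 / (real n * T)) * Bd \<omega>
      + ennreal (exp (real n * T)) * (indicator B (?Y \<omega>) * (\<Prod>k=1..n. ennreal (ratio \<phi> k \<omega>))) \<partial>\<Omega>)"
    by (rule nn_integral_mono_AE)
  also have "\<dots> = ennreal (1 / (real n * T)) * (\<integral>\<^sup>+ \<omega>. Bd \<omega> \<partial>\<Omega>)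
      + ennreal (exp (real n * T)) * (\<integral>\<^sup>+ \<omega>. indicator B (?Y \<omega>) * (\<Prod>k=1..n. ennreal (ratio \<phi> k \<omega>)) \<partial>\<Omega>)"
  proof -
    have [measurable]: "(\<lambda>\<omega>. \<Prod>k=1..n. ennreal (ratio \<phi> k \<omega>)) \<in> borel_measurable \<Omega>"
      using rm by (intro borel_measurable_prod_ennreal) auto
    have [measurable]: "(\<lambda>\<omega>. indicator B (?Y \<omega>) :: ennreal) \<in> borel_measurable \<Omega>"
      by (rule measurable_compose[OF Ym]) measurable
    define h where "h \<omega> = indicator B (?Y \<omega>) * (\<Prod>k=1..n. ennreal (ratio \<phi> k \<omega>))" for \<omega>
    have [measurable]: "h \<in> borel_measurable \<Omega>" unfolding h_def by measurable
    show ?thesis unfolding h_def[symmetric] by (simp add: nn_integral_add nn_integral_cmult)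
  qed
  also have "\<dots> \<le> ennreal (1 / (real n * T)) * (ennreal (excess n) + ennreal b * (\<Sum>k=1..n. \<integral>\<^sup>+ \<omega>. ennreal ((?x \<omega> k)\<^sup>2) \<partial>\<Omega>))
      + ennreal (exp (real n * T)) * (\<integral>\<^sup>+ y. indicator B y * (\<Prod>k=1..n. ennreal (ref_density y k)) \<partial>Pi\<^sub>M {1..n} (\<lambda>_. lborel))"
  proof (intro add_mono mult_left_mono change_of_measure \<phi>)
    have s1: "(\<integral>\<^sup>+ \<omega>. (\<Sum>k=1..n. ennreal (ln (D k \<omega>))) \<partial>\<Omega>) = of_nat n * ennreal H"
      using d_ln by (subst nn_integral_sum) (auto simp: D_def)
    have "(\<integral>\<^sup>+ \<omega>. (\<Sum>k=1..n. ennreal (?N \<omega> k)) \<partial>\<Omega>) = (\<Sum>k=1..n. \<integral>\<^sup>+ \<omega>. ennreal (?N \<omega> k) \<partial>\<Omega>)"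
      using Nm by (intro nn_integral_sum) auto
    also have "\<dots> \<le> (\<Sum>k=1..n. 4)" by (intro sum_mono nn_integral_noise_factor) auto
    finally have s2: "(\<integral>\<^sup>+ \<omega>. (\<Sum>k=1..n. ennreal (?N \<omega> k)) \<partial>\<Omega>) \<le> of_nat n * 4" by simp
    have "(\<integral>\<^sup>+ \<omega>. (\<Sum>j=1..L. ennreal (?N \<omega> (n + j))) \<partial>\<Omega>) = (\<Sum>j=1..L. \<integral>\<^sup>+ \<omega>. ennreal (?N \<omega> (n + j)) \<partial>\<Omega>)"
      using Nm by (intro nn_integral_sum) auto
    also have "\<dots> \<le> (\<Sum>j=1..L. 4)" by (intro sum_mono nn_integral_noise_factor) auto
    finally have s3: "(\<integral>\<^sup>+ \<omega>. (\<Sum>j=1..L. ennreal (?N \<omega> (n + j))) \<partial>\<Omega>) \<le> of_nat L * 4" by simp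
    have s4: "(\<integral>\<^sup>+ \<omega>. ennreal b * (\<Sum>k=1..n. ennreal ((?x \<omega> k)\<^sup>2)) \<partial>\<Omega>)
        = ennreal b * (\<Sum>k=1..n. \<integral>\<^sup>+ \<omega>. ennreal ((?x \<omega> k)\<^sup>2) \<partial>\<Omega>)"
      using xm by (subst nn_integral_cmult, measurable, subst nn_integral_sum) auto
    have [measurable]: "(\<lambda>\<omega>. \<Sum>k=1..n. ennreal (?N \<omega> k)) \<in> borel_measurable \<Omega>"
      "(\<lambda>\<omega>. \<Sum>j=1..L. ennreal (?N \<omega> (n + j))) \<in> borel_measurable \<Omega>"
      "(\<lambda>\<omega>. \<Sum>k=1..n. ennreal ((?x \<omega> k)\<^sup>2)) \<in> borel_measurable \<Omega>"
      using xm Nm by (auto intro!: borel_measurable_sum)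
    have "(\<integral>\<^sup>+ \<omega>. Bd \<omega> \<partial>\<Omega>) = (\<integral>\<^sup>+ \<omega>. (\<Sum>k=1..n. ennreal (ln (D k \<omega>))) \<partial>\<Omega>) + ennreal r1
        + (\<integral>\<^sup>+ \<omega>. (\<Sum>k=1..n. ennreal (?N \<omega> k)) \<partial>\<Omega>) + (\<integral>\<^sup>+ \<omega>. (\<Sum>j=1..L. ennreal (?N \<omega> (n + j))) \<partial>\<Omega>)
        + ennreal r2 + (\<integral>\<^sup>+ \<omega>. ennreal b * (\<Sum>k=1..n. ennreal ((?x \<omega> k)\<^sup>2)) \<partial>\<Omega>)"
      unfolding Bd_def by (simp add: nn_integral_add emeasure_space_1)
    also have "\<dots> \<le> of_nat n * ennreal H + ennreal r1 + of_nat n * 4 + of_nat L * 4 + ennreal r2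
        + ennreal b * (\<Sum>k=1..n. \<integral>\<^sup>+ \<omega>. ennreal ((?x \<omega> k)\<^sup>2) \<partial>\<Omega>)"
      unfolding s1 s4 by (intro add_mono s2 s3 order.refl)
    also have "of_nat n * ennreal H + ennreal r1 + of_nat n * 4 + of_nat L * 4 + ennreal r2 = ennreal (excess n)"
    proof -
      have "of_nat n * ennreal H = ennreal (real n * H)" "of_nat n * 4 = ennreal (real n * 4)"
        "of_nat L * 4 = ennreal (real L * 4)"
        using H_nonneg by (auto simp: ennreal_mult' ennreal_of_nat_eq_real_of_nat)
      moreover have "excess n = real n * H + r1 + real n * 4 + real L * 4 + r2"
        by (simp add: excess_def r1_def r2_def algebra_simps)
      ultimately show ?thesis
        using r12 H_nonneg by (simp add: ennreal_plus)
    qed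
    finally show "(\<integral>\<^sup>+ \<omega>. Bd \<omega> \<partial>\<Omega>) \<le> ennreal (excess n) + ennreal b * (\<Sum>k=1..n. \<integral>\<^sup>+ \<omega>. ennreal ((?x \<omega> k)\<^sup>2) \<partial>\<Omega>)" .
  qed (use B in auto)
  finally show ?thesis unfolding b_def .
qed

text \<open>Averaging \<open>prob_in_region_le\<close> over the messages: the decoding regions are
  disjoint and the reference law does not depend on the message, so their reference probabilities
  sum to at most 1 and leave the factor 1 / |W|. The energies average to at most n P.\<close>

lemma prob_correct_le:
  assumes n: "1 \<le> n" and T: "0 < T" and P: "0 \<le> P" and W: "finite W" "W \<noteq> {}"
    and \<phi>: "\<And>m k. m \<in> W \<Longrightarrow> k \<in> {1..n} \<Longrightarrow> \<phi> m k \<in> borel_measurable (Pi\<^sub>M {1..<k} (\<lambda>_. borel))"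
    and \<psi> [measurable]: "\<psi> \<in> Pi\<^sub>M {1..n} (\<lambda>_. borel) \<rightarrow>\<^sub>M count_space W"
    and power: "power_constraint \<Omega> P n W (\<lambda>k p. fb_input \<sigma> \<alpha> (\<phi> (fst p)) (\<lambda>i. U (int i) (snd p)) k)"
  shows "1 - error_prob \<Omega> U \<sigma> \<alpha> n W (\<lambda>k p. fb_input \<sigma> \<alpha> (\<phi> (fst p)) (\<lambda>i. U (int i) (snd p)) k) \<psi>
    \<le> (excess n + real L * A * P / \<sigma>\<^sup>2) / (real n * T) + exp (real n * T) / card W"
proof -
  interpret M: prob_space "msg_noise W \<Omega>" by (rule prob_space_msg_noise[OF W])
  let ?M = "msg_noise W \<Omega>"
  let ?x = "\<lambda>m \<omega>. fb_input \<sigma> \<alpha> (\<phi> m) (noise \<omega>)"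
  let ?Y = "\<lambda>m \<omega>. \<lambda>i\<in>{1..n}. fb_output \<sigma> \<alpha> (\<phi> m) (noise \<omega>) i"
  have nz: "(\<lambda>i. U (int i) \<omega>) = noise \<omega>" for \<omega> by (rule ext) (simp add: noise_def)
  have xm: "(\<lambda>\<omega>. ?x m \<omega> k) \<in> borel_measurable \<Omega>" if "m \<in> W" "k \<in> {1..n}" for m k
    using that by (intro measurable_fb_input[OF \<phi>]) auto
  have ym: "(\<lambda>\<omega>. ?Y m \<omega>) \<in> \<Omega> \<rightarrow>\<^sub>M Pi\<^sub>M {1..n} (\<lambda>_. borel)" if "m \<in> W" for m
    using that by (intro measurable_restrict measurable_fb_output[OF \<phi>]) auto
  have xM: "(\<lambda>p. ?x (fst p) (snd p) k) \<in> borel_measurable ?M" if "k \<in> {1..n}" for k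
    using that xm by (intro measurable_msg_noise W) auto
  have YM: "(\<lambda>p. ?Y (fst p) (snd p)) \<in> ?M \<rightarrow>\<^sub>M Pi\<^sub>M {1..n} (\<lambda>_. borel)"
    using ym by (intro measurable_msg_noise W) auto
  have psiY [measurable]: "(\<lambda>p. \<psi> (?Y (fst p) (snd p))) \<in> ?M \<rightarrow>\<^sub>M count_space W"
    by (rule measurable_compose[OF YM \<psi>])
  have fstM: "fst \<in> ?M \<rightarrow>\<^sub>M count_space W"
    using W by (intro measurable_msg_noise) auto
  define E where "E = {p \<in> space ?M. \<psi> (?Y (fst p) (snd p)) \<noteq> fst p}"
  define G where "G = {p \<in> space ?M. \<psi> (?Y (fst p) (snd p)) = fst p}"
  have "G = (\<Union>m\<in>W. ((\<lambda>p. \<psi> (?Y (fst p) (snd p))) -` {m} \<inter> space ?M) \<inter> (fst -` {m} \<inter> space ?M))"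
    using measurable_space[OF fstM] by (auto simp: G_def)
  also have "\<dots> \<in> sets ?M"
    using W by (intro sets.finite_UN sets.Int measurable_sets[OF psiY] measurable_sets[OF fstM]) auto
  finally have G [measurable]: "G \<in> sets ?M" .
  have E_eq: "E = space ?M - G" by (auto simp: E_def G_def)
  have err: "error_prob \<Omega> U \<sigma> \<alpha> n W (\<lambda>k p. fb_input \<sigma> \<alpha> (\<phi> (fst p)) (\<lambda>i. U (int i) (snd p)) k) \<psi> = measure ?M E"
    by (simp add: error_prob_def E_def nz)
  have cor: "1 - measure ?M E = measure ?M G"
    unfolding E_eq using M.prob_compl[OF G] by simp
  define R where "R m = \<psi> -` {m} \<inter> space (Pi\<^sub>M {1..n} (\<lambda>_. borel :: real measure))" for m
  have Rs: "R m \<in> sets (Pi\<^sub>M {1..n} (\<lambda>_. borel))" if "m \<in> W" for m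
    unfolding R_def using that by (intro measurable_sets[OF \<psi>]) auto
  define Q where "Q m = (\<integral>\<^sup>+ y. indicator (R m) y * (\<Prod>k=1..n. ennreal (ref_density y k)) \<partial>Pi\<^sub>M {1..n} (\<lambda>_. lborel))" for m
  define S where "S m = (\<Sum>k=1..n. \<integral>\<^sup>+ \<omega>. ennreal ((?x m \<omega> k)\<^sup>2) \<partial>\<Omega>)" for m
  have rdm: "(\<lambda>y. \<Prod>k=1..n. ennreal (ref_density y k)) \<in> borel_measurable (Pi\<^sub>M {1..n} (\<lambda>_. lborel))"
  proof -
    have "(\<lambda>y. ref_density y k) \<in> borel_measurable (Pi\<^sub>M {1..n} (\<lambda>_. borel))" if "k \<in> {1..n}" for k
      using that by (intro measurable_ref_density measurable_component_singleton) auto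
    then show ?thesis by (simp cong: measurable_cong_sets add: sets_PiM_lborel)
  qed
  have Qsum: "(\<Sum>m\<in>W. Q m) \<le> 1"
  proof -
    have "(\<Sum>m\<in>W. Q m) = (\<integral>\<^sup>+ y. (\<Sum>m\<in>W. indicator (R m) y * (\<Prod>k=1..n. ennreal (ref_density y k))) \<partial>Pi\<^sub>M {1..n} (\<lambda>_. lborel))"
      unfolding Q_def
    proof (rule nn_integral_sum[symmetric])
      fix m assume "m \<in> W"
      then have "R m \<in> sets (Pi\<^sub>M {1..n} (\<lambda>_. lborel))" using Rs by (simp add: sets_PiM_lborel)
      then show "(\<lambda>y. indicator (R m) y * (\<Prod>k=1..n. ennreal (ref_density y k))) \<in> borel_measurable (Pi\<^sub>M {1..n} (\<lambda>_. lborel))"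
        by (intro borel_measurable_times_ennreal borel_measurable_indicator rdm)
    qed
    also have "\<dots> \<le> (\<integral>\<^sup>+ y. (\<Prod>k=1..n. ennreal (ref_density y k)) \<partial>Pi\<^sub>M {1..n} (\<lambda>_. lborel))"
    proof (intro nn_integral_mono)
      fix y :: "nat \<Rightarrow> real"
      have "(\<Sum>m\<in>W. indicator (R m) y :: ennreal) \<le> (\<Sum>m\<in>W. if m = \<psi> y then 1 else 0)"
        by (intro sum_mono) (auto simp: R_def indicator_def)
      also have "\<dots> \<le> 1" using W by (simp add: sum.delta)
      finally have "(\<Sum>m\<in>W. indicator (R m) y) * (\<Prod>k=1..n. ennreal (ref_density y k)) \<le> 1 * (\<Prod>k=1..n. ennreal (ref_density y k))"
        by (rule mult_right_mono) simp
      then show "(\<Sum>m\<in>W. indicator (R m) y * (\<Prod>k=1..n. ennreal (ref_density y k))) \<le> (\<Prod>k=1..n. ennreal (ref_density y k))"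
        by (simp add: sum_distrib_right)
    qed
    also have "\<dots> \<le> 1" by (rule nn_integral_ref_density_prod)
    finally show ?thesis .
  qed
  have Ssum: "(\<Sum>m\<in>W. S m) * ennreal (1 / card W) \<le> ennreal (real n * P)"
  proof -
    have "(\<Sum>m\<in>W. S m) * ennreal (1 / card W)
        = (\<Sum>k=1..n. (\<Sum>m\<in>W. \<integral>\<^sup>+ \<omega>. ennreal ((?x m \<omega> k)\<^sup>2) \<partial>\<Omega>) * ennreal (1 / card W))"
      unfolding S_def by (subst sum.swap) (simp add: sum_distrib_right)
    also have "\<dots> = (\<Sum>k=1..n. \<integral>\<^sup>+ p. ennreal ((?x (fst p) (snd p) k)\<^sup>2) \<partial>?M)"
    proof (intro sum.cong refl)
      fix k assume "k \<in> {1..n}"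
      then have "(\<lambda>p. ennreal ((?x (fst p) (snd p) k)\<^sup>2)) \<in> borel_measurable ?M"
        using xM by measurable
      from nn_integral_msg_noise[OF W this]
      show "(\<Sum>m\<in>W. \<integral>\<^sup>+ \<omega>. ennreal ((?x m \<omega> k)\<^sup>2) \<partial>\<Omega>) * ennreal (1 / card W)
        = (\<integral>\<^sup>+ p. ennreal ((?x (fst p) (snd p) k)\<^sup>2) \<partial>?M)" by simp
    qed
    also have "\<dots> = (\<Sum>k=1..n. \<integral>\<^sup>+ p. ennreal ((?x (fst p) (snd p) k)\<^sup>2) \<partial>?M) / of_nat n * of_nat n"
    proof -
      have "of_nat n / of_nat n = (1 :: ennreal)"
        using n by (intro ennreal_divide_self) (auto simp: of_nat_less_top)
      then show ?thesis by (simp add: ennreal_divide_times)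
    qed
    also have "\<dots> \<le> ennreal P * of_nat n"
      using power by (intro mult_right_mono) (auto simp: power_constraint_def nz)
    also have "\<dots> = ennreal (real n * P)"
      using P by (simp add: ennreal_mult' ennreal_of_nat_eq_real_of_nat mult.commute)
    finally show ?thesis .
  qed
  let ?a = "ennreal (1 / (real n * T))" and ?e = "ennreal (excess n)" and ?b = "ennreal (real L * A / (\<sigma>\<^sup>2 * real n))"
    and ?w = "ennreal (1 / card W)" and ?t = "ennreal (exp (real n * T))"
  have "emeasure ?M G = (\<integral>\<^sup>+ p. indicator G p \<partial>?M)" by simp
  also have "\<dots> = (\<Sum>m\<in>W. \<integral>\<^sup>+ \<omega>. indicator G (m, \<omega>) \<partial>\<Omega>) * ?w"
    by (rule nn_integral_msg_noise[OF W]) measurable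
  also have "\<dots> \<le> (\<Sum>m\<in>W. ?a * (?e + ?b * S m) + ?t * Q m) * ?w"
  proof (intro mult_right_mono sum_mono)
    fix m assume m: "m \<in> W"
    have "(\<integral>\<^sup>+ \<omega>. indicator G (m, \<omega>) \<partial>\<Omega>) \<le> (\<integral>\<^sup>+ \<omega>. indicator (R m) (?Y m \<omega>) \<partial>\<Omega>)"
      by (intro nn_integral_mono) (auto simp: G_def R_def indicator_def space_PiM)
    also have "\<dots> \<le> ?a * (?e + ?b * S m) + ?t * Q m"
      unfolding S_def Q_def using m by (intro prob_in_region_le n T \<phi> Rs)
    finally show "(\<integral>\<^sup>+ \<omega>. indicator G (m, \<omega>) \<partial>\<Omega>) \<le> ?a * (?e + ?b * S m) + ?t * Q m" .
  qed simp
  also have "\<dots> = ?a * (?e * (of_nat (card W) * ?w) + ?b * ((\<Sum>m\<in>W. S m) * ?w)) + ?t * (\<Sum>m\<in>W. Q m) * ?w"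
  proof -
    have "(\<Sum>m\<in>W. a * (e + b * S m) + t * Q m) * w
        = a * (e * (of_nat (card W) * w) + b * ((\<Sum>m\<in>W. S m) * w)) + t * (\<Sum>m\<in>W. Q m) * w"
      for a b e t w :: ennreal
    proof -
      have "(\<Sum>m\<in>W. a * (e + b * S m) + t * Q m)
          = a * (of_nat (card W) * e + b * (\<Sum>m\<in>W. S m)) + t * (\<Sum>m\<in>W. Q m)"
        by (simp only: sum.distrib sum_distrib_left[symmetric] sum_constant)
      then show ?thesis by (simp add: distrib_left distrib_right mult_ac)
    qed
    then show ?thesis .
  qed
  also have "\<dots> \<le> ?a * (?e * 1 + ?b * ennreal (real n * P)) + ?t * 1 * ?w"
  proof (intro add_mono mult_left_mono mult_right_mono Ssum Qsum)
    show "of_nat (card W) * ?w \<le> 1"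
      using W by (simp add: ennreal_of_nat_eq_real_of_nat ennreal_mult'[symmetric])
  qed auto
  also have "\<dots> = ennreal ((excess n + real L * A * P / \<sigma>\<^sup>2) / (real n * T) + exp (real n * T) / card W)"
  proof -
    have 1: "real L * A / (\<sigma>\<^sup>2 * real n) * (real n * P) = real L * A * P / \<sigma>\<^sup>2" using n by simp
    have 2: "0 \<le> real L * A * P / \<sigma>\<^sup>2" using A P by auto
    have "?b * ennreal (real n * P) = ennreal (real L * A * P / \<sigma>\<^sup>2)"
      using A by (subst ennreal_mult'[symmetric]) (simp_all only: 1, auto)
    moreover have "?e + ennreal (real L * A * P / \<sigma>\<^sup>2) = ennreal (excess n + real L * A * P / \<sigma>\<^sup>2)"
      using excess_nonneg[OF n] 2 by simp
    moreover have "?a * ennreal (excess n + real L * A * P / \<sigma>\<^sup>2) = ennreal ((excess n + real L * A * P / \<sigma>\<^sup>2) / (real n * T))"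
      using n T by (subst ennreal_mult'[symmetric]) auto
    moreover have "?t * 1 * ?w = ennreal (exp (real n * T) / card W)"
      by (simp add: ennreal_mult'[symmetric])
    ultimately show ?thesis
      using excess_nonneg[OF n] 2 n T by (simp add: ennreal_plus[symmetric] del: ennreal_plus)
  qed
  finally have "ennreal (measure ?M G) \<le> ennreal ((excess n + real L * A * P / \<sigma>\<^sup>2) / (real n * T) + exp (real n * T) / card W)"
    by (simp add: M.emeasure_eq_measure)
  moreover have "0 \<le> (excess n + real L * A * P / \<sigma>\<^sup>2) / (real n * T) + exp (real n * T) / card W"
    using excess_nonneg[OF n] A P T by (intro add_nonneg_nonneg divide_nonneg_nonneg) auto
  ultimately show ?thesis unfolding err cor by (simp add: ennreal_le_iff)
qed

text \<open>The mean information density per letter is asymptotically at most H + ln (2 pi / c) + 4;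
  \<open>P\<close> enters only through a constant divided by \<open>n\<close>. Twice this value as
  threshold \<open>T\<close> makes the Markov term tend to 1/2, so at rates above \<open>T\<close>
  the probability of correct decoding cannot tend to 1.\<close>

lemma achievable_fb_le:
  assumes P: "0 \<le> P" and R: "achievable_fb \<Omega> U \<sigma> \<alpha> P R"
  shows "R \<le> 2 * (H + ln (2 * pi / c) + 4)"
proof (rule ccontr)
  define T where "T = 2 * (H + ln (2 * pi / c) + 4)"
  assume "\<not> R \<le> 2 * (H + ln (2 * pi / c) + 4)"
  then have RT: "T < R" by (simp add: T_def)
  have T: "0 < T" using H_nonneg ln_const_nonneg by (simp add: T_def)
  obtain W \<phi> \<psi> where
    \<phi>: "\<And>n m k. n \<ge> 1 \<Longrightarrow> m \<in> W n \<Longrightarrow> k \<in> {1..n} \<Longrightarrow> \<phi> n m k \<in> borel_measurable (Pi\<^sub>M {1..<k} (\<lambda>_. borel))"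
    and ach: "achieves_rate \<Omega> U \<sigma> \<alpha> P W
          (\<lambda>n k p. fb_input \<sigma> \<alpha> (\<phi> n (fst p)) (\<lambda>i. U (int i) (snd p)) k) \<psi> R"
    using R unfolding achievable_fb_def by blast
  define err where "err n = error_prob \<Omega> U \<sigma> \<alpha> n (W n)
    (\<lambda>k p. fb_input \<sigma> \<alpha> (\<phi> n (fst p)) (\<lambda>i. U (int i) (snd p)) k) (\<psi> n)" for n
  have code: "finite (W n)" "W n \<noteq> {}" "\<psi> n \<in> Pi\<^sub>M {1..n} (\<lambda>_. borel) \<rightarrow>\<^sub>M count_space (W n)"
      "power_constraint \<Omega> P n (W n) (\<lambda>k p. fb_input \<sigma> \<alpha> (\<phi> n (fst p)) (\<lambda>i. U (int i) (snd p)) k)"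
    if "1 \<le> n" for n
    using ach that unfolding achieves_rate_def by auto
  have rate: "ereal R \<le> liminf (\<lambda>n. ereal (ln (real (card (W n))) / real n))"
    and err0: "err \<longlonglongrightarrow> 0"
    using ach unfolding achieves_rate_def err_def[abs_def] by auto
  \<comment> \<open>The liminf guarantees only rates strictly below \<open>R\<close>; a rate
    strictly between \<open>T\<close> and \<open>R\<close> still lets |W| outgrow exp (n T).\<close>
  define R' where "R' = (R + T) / 2"
  have R': "T < R'" "R' < R" using RT by (auto simp: R'_def)
  have "ereal R' < liminf (\<lambda>n. ereal (ln (real (card (W n))) / real n))"
    using R'(2) rate by (meson ereal_less(2) less_ereal.simps(1) less_le_trans)
  then have ev: "\<forall>\<^sub>F n in sequentially. ereal R' < ereal (ln (real (card (W n))) / real n)"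
    by (rule less_LiminfD)
  define up where "up n = (excess n + real L * A * P / \<sigma>\<^sup>2) / (real n * T) + exp (- (R' - T) * real n)" for n
  have bound: "\<forall>\<^sub>F n in sequentially. 1 - err n \<le> up n"
    using ev eventually_ge_at_top[of 1]
  proof eventually_elim
    case (elim n)
    have cW: "0 < card (W n)" using code[OF elim(2)] by (simp add: card_gt_0_iff)
    have "R' * real n < ln (real (card (W n)))" using elim by (simp add: field_simps)
    then have "exp (R' * real n) \<le> card (W n)" using cW by (subst ln_ge_iff[symmetric]) auto
    then have "exp (real n * T) / card (W n) \<le> exp (real n * T) / exp (R' * real n)"
      using cW by (intro divide_left_mono) auto
    also have "\<dots> = exp (- (R' - T) * real n)" by (simp add: exp_diff[symmetric] algebra_simps)
    finally have "exp (real n * T) / card (W n) \<le> exp (- (R' - T) * real n)" .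
    moreover have "1 - err n \<le> (excess n + real L * A * P / \<sigma>\<^sup>2) / (real n * T) + exp (real n * T) / card (W n)"
      unfolding err_def using code[OF elim(2)] \<phi>[OF elim(2)] elim(2) T P by (intro prob_correct_le)
    ultimately show ?case by (simp add: up_def)
  qed
  have "up \<longlonglongrightarrow> 1 / 2"
  proof -
    define l where "l = ln (2 * pi / c)"
    define C where "C = real L * A * P / \<sigma>\<^sup>2"
    have "(\<lambda>n. (real n * H + real n * l + 4 * real n + real L * (4 + ln (real n) + 1 / real n) + C) / (real n * T))
        \<longlonglongrightarrow> (H + l + 4) * inverse T"
      using T by real_asymp
    moreover have "(H + l + 4) * inverse T = 1 / 2" using T by (simp add: T_def l_def field_simps)
    moreover have "(\<lambda>n. exp (- (R' - T) * real n)) \<longlonglongrightarrow> 0"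
      using R' by real_asymp
    ultimately show ?thesis
      unfolding up_def[abs_def] excess_def l_def[symmetric] C_def[symmetric]
      using tendsto_add by fastforce
  qed
  moreover have "(\<lambda>n. 1 - err n) \<longlonglongrightarrow> 1 - 0" by (intro tendsto_diff err0 tendsto_const)
  ultimately have "1 - 0 \<le> (1 / 2 :: real)"
    using bound by (intro tendsto_le[OF sequentially_bot])
  then show False by simp
qed

end

lemma capacity_fb_bounded:
  assumes noise: "noise_process \<Omega> U" and \<sigma>: "0 < \<sigma>"
    and \<alpha>: "\<And>l. 1 \<le> l \<Longrightarrow> 0 \<le> \<alpha> l" "bdd_above (\<alpha> ` {1..})"
    and lim: "0 < liminf (coeff_ratio \<alpha>)"
  shows "(SUP SNR\<in>{0<..}. capacity_fb \<Omega> U \<sigma> \<alpha> SNR) < \<infinity>"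
proof -
  interpret noise_process \<Omega> U by fact
  obtain c A L where ph: "persistent_heat \<sigma> \<alpha> c A L"
    using persistent_heat_exists[of \<sigma> \<alpha>] \<sigma> \<alpha> lim by blast
  obtain d H where d: "\<And>k. d k \<in> borel_measurable (borel \<Otimes>\<^sub>M Pi\<^sub>M {..<k} (\<lambda>_. borel))" "0 \<le> H"
    "\<And>k. AE \<omega> in \<Omega>. 0 < d k (U k \<omega>, past k \<omega>)"
    "\<And>k. (\<integral>\<^sup>+ \<omega>. ennreal (ln (d k (U k \<omega>, past k \<omega>))) \<partial>\<Omega>) = ennreal H"
    "\<And>k F. F \<in> borel_measurable (borel \<Otimes>\<^sub>M Pi\<^sub>M {..<k} (\<lambda>_. borel)) \<Longrightarrow>
      (\<integral>\<^sup>+ \<omega>. F (U k \<omega>, past k \<omega>) * ennreal (1 / d k (U k \<omega>, past k \<omega>)) \<partial>\<Omega>)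
      \<le> (\<integral>\<^sup>+ \<omega>. (\<integral>\<^sup>+ u. F (u, past k \<omega>) \<partial>lborel) \<partial>\<Omega>)"
  proof (rule conditional_density, goal_cases)
    case (1 d H)
    show ?case by (rule 1(1)[OF 1(2-6)])
  qed
  interpret persistent_heat \<sigma> \<alpha> c A L by fact
  interpret persistent_channel \<Omega> U \<sigma> \<alpha> c A L d H
    by unfold_locales (fact d)+
  have "capacity_fb \<Omega> U \<sigma> \<alpha> SNR \<le> ereal (2 * (H + ln (2 * pi / c) + 4))" if "0 < SNR" for SNR
    unfolding capacity_fb_def using that achievable_fb_le[of "SNR * \<sigma>\<^sup>2"]
    by (intro Sup_least) auto
  then have "(SUP SNR\<in>{0<..}. capacity_fb \<Omega> U \<sigma> \<alpha> SNR) \<le> ereal (2 * (H + ln (2 * pi / c) + 4))"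
    by (intro SUP_least) auto
  then show ?thesis by (rule le_less_trans) simp
qed

section \<open>Gilbert-Varshamov codes\<close>

definition hamming :: "nat \<Rightarrow> (nat \<Rightarrow> nat) \<Rightarrow> (nat \<Rightarrow> nat) \<Rightarrow> nat" where
  "hamming N f g = card {i. i < N \<and> f i \<noteq> g i}"

text \<open>Choose the set of positions that may change, then the entries there. Counting all 2^N
  sets is crude but costs only ln 2 per symbol, which is small against ln q.\<close>

lemma card_hamming_ball_le:
  assumes q: "1 \<le> q" and g: "g \<in> {..<N} \<rightarrow>\<^sub>E {..<q}"
  shows "card {f \<in> {..<N} \<rightarrow>\<^sub>E {..<q}. hamming N f g \<le> r} \<le> 2 ^ N * q ^ r"
proof -
  let ?S = "{S \<in> Pow {..<N}. card S \<le> r}"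
  let ?I = "\<lambda>S. (\<lambda>h i. if i \<in> S then h i else g i) ` (S \<rightarrow>\<^sub>E {..<q})"
  have fin: "finite S" if "S \<in> ?S" for S using that finite_subset by auto
  have finS: "finite ?S" by (rule finite_subset[of _ "Pow {..<N}"]) auto
  have finI: "finite (?I S)" if "S \<in> ?S" for S
    using fin[OF that] by (intro finite_imageI finite_PiE) auto
  have "{f \<in> {..<N} \<rightarrow>\<^sub>E {..<q}. hamming N f g \<le> r} \<subseteq> (\<Union>S\<in>?S. ?I S)"
  proof
    fix f assume f: "f \<in> {f \<in> {..<N} \<rightarrow>\<^sub>E {..<q}. hamming N f g \<le> r}"
    let ?T = "{i. i < N \<and> f i \<noteq> g i}"
    have "f i = g i" if "\<not> i < N" for i
      using f g that by (simp add: PiE_def extensional_def)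
    then have "f i = (if i \<in> ?T then restrict f ?T i else g i)" for i
      by (cases "i < N"; cases "f i = g i") simp_all
    then have "f = (\<lambda>i. if i \<in> ?T then restrict f ?T i else g i)" by (rule ext)
    moreover have "restrict f ?T \<in> ?T \<rightarrow>\<^sub>E {..<q}"
      using f by (simp add: PiE_def Pi_def)
    ultimately have "f \<in> ?I ?T" by (rule image_eqI)
    moreover have "?T \<in> ?S" using f by (auto simp: hamming_def)
    ultimately show "f \<in> (\<Union>S\<in>?S. ?I S)" by (intro UN_I)
  qed
  then have "card {f \<in> {..<N} \<rightarrow>\<^sub>E {..<q}. hamming N f g \<le> r} \<le> card (\<Union>S\<in>?S. ?I S)"
    by (intro card_mono finite_UN_I finS finI)
  also have "\<dots> \<le> (\<Sum>S\<in>?S. card (?I S))" by (rule card_UN_le[OF finS])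
  also have "\<dots> \<le> (\<Sum>S\<in>?S. q ^ r)"
  proof (intro sum_mono)
    fix S assume S: "S \<in> ?S"
    have "card (?I S) \<le> card (S \<rightarrow>\<^sub>E {..<q})" using fin[OF S] by (intro card_image_le finite_PiE) auto
    also have "\<dots> = q ^ card S" using fin[OF S] by (simp add: card_PiE)
    also have "\<dots> \<le> q ^ r" using S q by (intro power_increasing) auto
    finally show "card (?I S) \<le> q ^ r" .
  qed
  also have "\<dots> = card ?S * q ^ r" by simp
  also have "\<dots> \<le> card (Pow {..<N}) * q ^ r" by (intro mult_right_mono card_mono) auto
  finally show ?thesis by (simp add: card_Pow)
qed

text \<open>In a code of maximal cardinality every word lies within distance \<open>r\<close> of a
  code word, as it could be added otherwise; so the balls around the code words cover the whole
  space.\<close>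

lemma gilbert_varshamov:
  assumes q: "1 \<le> q"
  obtains C where "C \<subseteq> {..<N} \<rightarrow>\<^sub>E {..<q}"
    "\<And>f g. f \<in> C \<Longrightarrow> g \<in> C \<Longrightarrow> f \<noteq> g \<Longrightarrow> r < hamming N f g"
    "q ^ N \<le> card C * (2 ^ N * q ^ r)"
proof -
  let ?X = "{..<N} \<rightarrow>\<^sub>E {..<q}"
  let ?P = "\<lambda>C. C \<subseteq> ?X \<and> (\<forall>f\<in>C. \<forall>g\<in>C. f \<noteq> g \<longrightarrow> r < hamming N f g)"
  have finX: "finite ?X" by (intro finite_PiE) auto
  define \<C> where "\<C> = {C. ?P C}"
  have "finite \<C>" using finX by (intro finite_subset[of \<C> "Pow ?X"]) (auto simp: \<C>_def)
  moreover have "{} \<in> \<C>" by (simp add: \<C>_def)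
  ultimately have "Max (card ` \<C>) \<in> card ` \<C>" "\<And>C'. C' \<in> \<C> \<Longrightarrow> card C' \<le> Max (card ` \<C>)"
    using Max_in[of "card ` \<C>"] Max_ge[of "card ` \<C>"] by blast+
  then obtain C where C\<C>: "C \<in> \<C>" and max': "\<And>C'. C' \<in> \<C> \<Longrightarrow> card C' \<le> card C"
    by auto
  have C: "C \<subseteq> ?X" "\<And>f g. f \<in> C \<Longrightarrow> g \<in> C \<Longrightarrow> f \<noteq> g \<Longrightarrow> r < hamming N f g"
    using C\<C> unfolding \<C>_def by blast+
  have finC: "finite C" using C(1) finX by (rule finite_subset)
  have sym: "hamming N f g = hamming N g f" for f g by (simp add: hamming_def eq_commute)
  have "?X \<subseteq> (\<Union>g\<in>C. {f \<in> ?X. hamming N f g \<le> r})"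
  proof
    fix f assume f: "f \<in> ?X"
    show "f \<in> (\<Union>g\<in>C. {f \<in> ?X. hamming N f g \<le> r})"
    proof (rule ccontr)
      assume "f \<notin> (\<Union>g\<in>C. {f \<in> ?X. hamming N f g \<le> r})"
      then have far: "r < hamming N f g" if "g \<in> C" for g using that f by fastforce
      have "f \<notin> C" using far[of f] by (auto simp: hamming_def)
      have "r < hamming N g h" if "g \<in> insert f C" "h \<in> insert f C" "g \<noteq> h" for g h
      proof (cases "g = f")
        case True
        then show ?thesis using that far[of h] by simp
      next
        case False
        then show ?thesis using that far[of g] C(2)[of g h] sym[of g f] by auto
      qed
      then have "insert f C \<in> \<C>" using C(1) f unfolding \<C>_def by simp
      then show False using max'[of "insert f C"] finC \<open>f \<notin> C\<close> by simp
    qed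
  qed
  then have "card ?X \<le> card (\<Union>g\<in>C. {f \<in> ?X. hamming N f g \<le> r})"
    by (intro card_mono finite_UN_I finC finite_subset[OF _ finX]) auto
  also have "\<dots> \<le> (\<Sum>g\<in>C. card {f \<in> ?X. hamming N f g \<le> r})" by (rule card_UN_le[OF finC])
  also have "\<dots> \<le> (\<Sum>g\<in>C. 2 ^ N * q ^ r)"
    using C(1) q by (intro sum_mono card_hamming_ball_le) auto
  finally have "q ^ N \<le> card C * (2 ^ N * q ^ r)" by (simp add: card_PiE)
  with C show thesis by (rule that)
qed

text \<open>Seen from position \<open>i\<close>, each lag occurs at most twice, once on either side.
  This reduces the double sum of covariances in a variance to a single sum.\<close>

lemma sum_abs_diff_le:
  fixes h :: "nat \<Rightarrow> real"
  assumes h: "\<And>j. 0 \<le> h j" and i: "i < N"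
  shows "(\<Sum>j<N. h (if i \<le> j then j - i else i - j)) \<le> 2 * (\<Sum>j<N. h j)"
proof -
  have "(\<Sum>j<N. h (if i \<le> j then j - i else i - j))
      = (\<Sum>j\<in>{i..<N}. h (j - i)) + (\<Sum>j<i. h (i - j))"
  proof -
    have "{..<N} = {i..<N} \<union> {..<i}" using i by auto
    then have "(\<Sum>j<N. h (if i \<le> j then j - i else i - j))
        = (\<Sum>j\<in>{i..<N} \<union> {..<i}. h (if i \<le> j then j - i else i - j))" by simp
    also have "\<dots> = (\<Sum>j\<in>{i..<N}. h (if i \<le> j then j - i else i - j)) + (\<Sum>j<i. h (if i \<le> j then j - i else i - j))"
      by (rule sum.union_disjoint) auto
    finally have "(\<Sum>j<N. h (if i \<le> j then j - i else i - j))
        = (\<Sum>j\<in>{i..<N}. h (if i \<le> j then j - i else i - j)) + (\<Sum>j<i. h (if i \<le> j then j - i else i - j))" .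
    then show ?thesis by simp
  qed
  also have "(\<Sum>j\<in>{i..<N}. h (j - i)) = (\<Sum>j\<in>{..<N - i}. h j)"
    by (rule sum.reindex_bij_witness[of _ "\<lambda>j. j + i" "\<lambda>j. j - i"]) auto
  also have "(\<Sum>j<i. h (i - j)) = (\<Sum>j\<in>{1..i}. h j)"
    by (rule sum.reindex_bij_witness[of _ "\<lambda>j. i - j" "\<lambda>j. i - j"]) auto
  also have "(\<Sum>j\<in>{..<N - i}. h j) + (\<Sum>j\<in>{1..i}. h j) \<le> (\<Sum>j<N. h j) + (\<Sum>j<N. h j)"
    using i h by (intro add_mono sum_mono2) auto
  finally show ?thesis by simp
qed

section \<open>Concentration of large noise samples\<close>

context noise_process
begin

text \<open>The threshold 4 is chosen so that Chebyshev bounds the burst probability by 1/16, half of the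
  fraction 1/8 of errors that the outer code corrects.\<close>
definition burst :: "int \<Rightarrow> 'a set" where
  "burst k = {\<omega> \<in> space \<Omega>. 4 < \<bar>U k \<omega>\<bar>}"

lemma burst_sets [measurable]: "burst k \<in> events"
  unfolding burst_def by measurable

lemma prob_burst_shift: "prob (burst i \<inter> burst (i + k)) = prob (burst 0 \<inter> burst k)"
proof -
  let ?F = "\<lambda>w :: int \<Rightarrow> real. (if 4 < \<bar>w 0\<bar> \<and> 4 < \<bar>w k\<bar> then 1 else 0) :: ennreal"
  have [measurable]: "(\<lambda>w. w j) \<in> borel_measurable path_space" for j :: int
    by (rule measurable_component_singleton) simp
  have "(\<integral>\<^sup>+ \<omega>. ?F (\<lambda>j. U (j + i) \<omega>) \<partial>\<Omega>) = (\<integral>\<^sup>+ \<omega>. ?F (\<lambda>j. U j \<omega>) \<partial>\<Omega>)"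
    by (rule nn_integral_shift) measurable
  moreover have "(\<integral>\<^sup>+ \<omega>. ?F (\<lambda>j. U (j + l) \<omega>) \<partial>\<Omega>) = emeasure \<Omega> (burst l \<inter> burst (l + k))" for l
  proof -
    have "(\<integral>\<^sup>+ \<omega>. ?F (\<lambda>j. U (j + l) \<omega>) \<partial>\<Omega>) = (\<integral>\<^sup>+ \<omega>. indicator (burst l \<inter> burst (l + k)) \<omega> \<partial>\<Omega>)"
      by (intro nn_integral_cong) (auto simp: burst_def indicator_def add.commute)
    then show ?thesis by simp
  qed
  from this[of i] this[of 0] calculation
  have "emeasure \<Omega> (burst i \<inter> burst (i + k)) = emeasure \<Omega> (burst 0 \<inter> burst k)" by simp
  then show ?thesis by (simp add: emeasure_eq_measure)
qed

lemma prob_burst: "prob (burst k) = prob (burst 0)"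
  using prob_burst_shift[of k 0] by simp

lemma prob_burst_le: "prob (burst 0) \<le> 1 / 16"
proof -
  have "prob {\<omega> \<in> space \<Omega>. 4 \<le> \<bar>U 0 \<omega> - expectation (U 0)\<bar>} \<le> variance (U 0) / 4\<^sup>2"
    by (rule Chebyshev_inequality) (auto intro: integrable_U_sq)
  moreover have "prob (burst 0) \<le> prob {\<omega> \<in> space \<Omega>. 4 \<le> \<bar>U 0 \<omega> - expectation (U 0)\<bar>}"
    by (intro finite_measure_mono) (auto simp: burst_def zero_mean)
  ultimately show ?thesis by (simp add: unit_variance)
qed

definition burst_cov :: "nat \<Rightarrow> real" where
  "burst_cov k = prob (burst 0 \<inter> burst (int k)) - (prob (burst 0))\<^sup>2"

text \<open>Weak mixing with the same event, a large coordinate 0, in both places.\<close>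

lemma burst_cov_tendsto: "(\<lambda>n. (\<Sum>k<n. \<bar>burst_cov k\<bar>) / real n) \<longlonglongrightarrow> 0"
proof -
  let ?A = "{w \<in> space path_space. 4 < \<bar>w 0\<bar>}"
  have [measurable]: "(\<lambda>w. w j) \<in> borel_measurable path_space" for j :: int
    by (rule measurable_component_singleton) simp
  have "?A \<in> sets path_space" by measurable
  then have "(\<lambda>n. (\<Sum>k<n.
          \<bar>prob {\<omega> \<in> space \<Omega>. (\<lambda>i. U i \<omega>) \<in> ?A \<and> (\<lambda>i. U (i + int k) \<omega>) \<in> ?A}
            - prob {\<omega> \<in> space \<Omega>. (\<lambda>i. U i \<omega>) \<in> ?A}
              * prob {\<omega> \<in> space \<Omega>. (\<lambda>i. U i \<omega>) \<in> ?A}\<bar>) / real n) \<longlonglongrightarrow> 0"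
    using weakly_mixing unfolding weakly_mixing_process_def by blast
  moreover have "{\<omega> \<in> space \<Omega>. (\<lambda>i. U i \<omega>) \<in> ?A \<and> (\<lambda>i. U (i + int k) \<omega>) \<in> ?A} = burst 0 \<inter> burst (int k)" for k
    by (auto simp: burst_def space_PiM)
  moreover have "{\<omega> \<in> space \<Omega>. (\<lambda>i. U i \<omega>) \<in> ?A} = burst 0"
    by (auto simp: burst_def space_PiM)
  ultimately show ?thesis by (simp add: burst_cov_def power2_eq_square)
qed

definition burst_count :: "nat \<Rightarrow> nat \<Rightarrow> 'a \<Rightarrow> nat" where
  "burst_count L N \<omega> = card {\<nu>. \<nu> < N \<and> 4 < \<bar>U (int (\<nu> * L + 1)) \<omega>\<bar>}"

lemma real_burst_count:
  assumes "\<omega> \<in> space \<Omega>"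
  shows "real (burst_count L N \<omega>) = (\<Sum>\<nu><N. indicator (burst (int (\<nu> * L + 1))) \<omega>)"
proof -
  have "(\<Sum>\<nu><N. indicator (burst (int (\<nu> * L + 1))) \<omega> :: real)
      = (\<Sum>\<nu><N. if 4 < \<bar>U (int (\<nu> * L + 1)) \<omega>\<bar> then 1 else 0)"
    using assms by (intro sum.cong) (auto simp: burst_def indicator_def)
  also have "\<dots> = real (card {\<nu> \<in> {..<N}. 4 < \<bar>U (int (\<nu> * L + 1)) \<omega>\<bar>})"
    by (simp add: sum.If_cases Int_def)
  finally show ?thesis by (simp add: burst_count_def)
qed

lemma many_bursts_sets [measurable]: "{\<omega> \<in> space \<Omega>. N < 8 * burst_count L N \<omega>} \<in> events"
proof -
  have "{\<omega> \<in> space \<Omega>. N < 8 * burst_count L N \<omega>}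
      = {\<omega> \<in> space \<Omega>. real N < 8 * (\<Sum>\<nu><N. indicator (burst (int (\<nu> * L + 1))) \<omega>)}"
    unfolding set_eq_iff mem_Collect_eq
  proof (intro allI conj_cong refl)
    fix \<omega> assume "\<omega> \<in> space \<Omega>"
    from real_burst_count[OF this, of L N]
    show "(N < 8 * burst_count L N \<omega>) = (real N < 8 * (\<Sum>\<nu><N. indicator (burst (int (\<nu> * L + 1))) \<omega>))"
      by linarith
  qed
  also have "\<dots> \<in> events" by measurable
  finally show ?thesis .
qed

text \<open>Chebyshev's inequality: bursts have mean at most N / 16, so a count above N / 8 deviates
  by N / 16. The variance is at most 2 N times the absolute covariances at multiples of
  \<open>L\<close>, and these are dominated by the sum over all lags below N L. Normalising that sum
  by N L costs the factor \<open>L\<close>, and 2 N / (N / 16)^2 = 512 / N.\<close>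

lemma prob_many_bursts_le:
  assumes L: "1 \<le> L" and N: "1 \<le> N"
  shows "prob {\<omega> \<in> space \<Omega>. N < 8 * burst_count L N \<omega>}
    \<le> 512 * real L * ((\<Sum>k<N * L. \<bar>burst_cov k\<bar>) / real (N * L))"
proof -
  define B where "B \<nu> = burst (int (\<nu> * L + 1))" for \<nu>
  define S where "S \<omega> = (\<Sum>\<nu><N. indicator (B \<nu>) \<omega> :: real)" for \<omega>
  let ?p = "prob (burst 0)"
  have Bm [measurable]: "B \<nu> \<in> events" for \<nu> by (simp add: B_def)
  have pB: "prob (B \<nu>) = ?p" for \<nu> unfolding B_def by (rule prob_burst)
  have count: "real (burst_count L N \<omega>) = S \<omega>" if "\<omega> \<in> space \<Omega>" for \<omega>
    unfolding S_def B_def by (rule real_burst_count[OF that])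
  have [measurable]: "S \<in> borel_measurable \<Omega>" unfolding S_def by measurable
  have iB: "integrable \<Omega> (\<lambda>\<omega>. indicator (B \<nu>) \<omega> * indicator (B \<mu>) \<omega> :: real)"
    "integrable \<Omega> (\<lambda>\<omega>. indicator (B \<nu>) \<omega> :: real)" for \<nu> \<mu>
    by (auto intro!: integrable_real_mult_indicator simp: emeasure_eq_measure)
  have ES: "expectation S = N * ?p"
    unfolding S_def using iB by (subst Bochner_Integration.integral_sum) (auto simp: pB)
  have sq: "(S \<omega> - N * ?p)\<^sup>2 = (\<Sum>\<nu><N. \<Sum>\<mu><N. (indicator (B \<nu>) \<omega> - ?p) * (indicator (B \<mu>) \<omega> - ?p))" for \<omega>
  proof -
    have "S \<omega> - N * ?p = (\<Sum>\<nu><N. indicator (B \<nu>) \<omega> - ?p)" by (simp add: S_def sum_subtractf)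
    then show ?thesis by (simp add: power2_eq_square sum_product)
  qed
  have cov: "integrable \<Omega> (\<lambda>\<omega>. (indicator (B \<nu>) \<omega> - ?p) * (indicator (B \<mu>) \<omega> - ?p))"
    "expectation (\<lambda>\<omega>. (indicator (B \<nu>) \<omega> - ?p) * (indicator (B \<mu>) \<omega> - ?p))
      = burst_cov ((if \<nu> \<le> \<mu> then \<mu> - \<nu> else \<nu> - \<mu>) * L)" for \<nu> \<mu>
  proof -
    have eq: "(\<lambda>\<omega>. (indicator (B \<nu>) \<omega> - ?p) * (indicator (B \<mu>) \<omega> - ?p))
        = (\<lambda>\<omega>. indicator (B \<nu>) \<omega> * indicator (B \<mu>) \<omega> - ?p * indicator (B \<nu>) \<omega> - ?p * indicator (B \<mu>) \<omega> + ?p\<^sup>2)"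
      by (auto simp: fun_eq_iff algebra_simps power2_eq_square)
    show "integrable \<Omega> (\<lambda>\<omega>. (indicator (B \<nu>) \<omega> - ?p) * (indicator (B \<mu>) \<omega> - ?p))"
      unfolding eq using iB by auto
    have "expectation (\<lambda>\<omega>. indicator (B \<nu>) \<omega> * indicator (B \<mu>) \<omega>) = prob (B \<nu> \<inter> B \<mu>)"
      by (subst indicator_inter_arith[symmetric]) simp
    then have "expectation (\<lambda>\<omega>. (indicator (B \<nu>) \<omega> - ?p) * (indicator (B \<mu>) \<omega> - ?p))
        = prob (B \<nu> \<inter> B \<mu>) - ?p * ?p - ?p * ?p + ?p\<^sup>2"
      unfolding eq using iB by (simp add: pB prob_space)
    also have "\<dots> = prob (B \<nu> \<inter> B \<mu>) - ?p\<^sup>2" by (simp add: power2_eq_square)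
    also have "prob (B \<nu> \<inter> B \<mu>) = prob (burst 0 \<inter> burst (int ((if \<nu> \<le> \<mu> then \<mu> - \<nu> else \<nu> - \<mu>) * L)))"
    proof (cases "\<nu> \<le> \<mu>")
      case True
      have e: "int (\<mu> * L + 1) = int (\<nu> * L + 1) + int ((\<mu> - \<nu>) * L)"
        using True by (simp add: of_nat_diff left_diff_distrib)
      show ?thesis
        unfolding B_def e using True prob_burst_shift[of "int (\<nu> * L + 1)" "int ((\<mu> - \<nu>) * L)"]
        by (simp only: if_True)
    next
      case False
      have e: "int (\<nu> * L + 1) = int (\<mu> * L + 1) + int ((\<nu> - \<mu>) * L)"
        using False by (simp add: of_nat_diff left_diff_distrib)
      show ?thesis
        unfolding B_def e Int_commute[of "burst (int (\<mu> * L + 1) + int ((\<nu> - \<mu>) * L))"]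
        using False prob_burst_shift[of "int (\<mu> * L + 1)" "int ((\<nu> - \<mu>) * L)"]
        by (simp only: if_False)
    qed
    finally show "expectation (\<lambda>\<omega>. (indicator (B \<nu>) \<omega> - ?p) * (indicator (B \<mu>) \<omega> - ?p))
      = burst_cov ((if \<nu> \<le> \<mu> then \<mu> - \<nu> else \<nu> - \<mu>) * L)" by (simp add: burst_cov_def)
  qed
  have "variance S = (\<Sum>\<nu><N. \<Sum>\<mu><N. burst_cov ((if \<nu> \<le> \<mu> then \<mu> - \<nu> else \<nu> - \<mu>) * L))"
    unfolding ES sq using cov by simp
  also have "\<dots> \<le> (\<Sum>\<nu><N. \<Sum>\<mu><N. \<bar>burst_cov ((if \<nu> \<le> \<mu> then \<mu> - \<nu> else \<nu> - \<mu>) * L)\<bar>)"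
    by (intro sum_mono) simp
  also have "\<dots> \<le> (\<Sum>\<nu><N. 2 * (\<Sum>j<N. \<bar>burst_cov (j * L)\<bar>))"
    by (intro sum_mono sum_abs_diff_le[where h = "\<lambda>j. \<bar>burst_cov (j * L)\<bar>"]) auto
  also have "\<dots> = 2 * N * (\<Sum>j<N. \<bar>burst_cov (j * L)\<bar>)" by simp
  also have "(\<Sum>j<N. \<bar>burst_cov (j * L)\<bar>) = (\<Sum>k\<in>(\<lambda>j. j * L) ` {..<N}. \<bar>burst_cov k\<bar>)"
    using L by (subst sum.reindex) (auto simp: inj_on_def)
  also have "\<dots> \<le> (\<Sum>k<N * L. \<bar>burst_cov k\<bar>)"
    using L by (intro sum_mono2) auto
  finally have var: "variance S \<le> 2 * N * (\<Sum>k<N * L. \<bar>burst_cov k\<bar>)" using N by simp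
  have S_bound: "\<bar>S \<omega>\<bar> \<le> N" for \<omega>
  proof -
    have "\<bar>S \<omega>\<bar> \<le> (\<Sum>\<nu><N. \<bar>indicator (B \<nu>) \<omega> :: real\<bar>)" unfolding S_def by (rule sum_abs)
    also have "\<dots> \<le> (\<Sum>\<nu><N. 1)" by (intro sum_mono) (auto simp: indicator_def)
    finally show ?thesis by simp
  qed
  have S2: "integrable \<Omega> (\<lambda>\<omega>. (S \<omega>)\<^sup>2)"
  proof (rule integrable_const_bound[where B = "(real N)\<^sup>2"])
    show "AE \<omega> in \<Omega>. norm ((S \<omega>)\<^sup>2) \<le> (real N)\<^sup>2"
      using power_mono[OF S_bound abs_ge_zero, where n = 2] by (intro AE_I2) simp
  qed measurable
  have "prob {\<omega> \<in> space \<Omega>. N < 8 * burst_count L N \<omega>} \<le> prob {\<omega> \<in> space \<Omega>. real N / 16 \<le> \<bar>S \<omega> - expectation S\<bar>}"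
  proof (intro finite_measure_mono subsetI)
    fix \<omega> assume "\<omega> \<in> {\<omega> \<in> space \<Omega>. N < 8 * burst_count L N \<omega>}"
    then have \<omega>: "\<omega> \<in> space \<Omega>" "real N < 8 * S \<omega>" using count[of \<omega>] by auto
    moreover have "real N * ?p \<le> real N * (1 / 16)" by (intro mult_left_mono prob_burst_le) simp
    ultimately show "\<omega> \<in> {\<omega> \<in> space \<Omega>. real N / 16 \<le> \<bar>S \<omega> - expectation S\<bar>}" unfolding ES by auto
  qed measurable
  also have "\<dots> \<le> variance S / (real N / 16)\<^sup>2"
    using N S2 by (intro Chebyshev_inequality) auto
  also have "\<dots> \<le> (2 * N * (\<Sum>k<N * L. \<bar>burst_cov k\<bar>)) / (real N / 16)\<^sup>2"
    by (intro divide_right_mono var) simp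
  also have "\<dots> = 512 * real L * ((\<Sum>k<N * L. \<bar>burst_cov k\<bar>) / real (N * L))"
    using N L by (simp add: power2_eq_square field_simps)
  finally show ?thesis .
qed

lemma prob_many_bursts_tendsto:
  assumes L: "1 \<le> L"
  shows "(\<lambda>n. prob {\<omega> \<in> space \<Omega>. n div L < 8 * burst_count L (n div L) \<omega>}) \<longlonglongrightarrow> 0"
proof -
  have div: "filterlim (\<lambda>n. n div L) sequentially sequentially"
  proof (subst filterlim_at_top, intro allI)
    fix Z
    have "Z \<le> n div L" if "Z * L \<le> n" for n
      using div_le_mono[OF that, of L] L by simp
    then show "\<forall>\<^sub>F n in sequentially. Z \<le> n div L"
      by (auto simp: eventually_sequentially)
  qed
  have mul: "filterlim (\<lambda>N. N * L) sequentially sequentially"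
    using L by (intro filterlim_subseq) (auto simp: strict_mono_def)
  have "(\<lambda>N. 512 * real L * ((\<Sum>k<N * L. \<bar>burst_cov k\<bar>) / real (N * L))) \<longlonglongrightarrow> 512 * real L * 0"
    by (intro tendsto_mult tendsto_const filterlim_compose[OF burst_cov_tendsto mul])
  then have lim: "(\<lambda>N. 512 * real L * ((\<Sum>k<N * L. \<bar>burst_cov k\<bar>) / real (N * L))) \<longlonglongrightarrow> 0" by simp
  have "(\<lambda>N. prob {\<omega> \<in> space \<Omega>. N < 8 * burst_count L N \<omega>}) \<longlonglongrightarrow> 0"
  proof (rule tendsto_sandwich[OF _ _ tendsto_const lim])
    show "\<forall>\<^sub>F N in sequentially. prob {\<omega> \<in> space \<Omega>. N < 8 * burst_count L N \<omega>}
      \<le> 512 * real L * ((\<Sum>k<N * L. \<bar>burst_cov k\<bar>) / real (N * L))"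
      using eventually_ge_at_top[of 1] by eventually_elim (rule prob_many_bursts_le[OF L])
  qed simp
  from filterlim_compose[OF this div] show ?thesis .
qed

end

section \<open>Achievability by sparse pulses\<close>

text \<open>The spacing \<open>20 * \<sigma>\<close> exceeds twice the decision radius
  \<open>8 * \<sigma>\<close> used below. The guard \<open>1 \<le> k\<close> is needed because 0 - 1
  = 0 on natural numbers would put a pulse at time 0.\<close>

definition pam_input :: "real \<Rightarrow> nat \<Rightarrow> nat \<Rightarrow> (nat \<Rightarrow> nat) \<Rightarrow> nat \<Rightarrow> real" where
  "pam_input \<sigma> L N f k =
    (if 1 \<le> k \<and> L dvd (k - 1) \<and> (k - 1) div L < N then 20 * \<sigma> * real (f ((k - 1) div L)) else 0)"

lemma geometric_tail_le:
  fixes t :: real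
  assumes "0 \<le> t" "t \<le> 1 / 2"
  shows "(\<Sum>i<k. if L \<le> i then t ^ i else 0) \<le> 2 * t ^ L"
proof -
  \<comment> \<open>The subtracted remainder strengthens the claim enough for induction: going from
    \<open>k\<close> to k + 1 frees 2 (t^k - t^(k+1)), which is at least t^k.\<close>
  have "(\<Sum>i<k. if L \<le> i then t ^ i else 0) \<le> 2 * (t ^ L - t ^ max k L)"
  proof (induction k)
    case (Suc k)
    have "t ^ Suc k \<le> t ^ k / 2" using assms mult_right_mono[of t "1/2" "t ^ k"] by simp
    show ?case
    proof (cases "L \<le> k")
      case True
      then have "max k L = k" "max (Suc k) L = Suc k" by auto
      then show ?thesis using Suc True \<open>t ^ Suc k \<le> t ^ k / 2\<close> by (simp only: sum.lessThan_Suc if_True) argo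
    next
      case False
      then have "max k L = L" "max (Suc k) L = L" by auto
      then show ?thesis using Suc False by simp
    qed
  qed simp
  also have "\<dots> \<le> 2 * t ^ L" using assms by simp
  finally show ?thesis .
qed

text \<open>At a used time all earlier pulses lie at positive multiples of \<open>L\<close> in the
  past, so only coefficients with index at least \<open>L\<close> occur, and their geometric tail is
  at most twice its first term.\<close>

lemma heat_sparse_le:
  fixes t :: real
  assumes L: "1 \<le> L" and t: "0 \<le> t" "t \<le> 1 / 2"
    and \<alpha>: "\<And>l. L \<le> l \<Longrightarrow> \<alpha> l \<le> t ^ l"
    and x: "\<And>l. (x l)\<^sup>2 \<le> E" and sparse: "\<And>l. x l \<noteq> 0 \<Longrightarrow> L dvd (l - 1)"
  shows "heat \<sigma> \<alpha> x (\<nu> * L + 1) \<le> \<sigma>\<^sup>2 + E * (2 * t ^ L)"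
proof -
  define k where "k = \<nu> * L + 1"
  let ?g = "\<lambda>i. if L \<le> i then t ^ i else 0"
  have E: "0 \<le> E" using x[of 0] zero_le_power2[of "x 0"] by linarith
  have "(\<Sum>l=1..<k. \<alpha> (k - l) * (x l)\<^sup>2) \<le> (\<Sum>l=1..<k. E * ?g (k - l))"
  proof (intro sum_mono)
    fix l assume l: "l \<in> {1..<k}"
    show "\<alpha> (k - l) * (x l)\<^sup>2 \<le> E * ?g (k - l)"
    proof (cases "x l = 0")
      case True
      then show ?thesis using E t by simp
    next
      case False
      have "k - l = \<nu> * L - (l - 1)" using l by (auto simp: k_def)
      then have "L dvd (k - l)" using sparse[OF False] by (auto intro: dvd_diff_nat)
      then have le: "L \<le> k - l" using l by (intro dvd_imp_le) auto
      have "\<alpha> (k - l) * (x l)\<^sup>2 \<le> t ^ (k - l) * (x l)\<^sup>2"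
        by (intro mult_right_mono \<alpha> le) simp
      also have "\<dots> \<le> t ^ (k - l) * E" using t x by (intro mult_left_mono) auto
      finally show ?thesis using le by (simp add: mult.commute)
    qed
  qed
  also have "\<dots> = E * (\<Sum>l=1..<k. ?g (k - l))" by (simp add: sum_distrib_left)
  also have "(\<Sum>l=1..<k. ?g (k - l)) = (\<Sum>i=1..<k. ?g i)"
    by (rule sum.reindex_bij_witness[of _ "\<lambda>i. k - i" "\<lambda>i. k - i"]) auto
  also have "\<dots> \<le> (\<Sum>i<k. ?g i)"
    using t by (intro sum_mono2) auto
  also have "\<dots> \<le> 2 * t ^ L" by (rule geometric_tail_le[OF t])
  finally show ?thesis using E unfolding k_def[symmetric] heat_def by (simp add: mult_left_mono)
qed

context noise_process
begin

text \<open>With \<open>q\<close> = b^L levels the amplitudes are at most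
  \<open>20 * \<sigma> * q\<close>, hence at most \<open>\<sigma> * q ^ 2\<close> because 20 <= q;
  this explains the energy \<open>E\<close> with factor b^(4L). The decay rate b^(-4) is matched to
  it, so that \<open>E * t ^ L\<close> is the bare noise variance. The heat at a used time is then
  at most three times that variance, whatever \<open>b\<close> is.\<close>

lemma achievable_pam:
  fixes b L :: nat
  assumes \<sigma>: "0 < \<sigma>" and b: "2 \<le> b" and L: "2 \<le> L" and bL: "20 \<le> b ^ L"
    and nonneg: "\<And>l. 1 \<le> l \<Longrightarrow> 0 \<le> \<alpha> l" and decay: "\<And>l. L \<le> l \<Longrightarrow> \<alpha> l \<le> (1 / real b ^ 4) ^ l"
  shows "achievable \<Omega> U \<sigma> \<alpha> (real b ^ (4 * L) * \<sigma>\<^sup>2) (ln (real b) / 8)"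
proof -
  define q where "q = b ^ L"
  define t where "t = 1 / real b ^ 4"
  define E where "E = real b ^ (4 * L) * \<sigma>\<^sup>2"
  define N where "N n = n div L" for n
  have q1: "1 \<le> q" using b by (simp add: q_def)
  have t: "0 \<le> t" "t \<le> 1 / 2"
  proof -
    have "(2::real) ^ 4 \<le> real b ^ 4" using b by (intro power_mono) auto
    then have "2 \<le> real b ^ 4" by simp
    then show "t \<le> 1 / 2" unfolding t_def using b by (intro divide_left_mono) auto
  qed (simp add: t_def)
  have Et: "E * t ^ L = \<sigma>\<^sup>2"
    using b unfolding E_def t_def power_mult[of _ 4 L] power_divide by simp
  have "\<exists>C. C \<subseteq> {..<N n} \<rightarrow>\<^sub>E {..<q} \<and> (\<forall>f\<in>C. \<forall>g\<in>C. f \<noteq> g \<longrightarrow> N n div 4 < hamming (N n) f g)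
      \<and> q ^ N n \<le> card C * (2 ^ N n * q ^ (N n div 4))" for n
  proof (rule gilbert_varshamov[OF q1, of "N n" "N n div 4"], goal_cases)
    case (1 C)
    show ?case by (rule exI[of _ C]) (intro conjI ballI impI 1)
  qed
  then obtain C where C: "\<And>n. C n \<subseteq> {..<N n} \<rightarrow>\<^sub>E {..<q}"
    "\<And>n f g. f \<in> C n \<Longrightarrow> g \<in> C n \<Longrightarrow> f \<noteq> g \<Longrightarrow> N n div 4 < hamming (N n) f g"
    "\<And>n. q ^ N n \<le> card (C n) * (2 ^ N n * q ^ (N n div 4))"
    by metis
  have finC: "finite (C n)" for n
    using C(1) by (rule finite_subset) (intro finite_PiE, auto)
  define M where "M n = card (C n)" for n
  have M: "0 < M n" for n
  proof (rule ccontr)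
    assume "\<not> 0 < M n"
    then have "q ^ N n \<le> 0" using C(3)[of n] by (simp add: M_def)
    then show False using q1 by simp
  qed
  have "\<exists>h. bij_betw h {0..<M n} (C n)" for n
    unfolding M_def by (rule ex_bij_betw_nat_finite[OF finC])
  then obtain e where e: "\<And>n. bij_betw (e n) {0..<M n} (C n)" by metis
  define W where "W n = {0..<M n}" for n
  have eC: "e n m \<in> C n" if "m \<in> W n" for n m
    using bij_betwE[OF e] that by (auto simp: W_def)
  have eq: "e n m \<nu> < q" if "m \<in> W n" "\<nu> < N n" for n m \<nu>
    using eC[OF that(1)] C(1)[of n] that(2) by (auto simp: PiE_def Pi_def)
  define \<phi> where "\<phi> n m = pam_input \<sigma> L (N n) (e n m)" for n m
  have \<phi>_sq: "(\<phi> n m k)\<^sup>2 \<le> E" if "m \<in> W n" for n m k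
  proof (cases "1 \<le> k \<and> L dvd (k - 1) \<and> (k - 1) div L < N n")
    case True
    have "real (e n m ((k - 1) div L)) \<le> real q"
      using eq[OF that] True by (simp add: less_imp_le)
    moreover have "20 \<le> real q" using bL unfolding q_def by (metis of_nat_le_iff of_nat_numeral)
    ultimately have "20 * real (e n m ((k - 1) div L)) \<le> real q * real q"
      by (intro mult_mono) auto
    then have "(20 * real (e n m ((k - 1) div L)))\<^sup>2 \<le> (real q * real q)\<^sup>2"
      by (intro power_mono) auto
    then have "(20 * real (e n m ((k - 1) div L)))\<^sup>2 * \<sigma>\<^sup>2 \<le> (real q * real q)\<^sup>2 * \<sigma>\<^sup>2"
      by (intro mult_right_mono) auto
    moreover have "(real q * real q)\<^sup>2 = real b ^ (4 * L)"
      by (simp add: q_def flip: power_mult power_add power2_eq_square)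
    ultimately show ?thesis
      using True by (simp add: \<phi>_def pam_input_def E_def power_mult_distrib mult_ac)
  qed (auto simp: \<phi>_def pam_input_def E_def)
  have heat: "sqrt (heat \<sigma> \<alpha> (\<phi> n m) (\<nu> * L + 1)) \<le> 2 * \<sigma>" if "m \<in> W n" for n m \<nu>
  proof -
    have "heat \<sigma> \<alpha> (\<phi> n m) (\<nu> * L + 1) \<le> \<sigma>\<^sup>2 + E * (2 * t ^ L)"
      using L t decay \<phi>_sq[OF that] unfolding t_def
      by (intro heat_sparse_le) (auto simp: \<phi>_def pam_input_def split: if_splits)
    also have "\<dots> \<le> (2 * \<sigma>)\<^sup>2"
      unfolding mult.left_commute[of E] Et by (simp add: power_mult_distrib)
    finally show ?thesis using \<sigma> real_le_lsqrt by simp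
  qed
  define bad where "bad n m y = {\<nu>. \<nu> < N n \<and> 8 * \<sigma> < \<bar>y (\<nu> * L + 1) - 20 * \<sigma> * real (e n m \<nu>)\<bar>}"
    for n m and y :: "nat \<Rightarrow> real"
  \<comment> \<open>The alternative \<open>m = M n - 1\<close>, the last message, makes LEAST well
    defined and keeps the decision inside \<open>W n\<close> when no message fits.\<close>
  define \<psi> where "\<psi> n y = (LEAST m. 8 * card (bad n m y) \<le> N n \<or> m = M n - 1)" for n y
  have fin_bad: "finite (bad n m y)" for n m y
    by (rule finite_subset[of _ "{..<N n}"]) (auto simp: bad_def)
  \<comment> \<open>Where two code words differ, their amplitudes are at least
    \<open>20 * \<sigma>\<close> apart, so no output is within \<open>8 * \<sigma>\<close> of both.
    Two fitting messages would thus differ in at most N / 8 + N / 8 positions, against the distance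
    of the code.\<close>
  have unique: "m = m'" if m: "m \<in> W n" "m' \<in> W n" "8 * card (bad n m y) \<le> N n" "8 * card (bad n m' y) \<le> N n"
    for n m m' y
  proof (rule ccontr)
    assume "m \<noteq> m'"
    then have "e n m \<noteq> e n m'" using bij_betw_imp_inj_on[OF e] m by (auto simp: W_def inj_on_def)
    then have "N n div 4 < hamming (N n) (e n m) (e n m')" using C(2) eC m by blast
    moreover have "hamming (N n) (e n m) (e n m') \<le> card (bad n m y \<union> bad n m' y)"
      unfolding hamming_def
    proof (intro card_mono finite_UnI fin_bad subsetI)
      fix \<nu> assume "\<nu> \<in> {i. i < N n \<and> e n m i \<noteq> e n m' i}"
      then have \<nu>: "\<nu> < N n" "e n m \<nu> \<noteq> e n m' \<nu>" by auto
      then have "1 \<le> \<bar>real (e n m \<nu>) - real (e n m' \<nu>)\<bar>" by linarith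
      then have "20 * \<sigma> \<le> 20 * \<sigma> * \<bar>real (e n m \<nu>) - real (e n m' \<nu>)\<bar>" using \<sigma> by simp
      also have "\<dots> = \<bar>20 * \<sigma> * real (e n m \<nu>) - 20 * \<sigma> * real (e n m' \<nu>)\<bar>"
        using \<sigma> by (simp add: abs_mult flip: right_diff_distrib)
      finally show "\<nu> \<in> bad n m y \<union> bad n m' y" using \<nu>(1) \<sigma> by (auto simp: bad_def)
    qed
    moreover have "card (bad n m y \<union> bad n m' y) \<le> card (bad n m y) + card (bad n m' y)"
      by (rule card_Un_le)
    ultimately show False using m by linarith
  qed
  have \<psi>_eq: "\<psi> n y = m" if m: "m \<in> W n" "8 * card (bad n m y) \<le> N n" for n m y
    unfolding \<psi>_def
  proof (rule Least_equality)
    fix m' assume "8 * card (bad n m' y) \<le> N n \<or> m' = M n - 1"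
    then show "m \<le> m'" using unique[of m n m' y] m by (cases "m' < M n") (auto simp: W_def)
  qed (use m in simp)
  have \<psi>_W: "\<psi> n y \<in> W n" for n y
  proof -
    have "\<psi> n y \<le> M n - 1" unfolding \<psi>_def by (rule Least_le) simp
    then show ?thesis using M[of n] by (simp add: W_def)
  qed
  have NL: "\<nu> * L + 1 \<in> {1..n}" if "\<nu> < N n" for \<nu> n
  proof -
    have "Suc \<nu> * L \<le> N n * L" using that by (intro mult_le_mono1) simp
    also have "\<dots> \<le> n" unfolding N_def by (rule div_times_less_eq_dividend)
    finally show ?thesis using L by auto
  qed
  have \<psi>_meas: "\<psi> n \<in> Pi\<^sub>M {1..n} (\<lambda>_. borel) \<rightarrow>\<^sub>M count_space (W n)" for n
  proof -
    have "Measurable.pred (Pi\<^sub>M {1..n} (\<lambda>_. borel)) (\<lambda>y. 8 * card (bad n m y) \<le> N n)" for m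
    proof -
      have card: "real (card (bad n m y)) = (\<Sum>\<nu><N n. if 8 * \<sigma> < \<bar>y (\<nu> * L + 1) - 20 * \<sigma> * real (e n m \<nu>)\<bar> then 1 else 0)" for y
        by (simp add: bad_def sum.If_cases Int_def)
      have [measurable]: "(\<lambda>y. real (card (bad n m y))) \<in> borel_measurable (Pi\<^sub>M {1..n} (\<lambda>_. borel))"
        unfolding card
      proof (intro borel_measurable_sum)
        fix \<nu> assume "\<nu> \<in> {..<N n}"
        then have [measurable]: "(\<lambda>y. y (\<nu> * L + 1)) \<in> borel_measurable (Pi\<^sub>M {1..n} (\<lambda>_. borel :: real measure))"
          by (intro measurable_component_singleton NL) simp
        show "(\<lambda>y. if 8 * \<sigma> < \<bar>y (\<nu> * L + 1) - 20 * \<sigma> * real (e n m \<nu>)\<bar> then 1 else 0 :: real)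
            \<in> borel_measurable (Pi\<^sub>M {1..n} (\<lambda>_. borel))" by measurable
      qed
      have le_iff: "(8 * card (bad n m y) \<le> N n) = (8 * real (card (bad n m y)) \<le> real (N n))" for y
        by linarith
      show ?thesis unfolding le_iff by measurable
    qed
    then have "\<psi> n \<in> Pi\<^sub>M {1..n} (\<lambda>_. borel) \<rightarrow>\<^sub>M count_space UNIV"
      unfolding \<psi>_def[abs_def] by measurable
    from measurable_sets[OF this] show ?thesis
      using \<psi>_W[of n] by (subst measurable_count_space_eq2) (auto simp: W_def)
  qed
  have power: "power_constraint \<Omega> E n (W n) (\<lambda>k p. \<phi> n (fst p) k)" if n: "1 \<le> n" for n
  proof -
    have Wn: "finite (W n)" "W n \<noteq> {}" using M[of n] by (auto simp: W_def)
    interpret MN: prob_space "msg_noise (W n) \<Omega>" by (rule prob_space_msg_noise[OF Wn])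
    have "(\<integral>\<^sup>+ p. ennreal ((\<phi> n (fst p) k)\<^sup>2) \<partial>msg_noise (W n) \<Omega>) \<le> ennreal E" for k
    proof -
      have "(\<integral>\<^sup>+ p. ennreal ((\<phi> n (fst p) k)\<^sup>2) \<partial>msg_noise (W n) \<Omega>) \<le> (\<integral>\<^sup>+ p. ennreal E \<partial>msg_noise (W n) \<Omega>)"
        by (intro nn_integral_mono ennreal_leI \<phi>_sq) (auto simp: space_msg_noise)
      then show ?thesis by (simp add: MN.emeasure_space_1)
    qed
    then have "(\<Sum>k=1..n. \<integral>\<^sup>+ p. ennreal ((\<phi> n (fst p) k)\<^sup>2) \<partial>msg_noise (W n) \<Omega>) \<le> (\<Sum>k=1..n. ennreal E)"
      by (intro sum_mono)
    also have "\<dots> = ennreal E * of_nat n" by (simp add: mult.commute)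
    finally have "(\<Sum>k=1..n. \<integral>\<^sup>+ p. ennreal ((\<phi> n (fst p) k)\<^sup>2) \<partial>msg_noise (W n) \<Omega>) / of_nat n
        \<le> ennreal E * of_nat n / of_nat n" by (rule divide_right_mono_ennreal)
    also have "\<dots> = ennreal E"
      using n by (intro ennreal_mult_divide_eq) (auto simp: of_nat_less_top)
    finally show ?thesis by (simp add: power_constraint_def)
  qed
  define err where "err n = error_prob \<Omega> U \<sigma> \<alpha> n (W n) (\<lambda>k p. \<phi> n (fst p) k) (\<psi> n)" for n
  have err_le: "err n \<le> prob {\<omega> \<in> space \<Omega>. n div L < 8 * burst_count L (n div L) \<omega>}" for n
  proof -
    let ?B = "{\<omega> \<in> space \<Omega>. N n < 8 * burst_count L (N n) \<omega>}"
    have Wn: "finite (W n)" "W n \<noteq> {}" using M[of n] by (auto simp: W_def)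
    interpret MN: prob_space "msg_noise (W n) \<Omega>" by (rule prob_space_msg_noise[OF Wn])
    \<comment> \<open>An error requires more than an eighth of the slots to be bad for the sent
      message. A slot is bad only in a burst, since the radius \<open>8 * \<sigma>\<close> is 4
      times the bound \<open>2 * \<sigma>\<close> on the noise scale.\<close>
    have "err n \<le> measure (msg_noise (W n) \<Omega>) (W n \<times> ?B)"
      unfolding err_def error_prob_def
    proof (intro MN.finite_measure_mono subsetI)
      fix p assume p: "p \<in> {p \<in> space (msg_noise (W n) \<Omega>).
        \<psi> n (\<lambda>k\<in>{1..n}. channel_output \<sigma> \<alpha> (\<lambda>i. U (int i) (snd p)) (\<lambda>i. \<phi> n (fst p) i) k) \<noteq> fst p}"
      obtain m \<omega> where pm: "p = (m, \<omega>)" by (cases p)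
      let ?y = "\<lambda>k\<in>{1..n}. channel_output \<sigma> \<alpha> (\<lambda>i. U (int i) \<omega>) (\<phi> n m) k"
      have m: "m \<in> W n" and \<omega>: "\<omega> \<in> space \<Omega>" and wrong: "\<psi> n ?y \<noteq> m"
        using p by (auto simp: pm space_msg_noise)
      have "bad n m ?y \<subseteq> {\<nu>. \<nu> < N n \<and> 4 < \<bar>U (int (\<nu> * L + 1)) \<omega>\<bar>}"
      proof
        fix \<nu> assume \<nu>: "\<nu> \<in> bad n m ?y"
        then have \<nu>N: "\<nu> < N n" by (simp add: bad_def)
        have "\<phi> n m (\<nu> * L + 1) = 20 * \<sigma> * real (e n m \<nu>)"
          using \<nu>N L by (simp add: \<phi>_def pam_input_def)
        then have "?y (\<nu> * L + 1) - 20 * \<sigma> * real (e n m \<nu>)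
            = sqrt (heat \<sigma> \<alpha> (\<phi> n m) (\<nu> * L + 1)) * U (int (\<nu> * L + 1)) \<omega>"
          using NL[OF \<nu>N] by (simp add: channel_output_heat)
        moreover have "8 * \<sigma> < \<bar>?y (\<nu> * L + 1) - 20 * \<sigma> * real (e n m \<nu>)\<bar>"
          using \<nu> by (simp add: bad_def)
        ultimately have "8 * \<sigma> < \<bar>sqrt (heat \<sigma> \<alpha> (\<phi> n m) (\<nu> * L + 1))\<bar> * \<bar>U (int (\<nu> * L + 1)) \<omega>\<bar>"
          by (simp add: abs_mult)
        also have "\<dots> \<le> 2 * \<sigma> * \<bar>U (int (\<nu> * L + 1)) \<omega>\<bar>"
        proof (intro mult_right_mono)
          have "0 \<le> heat \<sigma> \<alpha> (\<phi> n m) (\<nu> * L + 1)"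
            unfolding heat_def using nonneg by (intro add_nonneg_nonneg sum_nonneg mult_nonneg_nonneg) auto
          then show "\<bar>sqrt (heat \<sigma> \<alpha> (\<phi> n m) (\<nu> * L + 1))\<bar> \<le> 2 * \<sigma>" using heat[OF m] by simp
        qed simp
        finally have "4 < \<bar>U (int (\<nu> * L + 1)) \<omega>\<bar>" using \<sigma> by simp
        then show "\<nu> \<in> {\<nu>. \<nu> < N n \<and> 4 < \<bar>U (int (\<nu> * L + 1)) \<omega>\<bar>}" using \<nu>N by simp
      qed
      then have "card (bad n m ?y) \<le> burst_count L (N n) \<omega>"
        unfolding burst_count_def by (intro card_mono) auto
      moreover have "\<not> 8 * card (bad n m ?y) \<le> N n" using \<psi>_eq[OF m] wrong by blast
      ultimately show "p \<in> W n \<times> ?B" using m \<omega> by (simp add: pm)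
    next
      show "W n \<times> ?B \<in> sets (msg_noise (W n) \<Omega>)"
        by (intro pair_measureI) (auto simp: sets_uniform_count_measure)
    qed
    also have "measure (msg_noise (W n) \<Omega>) (W n \<times> ?B) = prob ?B"
    proof -
      have "emeasure (msg_noise (W n) \<Omega>) (W n \<times> ?B) = emeasure (uniform_count_measure (W n)) (W n) * emeasure \<Omega> ?B"
        by (rule emeasure_pair_measure_Times) (auto simp: sets_uniform_count_measure)
      also have "emeasure (uniform_count_measure (W n)) (W n) = 1"
        using Wn by (simp add: emeasure_uniform_count_measure)
      finally show ?thesis by (simp add: measure_def)
    qed
    finally show ?thesis by (simp add: N_def)
  qed
  have err_lim: "err \<longlonglongrightarrow> 0"
  proof (rule tendsto_sandwich[OF _ _ tendsto_const prob_many_bursts_tendsto])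
    show "\<forall>\<^sub>F n in sequentially. 0 \<le> err n" by (simp add: err_def error_prob_def)
    show "\<forall>\<^sub>F n in sequentially. err n \<le> prob {\<omega> \<in> space \<Omega>. n div L < 8 * burst_count L (n div L) \<omega>}"
      using err_le by simp
  qed (use L in simp)
  \<comment> \<open>The distance costs a quarter of ln q per symbol, and the ball count costs ln 2,
    at most half of it; a quarter remains, which is L ln b / 4. The incomplete last period is
    absorbed by n <= 2 N L, which halves the rate per channel use to ln b / 8.\<close>
  have rate: "ln (real b) / 8 \<le> ln (real (card (W n))) / real n" if n: "2 * L \<le> n" for n
  proof -
    define r where "r = N n div 4"
    have b0: "0 < ln (real b)" using b by simp
    have q0: "0 < real q" using q1 by simp
    have "real (q ^ N n) \<le> real (M n * (2 ^ N n * q ^ r))"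
      unfolding of_nat_le_iff M_def r_def by (rule C(3))
    then have "real q ^ N n \<le> real (M n) * (2 ^ N n * real q ^ r)"
      by (simp only: of_nat_power of_nat_mult of_nat_numeral)
    moreover have "0 < real q ^ N n" using q0 by simp
    ultimately have "ln (real q ^ N n) \<le> ln (real (M n) * (2 ^ N n * real q ^ r))"
      by (rule ln_mono)
    also have "\<dots> = ln (real (M n)) + (ln (2 ^ N n) + ln (real q ^ r))"
      using q0 M[of n] by (subst ln_mult_pos, simp, simp, subst ln_mult_pos) simp_all
    finally have "real (N n) * ln (real q) \<le> ln (real (M n)) + (real (N n) * ln 2 + real r * ln (real q))"
      by (simp only: ln_realpow)
    moreover have "real r * ln (real q) \<le> real (N n) / 4 * ln (real q)"
    proof (rule mult_right_mono)
      have "4 * r \<le> N n" by (simp add: r_def)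
      then show "real r \<le> real (N n) / 4" by linarith
    qed (use q1 in simp)
    ultimately have "real (N n) * (3 / 4 * ln (real q) - ln 2) \<le> ln (real (M n))"
      by (simp add: algebra_simps)
    moreover have "ln (real q) = real L * ln (real b)" by (simp add: q_def ln_realpow)
    ultimately have lnM: "real (N n) * (3 / 4 * (real L * ln (real b)) - ln 2) \<le> ln (real (M n))" by simp
    have "ln 2 \<le> ln (real b)" using b by simp
    also have "\<dots> \<le> real L * ln (real b) / 2" using L b0 mult_right_mono[of 2 "real L" "ln (real b)"] by simp
    finally have "real L * ln (real b) / 4 \<le> 3 / 4 * (real L * ln (real b)) - ln 2" by simp
    then have "real (N n) * (real L * ln (real b) / 4) \<le> real (N n) * (3 / 4 * (real L * ln (real b)) - ln 2)"
      by (intro mult_left_mono) auto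
    with lnM have 1: "real (N n) * (real L * ln (real b) / 4) \<le> ln (real (M n))" by simp
    have "n = N n * L + n mod L" by (simp add: N_def)
    moreover have "n mod L < L" using L by simp
    moreover have "2 \<le> N n" using div_le_mono[OF n, of L] L by (simp add: N_def)
    then have "L \<le> N n * L" by simp
    ultimately have "n \<le> 2 * (N n * L)" by linarith
    then have "real n \<le> real (2 * (N n * L))" by (simp only: of_nat_le_iff)
    then have "real n * (ln (real b) / 8) \<le> real (2 * (N n * L)) * (ln (real b) / 8)"
      using b0 by (intro mult_right_mono) auto
    also have "\<dots> = real (N n) * (real L * ln (real b) / 4)" by simp
    also note 1
    finally show ?thesis using n L by (simp add: W_def field_simps)
  qed
  have lim: "ereal (ln (real b) / 8) \<le> liminf (\<lambda>n. ereal (ln (real (card (W n))) / real n))"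
  proof (rule Liminf_bounded)
    show "\<forall>\<^sub>F n in sequentially. ereal (ln (real b) / 8) \<le> ereal (ln (real (card (W n))) / real n)"
      using eventually_ge_at_top[of "2 * L"] by eventually_elim (use rate in simp)
  qed
  have W: "finite (W n)" "W n \<noteq> {}" for n using M[of n] by (auto simp: W_def)
  have "achieves_rate \<Omega> U \<sigma> \<alpha> E W (\<lambda>n k p. \<phi> n (fst p) k) \<psi> (ln (real b) / 8)"
    unfolding achieves_rate_def
    by (intro conjI allI impI W \<psi>_meas power lim err_lim[unfolded err_def[abs_def]])
  then show ?thesis unfolding achievable_def E_def by (intro exI)
qed

end

text \<open>Asking for the ratio \<open>t / 2\<close> instead of \<open>t\<close> yields an extra
  factor 2^(-m), which eventually absorbs the constant \<open>\<alpha> K / t ^ K\<close>.\<close>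

lemma superexponential_decay:
  assumes nonneg: "\<And>l. 1 \<le> l \<Longrightarrow> 0 \<le> \<alpha> l" and lim: "limsup (coeff_ratio \<alpha>) = 0" and t: "0 < t"
  shows "\<forall>\<^sub>F l in sequentially. \<alpha> l \<le> t ^ l"
proof -
  have "\<forall>\<^sub>F l in sequentially. coeff_ratio \<alpha> l < ereal (t / 2)"
    using lim t by (intro Limsup_lessD) auto
  then obtain K0 where K0: "\<And>l. K0 \<le> l \<Longrightarrow> coeff_ratio \<alpha> l < ereal (t / 2)"
    by (auto simp: eventually_sequentially)
  define K where "K = max K0 1"
  have step: "\<alpha> (l + 1) \<le> t / 2 * \<alpha> l" if l: "K \<le> l" for l
  proof -
    have r: "coeff_ratio \<alpha> l < ereal (t / 2)" using K0 l by (simp add: K_def)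
    have n: "0 \<le> \<alpha> l" "0 \<le> \<alpha> (l + 1)" using nonneg l by (auto simp: K_def)
    show ?thesis
    proof (cases "\<alpha> l = 0")
      case True
      \<comment> \<open>As a / 0 is infinite for a > 0, a ratio below \<open>t / 2\<close> forces
        the coefficients to stay zero once they vanish.\<close>
      then have "\<alpha> (l + 1) = 0" using r n coeff_ratio_conventions(1)[of \<alpha> l] by fastforce
      then show ?thesis using True by simp
    next
      case False
      then have "\<alpha> (l + 1) / \<alpha> l < t / 2" using r by (simp add: coeff_ratio_conventions)
      then show ?thesis using n False by (simp add: field_simps)
    qed
  qed
  have iter: "\<alpha> (K + m) \<le> (t / 2) ^ m * \<alpha> K" for m
  proof (induction m)
    case (Suc m)
    have "\<alpha> (K + Suc m) \<le> t / 2 * \<alpha> (K + m)" using step[of "K + m"] by simp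
    also have "\<dots> \<le> t / 2 * ((t / 2) ^ m * \<alpha> K)" using Suc t by (intro mult_left_mono) auto
    finally show ?case by simp
  qed simp
  obtain m0 where m0: "\<alpha> K / t ^ K < 2 ^ m0" using real_arch_pow[of 2 "\<alpha> K / t ^ K"] by auto
  have "\<alpha> l \<le> t ^ l" if l: "K + m0 \<le> l" for l
  proof -
    define m where "m = l - K"
    have m: "l = K + m" "m0 \<le> m" using l by (auto simp: m_def)
    have "(2::real) ^ m0 \<le> 2 ^ m" using m by (intro power_increasing) auto
    then have "\<alpha> K / t ^ K \<le> 2 ^ m" using m0 by linarith
    then have "\<alpha> K \<le> 2 ^ m * t ^ K" using t by (simp add: field_simps)
    then have "(t / 2) ^ m * \<alpha> K \<le> (t / 2) ^ m * (2 ^ m * t ^ K)" using t by (intro mult_left_mono) auto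
    also have "\<dots> = t ^ l" by (simp add: m power_divide power_add)
    finally show ?thesis using iter[of m] m by simp
  qed
  then show ?thesis by (auto simp: eventually_sequentially)
qed

text \<open>The order of choices matters: \<open>B\<close> fixes \<open>b\<close>, the decay at base
  b^(-4) then fixes \<open>L\<close>, and only these two fix the signal-to-noise ratio b^(4L) at
  which rate ln b / 8 is achieved.\<close>

lemma capacity_unbounded:
  assumes noise: "noise_process \<Omega> U" and \<sigma>: "0 < \<sigma>"
    and nonneg: "\<And>l. 1 \<le> l \<Longrightarrow> 0 \<le> \<alpha> l" and lim: "limsup (coeff_ratio \<alpha>) = 0"
  shows "(SUP SNR\<in>{0<..}. capacity \<Omega> U \<sigma> \<alpha> SNR) = \<infinity>"
proof (rule ereal_top)
  interpret noise_process \<Omega> U by fact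
  fix B :: real
  obtain b :: nat where b: "exp (8 * B) + 2 \<le> real b" using real_arch_simple by blast
  then have b2: "2 \<le> b" using exp_gt_zero[of "8 * B"] by linarith
  have "exp (8 * B) \<le> real b" using b by simp
  then have Bb: "B \<le> ln (real b) / 8" using b2 by (subst (asm) ln_ge_iff[symmetric]) auto
  have "\<forall>\<^sub>F l in sequentially. \<alpha> l \<le> (1 / real b ^ 4) ^ l"
    using b2 by (intro superexponential_decay nonneg lim) auto
  then obtain L0 where L0: "\<And>l. L0 \<le> l \<Longrightarrow> \<alpha> l \<le> (1 / real b ^ 4) ^ l"
    by (auto simp: eventually_sequentially)
  \<comment> \<open>The 5 ensures 20 <= 2^5 <= b^L, as \<open>achievable_pam\<close>
    requires.\<close>
  define L where "L = max L0 5"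
  have "(20::nat) \<le> 2 ^ 5" by simp
  also have "\<dots> \<le> b ^ 5" using b2 by (intro power_mono) auto
  also have "\<dots> \<le> b ^ L" using b2 by (intro power_increasing) (auto simp: L_def)
  finally have "achievable \<Omega> U \<sigma> \<alpha> (real b ^ (4 * L) * \<sigma>\<^sup>2) (ln (real b) / 8)"
    using \<sigma> b2 nonneg L0 by (intro achievable_pam) (auto simp: L_def)
  then have "ereal (ln (real b) / 8) \<le> capacity \<Omega> U \<sigma> \<alpha> (real b ^ (4 * L))"
    unfolding capacity_def by (intro Sup_upper) auto
  also have "\<dots> \<le> (SUP SNR\<in>{0<..}. capacity \<Omega> U \<sigma> \<alpha> SNR)"
    using b2 by (intro SUP_upper) auto
  finally show "ereal B \<le> (SUP SNR\<in>{0<..}. capacity \<Omega> U \<sigma> \<alpha> SNR)"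
    using Bb by (meson ereal_less_eq(3) order_trans)
qed

theorem theorem3:
  fixes \<Omega> :: "'a measure" and U :: "int \<Rightarrow> 'a \<Rightarrow> real"
    and \<sigma> :: real and \<alpha> :: "nat \<Rightarrow> real"
  assumes "noise_process \<Omega> U"
    and "\<sigma> > 0"
    and "\<And>l. l \<ge> 1 \<Longrightarrow> \<alpha> l \<ge> 0"
    and "bdd_above (\<alpha> ` {1..})"
  shows "(liminf (coeff_ratio \<alpha>) > 0 \<longrightarrow> (SUP SNR\<in>{0<..}. capacity_fb \<Omega> U \<sigma> \<alpha> SNR) < \<infinity>)
    \<and> (limsup (coeff_ratio \<alpha>) = 0 \<longrightarrow> (SUP SNR\<in>{0<..}. capacity \<Omega> U \<sigma> \<alpha> SNR) = \<infinity>)"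
  using capacity_fb_bounded[of \<Omega> U \<sigma> \<alpha>] capacity_unbounded[of \<Omega> U \<sigma> \<alpha>] assms by blast

end
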